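(* In the diffusion setting described in the context, for every discount factor $0<c<1$, \[ \lambda^c=\overline{\delta}^c \leq \overline{d}^c=\ell^c \] pointwise on $E\times E$.
   Context: Setting (diffusion). Let $E$ be a locally compact Hausdorff space with a countable base, with its Borel $\sigma$-algebra; $E$ is Polish and $\Delta$ is a fixed 1-bounded metric generating its topology $\mathcal{O}$. Let $(\hat P_t)_{t\ge 0}$ be an honest Feller–Dynkin semigroup: a strongly continuous semigroup of linear operators on $C_0(E)$ (continuous functions vanishing at infinity, sup norm) with $0\le f\le 1\Rightarrow 0\le \hat P_t f\le 1$, whose associated kernels $P_t(x,\cdot)$ (defined by $\hat P_t f(x)=\int f(y)\,P_t(x,\mathrm{d}y)$) are probability measures; write $P_t(x)=P_t(x,\cdot)$. It is assumed to be a diffusion: the trajectory space is $\Omega=\{\omega:[0,\infty)\to E \text{ continuous}\}$ with the $\sigma$-algebra generated by the evaluations $\omega\mapsto\omega(t)$ and the topology generated by the uniform metric $U(\Delta)(\omega,\omega')=\sup_{t\ge0}\Delta(\omega(t),\omega'(t))$ (treated as a Polish space); for each $x\in E$, $\mathbb{P}^x$ is the probability measure on $\Omega$ whose finite-dimensional distributions are $\mathbb{P}^x(\omega(0)\in\mathrm{d}x_0,\omega(t_1)\in \mathrm{d}x_1,\dots,\omega(t_n)\in\mathrm{d}x_n)=\delta_x(\mathrm{d}x_0)P_{t_1}(x_0,\mathrm{d}x_1)\cdots P_{t_n-t_{n-1}}(x_{n-1},\mathrm{d}x_n)$ for $0<t_1<\dots<t_n$; and $x\mapsto \mathbb{P}^x$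 is weakly continuous. A continuous observable $obs:E\to[0,1]$ is given. Optimal transport: for a Polish space $\mathcal X$, a lower semi-continuous $c:\mathcal X\times\mathcal X\to[0,1]$ with $c(x,x)=0$, and probability measures $\mu,\nu$ on $\mathcal X$, $W(c)(\mu,\nu)=\min_{\gamma\in\Gamma(\mu,\nu)}\int c\,\mathrm{d}\gamma$, where $\Gamma(\mu,\nu)$ is the set of couplings. For a 1-bounded lower semi-continuous pseudometric $m$ on $E$ and $0<c<1$: $\mathcal{F}_c(m)(x,y)=\sup_{t\ge0}c^tW(m)(P_t(x),P_t(y))$; $U_c(m)(\omega,\omega')=\sup_{t\ge0}c^t m(\omega(t),\omega'(t))$ on $\Omega$; $\mathcal{G}_c(m)(x,y)=W(U_c(m))(\mathbb{P}^x,\mathbb{P}^y)$. First pseudometric: $\delta^c_0(x,y)=|obs(x)-obs(y)|$, $\delta^c_{n+1}=\mathcal{F}_c(\delta^c_n)$ for $n\ge 0$, $\overline{\delta}^c=\sup_n\delta^c_n$. Second pseudometric: $d^c_0(x,y)=|obs(x)-obs(y)|$, $d^c_{n+1}=\mathcal{G}_c(d^c_n)$ for $n\ge0$, $\overline{d}^c=\sup_n d^c_n$. Logic $\Lambda$: expressions $f::= q \mid obs\mid \min\{f_1,f_2\}\mid 1-f\mid f\ominus q\mid \langle t\rangle f$ with $q\in\mathbb{Q}\cap[0,1]$, $t\in\mathbb{Q}_{\ge0}$, interpreted as functions $E\to[0,1]$: $q(x)=q$, $obs(x)=obs(x)$, $\min\{f_1,f_2\}(x)=\min\{f_1(x),f_2(x)\}$,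 $(1-f)(x)=1-f(x)$, $(f\ominus q)(x)=\max\{0,f(x)-q\}$, $(\langle t\rangle f)(x)=c^t\int f\,\mathrm{d}P_t(x)$. Then $\lambda^c(x,y)=\sup_{f\in\Lambda}|f(x)-f(y)|$. Logic $\mathcal{L}_\sigma,\mathcal{L}_\tau$ (defined mutually): $f\in\mathcal{L}_\sigma::= q\mid obs\mid 1-f\mid \int g$ and $g\in\mathcal{L}_\tau::= f\circ ev_t\mid \min\{g_1,g_2\}\mid\max\{g_1,g_2\}\mid g\ominus q\mid g\oplus q$, with $q\in\mathbb{Q}\cap[0,1]$, $t\in\mathbb{Q}_{\ge0}$. Elements of $\mathcal{L}_\sigma$ are interpreted as functions $E\to[0,1]$: $q(x)=q$, $obs(x)$, $(1-f)(x)=1-f(x)$, $(\int g)(x)=\int g\,\mathrm{d}\mathbb{P}^x$; elements of $\mathcal{L}_\tau$ as functions $\Omega\to[0,1]$: $(f\circ ev_t)(\omega)=c^tf(\omega(t))$, pointwise min/max, $(g\ominus q)(\omega)=\max\{0,g(\omega)-q\}$, $(g\oplus q)(\omega)=\min\{1,g(\omega)+q\}$. Then $\ell^c(x,y)=\sup_{f\in\mathcal{L}_\sigma}|f(x)-f(y)|$. *)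

theory Defs
  imports "HOL-Probability.Probability"
begin

section \<open>Optimal transport\<close>

definition couplings :: "'a measure \<Rightarrow> 'b measure \<Rightarrow> ('a \<times> 'b) measure set" where
  "couplings \<mu> \<nu> = {\<gamma>. prob_space \<gamma> \<and> sets \<gamma> = sets (\<mu> \<Otimes>\<^sub>M \<nu>) \<and>
     distr \<gamma> \<mu> fst = \<mu> \<and> distr \<gamma> \<nu> snd = \<nu>}"

text \<open>The optimal cost is written as an infimum, which is the minimum whenever the latter is attained.\<close>

definition transport_cost :: "('a \<Rightarrow> 'a \<Rightarrow> real) \<Rightarrow> 'a measure \<Rightarrow> 'a measure \<Rightarrow> real" where
  "transport_cost k \<mu> \<nu> = (INF \<gamma>\<in>couplings \<mu> \<nu>. \<integral>p. k (fst p) (snd p) \<partial>\<gamma>)"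


section \<open>Honest Feller--Dynkin semigroups\<close>

definition C0 :: "('e::topological_space \<Rightarrow> real) set" where
  "C0 = {f. continuous_on UNIV f \<and> (\<forall>\<epsilon>>0. \<exists>K. compact K \<and> (\<forall>x. x \<notin> K \<longrightarrow> \<bar>f x\<bar> < \<epsilon>))}"

text \<open>Operators act on all real functions for convenience; only their restriction to
  \<^const>\<open>C0\<close> and to times \<open>t \<ge> 0\<close> is constrained. By the Riesz representation theorem
  the kernels \<open>P\<close> are determined by \<open>T\<close>; honesty is the requirement that they are
  probability kernels.\<close>

locale honest_feller_dynkin =
  fixes T :: "real \<Rightarrow> ('e::{second_countable_topology, t2_space} \<Rightarrow> real) \<Rightarrow> 'e \<Rightarrow> real"
    and P :: "real \<Rightarrow> 'e \<Rightarrow> 'e measure"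
  assumes maps_C0: "\<And>t f. t \<ge> 0 \<Longrightarrow> f \<in> C0 \<Longrightarrow> T t f \<in> C0"
    and linear: "\<And>t a b f g. t \<ge> 0 \<Longrightarrow> f \<in> C0 \<Longrightarrow> g \<in> C0 \<Longrightarrow>
        T t (\<lambda>x. a * f x + b * g x) = (\<lambda>x. a * T t f x + b * T t g x)"
    and semigroup_zero: "\<And>f. f \<in> C0 \<Longrightarrow> T 0 f = f"
    and semigroup_add: "\<And>s t f. s \<ge> 0 \<Longrightarrow> t \<ge> 0 \<Longrightarrow> f \<in> C0 \<Longrightarrow> T (s + t) f = T s (T t f)"
    and strongly_continuous: "\<And>f. f \<in> C0 \<Longrightarrow> uniform_limit UNIV (\<lambda>t. T t f) f (at_right 0)"
    and sub_markov: "\<And>t f. t \<ge> 0 \<Longrightarrow> f \<in> C0 \<Longrightarrow> (\<And>x. 0 \<le> f x \<and> f x \<le> 1) \<Longrightarrow>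
        (\<And>x. 0 \<le> T t f x \<and> T t f x \<le> 1)"
    and kernel: "\<And>t. t \<ge> 0 \<Longrightarrow> P t \<in> borel \<rightarrow>\<^sub>M prob_algebra borel"
    and kernel_represents: "\<And>t f x. t \<ge> 0 \<Longrightarrow> f \<in> C0 \<Longrightarrow> T t f x = (\<integral>y. f y \<partial>P t x)"


section \<open>Trajectories and diffusions\<close>

text \<open>Trajectories \<open>[0,\<infinity>) \<rightarrow> E\<close>, made into total functions by being
  \<^const>\<open>undefined\<close> at negative times.\<close>

definition trajectories :: "(real \<Rightarrow> 'e::topological_space) set" where
  "trajectories = {\<omega> \<in> extensional {0..}. continuous_on {0..} \<omega>}"

definition trajectory_space :: "(real \<Rightarrow> 'e::topological_space) measure" where
  "trajectory_space = sigma trajectories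
     {{\<omega> \<in> trajectories. \<omega> t \<in> A} | t A. t \<ge> 0 \<and> A \<in> sets borel}"

definition uniform_metric ::
    "('e \<Rightarrow> 'e \<Rightarrow> real) \<Rightarrow> (real \<Rightarrow> 'e) \<Rightarrow> (real \<Rightarrow> 'e) \<Rightarrow> real" where
  "uniform_metric \<Delta> \<omega> \<omega>' = (SUP t\<in>{0..}. \<Delta> (\<omega> t) (\<omega>' t))"

text \<open>For \<open>s < t\<^sub>1 < \<dots> < t\<^sub>n\<close>, the value
  \<open>\<integral> 1\<^bsub>A\<^sub>1\<^esub>(x\<^sub>1) \<dots> 1\<^bsub>A\<^sub>n\<^esub>(x\<^sub>n) P\<^bsub>t\<^sub>1-s\<^esub>(x,dx\<^sub>1) \<dots> P\<^bsub>t\<^sub>n-t\<^sub>n\<^sub>-\<^sub>1\<^esub>(x\<^sub>n\<^sub>-\<^sub>1,dx\<^sub>n)\<close>,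
  the pairs \<open>(t\<^sub>i, A\<^sub>i)\<close> being given as a list.\<close>

primrec fdd :: "(real \<Rightarrow> 'e \<Rightarrow> 'e measure) \<Rightarrow> (real \<times> 'e set) list \<Rightarrow> real \<Rightarrow> 'e \<Rightarrow> ennreal" where
  "fdd P [] s x = 1"
| "fdd P (p # ps) s x =
     (\<integral>\<^sup>+ y. indicator (snd p) y * fdd P ps (fst p) y \<partial>P (fst p - s) x)"

text \<open>Finite-dimensional distributions are given by their values on measurable rectangles.
  Weak continuity refers to the topology of the uniform metric; since that topology may have
  more Borel sets than the evaluations generate, measurability of the test functions is required
  explicitly.\<close>

locale diffusion = honest_feller_dynkin T P
  for T :: "real \<Rightarrow> ('e::{second_countable_topology, t2_space} \<Rightarrow> real) \<Rightarrow> 'e \<Rightarrow> real"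
    and P :: "real \<Rightarrow> 'e \<Rightarrow> 'e measure" +
  fixes \<Delta> :: "'e \<Rightarrow> 'e \<Rightarrow> real"
    and \<P> :: "'e \<Rightarrow> (real \<Rightarrow> 'e) measure"
  assumes locally_compact: "locally_compact_space (euclidean :: 'e topology)"
    and metric: "Metric_space UNIV \<Delta>"
    and metric_topology: "Metric_space.mtopology UNIV \<Delta> = euclidean"
    and metric_le_1: "\<And>x y. \<Delta> x y \<le> 1"
    and path_prob_space: "\<And>x. prob_space (\<P> x)"
    and path_sets: "\<And>x. sets (\<P> x) = sets trajectory_space"
    and path_fdd: "\<And>x A ps. A \<in> sets borel \<Longrightarrow> snd ` set ps \<subseteq> sets borel \<Longrightarrow>
        sorted_wrt (<) (0 # map fst ps) \<Longrightarrow>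
        emeasure (\<P> x) {\<omega> \<in> trajectories. \<omega> 0 \<in> A \<and> (\<forall>p\<in>set ps. \<omega> (fst p) \<in> snd p)} =
        (\<integral>\<^sup>+ y. indicator A y * fdd P ps 0 y \<partial>return borel x)"
    and path_weakly_continuous: "\<And>h :: (real \<Rightarrow> 'e) \<Rightarrow> real.
        h \<in> borel_measurable trajectory_space \<Longrightarrow>
        bounded (h ` trajectories) \<Longrightarrow>
        continuous_map (Metric_space.mtopology trajectories (uniform_metric \<Delta>)) euclidean h \<Longrightarrow>
        continuous_on UNIV (\<lambda>x. \<integral>\<omega>. h \<omega> \<partial>\<P> x)"


section \<open>Behavioural pseudometrics\<close>

definition F_op :: "(real \<Rightarrow> 'e \<Rightarrow> 'e measure) \<Rightarrow> real \<Rightarrow> ('e \<Rightarrow> 'e \<Rightarrow> real) \<Rightarrow> 'e \<Rightarrow> 'e \<Rightarrow> real" where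
  "F_op P c m x y = (SUP t\<in>{0..}. c powr t * transport_cost m (P t x) (P t y))"

definition U_op :: "real \<Rightarrow> ('e \<Rightarrow> 'e \<Rightarrow> real) \<Rightarrow> (real \<Rightarrow> 'e) \<Rightarrow> (real \<Rightarrow> 'e) \<Rightarrow> real" where
  "U_op c m \<omega> \<omega>' = (SUP t\<in>{0..}. c powr t * m (\<omega> t) (\<omega>' t))"

definition G_op :: "('e \<Rightarrow> (real \<Rightarrow> 'e) measure) \<Rightarrow> real \<Rightarrow> ('e \<Rightarrow> 'e \<Rightarrow> real) \<Rightarrow> 'e \<Rightarrow> 'e \<Rightarrow> real" where
  "G_op \<P> c m x y = transport_cost (U_op c m) (\<P> x) (\<P> y)"

primrec delta_seq ::
    "(real \<Rightarrow> 'e \<Rightarrow> 'e measure) \<Rightarrow> ('e \<Rightarrow> real) \<Rightarrow> real \<Rightarrow> nat \<Rightarrow> 'e \<Rightarrow> 'e \<Rightarrow> real" where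
  "delta_seq P obs c 0 = (\<lambda>x y. \<bar>obs x - obs y\<bar>)"
| "delta_seq P obs c (Suc n) = F_op P c (delta_seq P obs c n)"

definition delta_bar ::
    "(real \<Rightarrow> 'e \<Rightarrow> 'e measure) \<Rightarrow> ('e \<Rightarrow> real) \<Rightarrow> real \<Rightarrow> 'e \<Rightarrow> 'e \<Rightarrow> real" where
  "delta_bar P obs c x y = (SUP n. delta_seq P obs c n x y)"

primrec d_seq ::
    "('e \<Rightarrow> (real \<Rightarrow> 'e) measure) \<Rightarrow> ('e \<Rightarrow> real) \<Rightarrow> real \<Rightarrow> nat \<Rightarrow> 'e \<Rightarrow> 'e \<Rightarrow> real" where
  "d_seq \<P> obs c 0 = (\<lambda>x y. \<bar>obs x - obs y\<bar>)"
| "d_seq \<P> obs c (Suc n) = G_op \<P> c (d_seq \<P> obs c n)"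

definition d_bar ::
    "('e \<Rightarrow> (real \<Rightarrow> 'e) measure) \<Rightarrow> ('e \<Rightarrow> real) \<Rightarrow> real \<Rightarrow> 'e \<Rightarrow> 'e \<Rightarrow> real" where
  "d_bar \<P> obs c x y = (SUP n. d_seq \<P> obs c n x y)"


section \<open>Real-valued logics\<close>

typedef unit_rat = "{q::rat. 0 \<le> q \<and> q \<le> 1}"
  by (rule exI[of _ 0]) simp

typedef nonneg_rat = "{q::rat. 0 \<le> q}"
  by (rule exI[of _ 0]) simp

abbreviation unit_val :: "unit_rat \<Rightarrow> real" where
  "unit_val q \<equiv> of_rat (Rep_unit_rat q)"

abbreviation time_val :: "nonneg_rat \<Rightarrow> real" where
  "time_val t \<equiv> of_rat (Rep_nonneg_rat t)"

datatype lam_expr =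
    LConst unit_rat
  | LObs
  | LMin lam_expr lam_expr
  | LCompl lam_expr
  | LMinus lam_expr unit_rat
  | LDiamond nonneg_rat lam_expr

primrec lam_sem ::
    "(real \<Rightarrow> 'e \<Rightarrow> 'e measure) \<Rightarrow> ('e \<Rightarrow> real) \<Rightarrow> real \<Rightarrow> lam_expr \<Rightarrow> 'e \<Rightarrow> real" where
  "lam_sem P obs c (LConst q) = (\<lambda>x. unit_val q)"
| "lam_sem P obs c LObs = obs"
| "lam_sem P obs c (LMin f g) = (\<lambda>x. min (lam_sem P obs c f x) (lam_sem P obs c g x))"
| "lam_sem P obs c (LCompl f) = (\<lambda>x. 1 - lam_sem P obs c f x)"
| "lam_sem P obs c (LMinus f q) = (\<lambda>x. max 0 (lam_sem P obs c f x - unit_val q))"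
| "lam_sem P obs c (LDiamond t f) =
     (\<lambda>x. c powr time_val t * (\<integral>y. lam_sem P obs c f y \<partial>P (time_val t) x))"

definition lam_metric ::
    "(real \<Rightarrow> 'e \<Rightarrow> 'e measure) \<Rightarrow> ('e \<Rightarrow> real) \<Rightarrow> real \<Rightarrow> 'e \<Rightarrow> 'e \<Rightarrow> real" where
  "lam_metric P obs c x y = (SUP f. \<bar>lam_sem P obs c f x - lam_sem P obs c f y\<bar>)"

datatype sigma_expr =
    SConst unit_rat
  | SObs
  | SCompl sigma_expr
  | SInt tau_expr
and tau_expr =
    TEv sigma_expr nonneg_rat
  | TMin tau_expr tau_expr
  | TMax tau_expr tau_expr
  | TMinus tau_expr unit_rat
  | TPlus tau_expr unit_rat

primrec
  sigma_sem ::
    "('e \<Rightarrow> (real \<Rightarrow> 'e) measure) \<Rightarrow> ('e \<Rightarrow> real) \<Rightarrow> real \<Rightarrow> sigma_expr \<Rightarrow> 'e \<Rightarrow> real" and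
  tau_sem ::
    "('e \<Rightarrow> (real \<Rightarrow> 'e) measure) \<Rightarrow> ('e \<Rightarrow> real) \<Rightarrow> real \<Rightarrow> tau_expr \<Rightarrow> (real \<Rightarrow> 'e) \<Rightarrow> real"
where
  "sigma_sem \<P> obs c (SConst q) = (\<lambda>x. unit_val q)"
| "sigma_sem \<P> obs c SObs = obs"
| "sigma_sem \<P> obs c (SCompl f) = (\<lambda>x. 1 - sigma_sem \<P> obs c f x)"
| "sigma_sem \<P> obs c (SInt g) = (\<lambda>x. \<integral>\<omega>. tau_sem \<P> obs c g \<omega> \<partial>\<P> x)"
| "tau_sem \<P> obs c (TEv f t) = (\<lambda>\<omega>. c powr time_val t * sigma_sem \<P> obs c f (\<omega> (time_val t)))"
| "tau_sem \<P> obs c (TMin g h) = (\<lambda>\<omega>. min (tau_sem \<P> obs c g \<omega>) (tau_sem \<P> obs c h \<omega>))"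
| "tau_sem \<P> obs c (TMax g h) = (\<lambda>\<omega>. max (tau_sem \<P> obs c g \<omega>) (tau_sem \<P> obs c h \<omega>))"
| "tau_sem \<P> obs c (TMinus g q) = (\<lambda>\<omega>. max 0 (tau_sem \<P> obs c g \<omega> - unit_val q))"
| "tau_sem \<P> obs c (TPlus g q) = (\<lambda>\<omega>. min 1 (tau_sem \<P> obs c g \<omega> + unit_val q))"

definition ell_metric ::
    "('e \<Rightarrow> (real \<Rightarrow> 'e) measure) \<Rightarrow> ('e \<Rightarrow> real) \<Rightarrow> real \<Rightarrow> 'e \<Rightarrow> 'e \<Rightarrow> real" where
  "ell_metric \<P> obs c x y = (SUP f. \<bar>sigma_sem \<P> obs c f x - sigma_sem \<P> obs c f y\<bar>)"

end

theory Submission imports Defs begin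

text \<open>All four pseudometrics are suprema of \<open>\<bar>f x - f y\<bar>\<close> over families of functions. If a continuous
  pseudometric \<open>m\<close> is such a supremum over the \<open>m\<close>-nonexpansive formulas, then Kantorovich duality,
  restricted to the lattice of nonexpansive formulas, says the same of \<open>G_op \<P> c m\<close> and
  \<open>F_op P c m\<close>. Duality for a bounded cost only needs a countable dense set, which trajectories have
  for \<open>U_op c m\<close>: the space is cut into cells, leaving a finite transport problem. That
  \<open>G_op \<P> c m\<close> is again continuous follows from weak continuity of \<open>\<P>\<close>, as the nonexpansive
  functions are totally bounded up to a small integral. The kernels are the marginals of \<open>\<P>\<close>, so
  \<open>delta_seq P obs c n \<le> d_seq \<P> obs c n\<close>; this also makes the former continuous.\<close>

section \<open>Finite optimal transport\<close>

text \<open>The formulas are closed only under lattice operations, rational shifts and complements,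
  so an optimal potential need not be one of them. The duality proof therefore asks for a potential
  only at finitely many points and up to an error. No optimal coupling is constructed either, as
  near-optimal ones determine an infimum.

  Knowing that an iterate is a supremum over formulas pays twice: the pseudometric axioms follow
  without gluing couplings, and of continuity only smallness near the diagonal is left to prove. For
  \<open>F_op\<close> that smallness is the obstacle, since its supremum ranges over all times and
  the continuity in \<open>x\<close> at each single time does not add up; a path measure controls
  all times at once. The discount is what makes trajectories tractable: as \<open>m\<close> is at
  most 1, times beyond a horizon contribute little to \<open>U_op c m\<close>, and on the compact
  time interval that is left, continuity allows countably many approximate shapes only.\<close>

lemma nonneg_if_quadratic_nonneg:
  fixes B M :: real
  assumes "\<And>\<theta>. 0 < \<theta> \<Longrightarrow> \<theta> \<le> 1 \<Longrightarrow> 0 \<le> 2 * \<theta> * B + \<theta>\<^sup>2 * M"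
  shows "0 \<le> B"
proof (rule ccontr)
  assume "\<not> 0 \<le> B"
  then have B: "B < 0" by simp
  \<comment> \<open>Small enough that \<open>\<theta> * M\<close> is at most \<open>- B\<close>;
    then \<open>2 * B + \<theta> * M\<close> is at most \<open>B\<close> and the first-order term
    wins.\<close>
  define \<theta> where "\<theta> = min 1 (- B / (\<bar>M\<bar> + 1))"
  have t: "0 < \<theta>" "\<theta> \<le> 1" using B by (auto simp: \<theta>_def divide_neg_pos)
  have "\<theta> * (\<bar>M\<bar> + 1) \<le> - B / (\<bar>M\<bar> + 1) * (\<bar>M\<bar> + 1)"
    by (intro mult_right_mono) (auto simp: \<theta>_def)
  then have "\<theta> * (\<bar>M\<bar> + 1) \<le> - B" by simp
  moreover have "\<theta> * M \<le> \<theta> * (\<bar>M\<bar> + 1)" using t by (intro mult_left_mono) auto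
  ultimately have "2 * B + \<theta> * M < 0" using B by linarith
  then have "\<theta> * (2 * B + \<theta> * M) < 0" using t by (simp add: mult_pos_neg)
  moreover have "0 \<le> \<theta> * (2 * B + \<theta> * M)"
    using assms[OF t] by (simp add: algebra_simps power2_eq_square)
  ultimately show False by simp
qed

text \<open>The square of the positive part has derivative \<open>2 * max 0 x\<close>, which is
  2-Lipschitz, so its tangent parabola with leading coefficient 1 lies above it. This handles the
  penalty of the one-sided constraint on the cost; those of the marginals are genuine
  squares.\<close>

lemma max_square_le:
  fixes x h :: real
  shows "(max 0 (x + h))\<^sup>2 \<le> (max 0 x)\<^sup>2 + 2 * h * max 0 x + h\<^sup>2"
proof -
  consider "0 \<le> x" "0 \<le> x + h" | "0 \<le> x" "x + h < 0" | "x < 0" "0 \<le> x + h" | "x < 0" "x + h < 0"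
    by linarith
  then show ?thesis
  proof cases
    case 2
    have "0 \<le> (x + h)\<^sup>2" by simp
    with 2 show ?thesis by (simp add: power2_eq_square algebra_simps)
  next
    case 3
    then have "(x + h)\<^sup>2 \<le> h\<^sup>2" by (intro power_mono) auto
    with 3 show ?thesis by simp
  qed (simp_all add: power2_eq_square algebra_simps)
qed

text \<open>Only the coordinates in \<open>I\<close> enter the sum; the others stay free in the unit
  interval, which leaves a closed part of a Tychonoff cube in the full function space.\<close>

lemma compact_simplex:
  fixes I :: "'i::countable set"
  assumes "finite I"
  shows "compact {e :: 'i \<Rightarrow> real. (\<forall>z. 0 \<le> e z \<and> e z \<le> 1) \<and> sum e I = 1}"
proof -
  have "compact (PiE UNIV (\<lambda>z::'i. {0..1::real}))"
    using compactin_PiE[of "\<lambda>_::'i. euclidean :: real topology" UNIV "\<lambda>_. {0..1}"]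
    by (simp add: euclidean_product_topology)
  moreover have "closed {e :: 'i \<Rightarrow> real. sum e I = 1}"
    by (intro closed_Collect_eq continuous_intros continuous_on_product_coordinates)
  ultimately have "compact (PiE UNIV (\<lambda>z::'i. {0..1::real}) \<inter> {e. sum e I = 1})"
    by (rule compact_Int_closed)
  moreover have "PiE UNIV (\<lambda>z::'i. {0..1::real}) \<inter> {e. sum e I = 1} =
      {e. (\<forall>z. 0 \<le> e z \<and> e z \<le> 1) \<and> sum e I = 1}" by auto
  ultimately show ?thesis by simp
qed

text \<open>The \<open>C\<close>-transform \<open>f i = min_j (C i j - \<psi> j)\<close> replaces a
  pair of potentials by one: it is nonexpansive by the triangle inequality, lies above \<phi> by
  \<open>le\<close>, and \<open>- f\<close> lies above \<psi> because \<open>C\<close> vanishes on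
  the diagonal. So the dual value can only grow.\<close>

lemma Lipschitz_potential:
  fixes C :: "nat \<Rightarrow> nat \<Rightarrow> real"
  assumes p0: "\<And>i. 0 \<le> p i" and q0: "\<And>i. 0 \<le> q i"
    and p1: "(\<Sum>i\<le>n. p i) = 1" and q1: "(\<Sum>i\<le>n. q i) = 1"
    and C: "\<And>i j. C i j \<le> 1" "\<And>i. C i i = 0"
      "\<And>i j k. C i k \<le> C i j + C j k"
    and le: "\<And>i j. i \<le> n \<Longrightarrow> j \<le> n \<Longrightarrow> \<phi> i + \<psi> j \<le> C i j"
  obtains u :: "nat \<Rightarrow> real" where "\<And>i. i \<le> n \<Longrightarrow> 0 \<le> u i \<and> u i \<le> 1"
    "\<And>i j. i \<le> n \<Longrightarrow> j \<le> n \<Longrightarrow> u i - u j \<le> C i j"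
    "(\<Sum>i\<le>n. \<phi> i * p i) + (\<Sum>j\<le>n. \<psi> j * q j) \<le> (\<Sum>i\<le>n. u i * (p i - q i))"
proof -
  define f where "f i = Min ((\<lambda>j. C i j - \<psi> j) ` {..n})" for i
  have f_le: "f i \<le> C i j - \<psi> j" if "j \<le> n" for i j
    unfolding f_def using that by (intro Min_le) auto
  have f_ge: "a \<le> f i" if "\<And>j. j \<le> n \<Longrightarrow> a \<le> C i j - \<psi> j" for a i
    unfolding f_def using that by (intro Min.boundedI) auto
  have lip: "f i - f j \<le> C i j" for i j
  proof -
    have "f i - C i j \<le> f j"
      by (rule f_ge) (use f_le[of _ i] C(3)[of i _ j] in \<open>smt (verit)\<close>)
    then show ?thesis by simp
  qed
  \<comment> \<open>Shifting by the minimum puts the potential into the unit interval, since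
    \<open>f\<close> oscillates by at most 1. The shift leaves the dual value alone because both
    masses are 1.\<close>
  define b where "b = Min (f ` {..n})"
  have b_le: "b \<le> f i" if "i \<le> n" for i unfolding b_def using that by (intro Min_le) auto
  have "b \<in> f ` {..n}" unfolding b_def by (intro Min_in) auto
  then obtain l where l: "b = f l" by auto
  define u where "u i = f i - b" for i
  show thesis
  proof (rule that[of u])
    show "0 \<le> u i \<and> u i \<le> 1" if "i \<le> n" for i
      using b_le[OF that] lip[of i l] C(1)[of i l] by (auto simp: u_def l)
    show "u i - u j \<le> C i j" for i j using lip[of i j] by (simp add: u_def)
    have "(\<Sum>i\<le>n. \<phi> i * p i) \<le> (\<Sum>i\<le>n. f i * p i)"
      using p0 by (intro sum_mono mult_right_mono f_ge) (auto simp: le le_diff_eq)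
    moreover have "(\<Sum>j\<le>n. \<psi> j * q j) \<le> (\<Sum>j\<le>n. - f j * q j)"
    proof (intro sum_mono mult_right_mono q0)
      fix j assume "j \<in> {..n}"
      then show "\<psi> j \<le> - f j" using f_le[of j j] C(2)[of j] by auto
    qed
    moreover have "(\<Sum>i\<le>n. u i * (p i - q i)) = (\<Sum>i\<le>n. f i * p i) + (\<Sum>j\<le>n. - f j * q j)"
    proof -
      have "(\<Sum>i\<le>n. u i * (p i - q i)) =
          (\<Sum>i\<le>n. f i * p i + - f i * q i + b * q i - b * p i)"
        by (intro sum.cong refl) (simp add: u_def algebra_simps)
      also have "\<dots> = (\<Sum>i\<le>n. f i * p i) + (\<Sum>j\<le>n. - f j * q j) + b * (\<Sum>i\<le>n. q i) - b * (\<Sum>i\<le>n. p i)"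
        by (simp add: sum.distrib sum_subtractf sum_distrib_left sum_negf)
      finally show ?thesis using p1 q1 by simp
    qed
    ultimately show "(\<Sum>i\<le>n. \<phi> i * p i) + (\<Sum>j\<le>n. \<psi> j * q j) \<le> (\<Sum>i\<le>n. u i * (p i - q i))"
      by linarith
  qed
qed

text \<open>A minimiser of the quadratic penalty for violating the two marginal constraints and the cost
  bound satisfies all three, as otherwise the residuals would be potentials contradicting the bound
  on the dual problem.\<close>

lemma finite_transport_duality:
  fixes C :: "nat \<Rightarrow> nat \<Rightarrow> real"
  assumes p0: "\<And>i. 0 \<le> p i" and q0: "\<And>i. 0 \<le> q i"
    and p1: "(\<Sum>i\<le>n. p i) = 1" and q1: "(\<Sum>i\<le>n. q i) = 1"
    and C: "\<And>i j. C i j \<le> 1" "\<And>i. C i i = 0"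
      "\<And>i j k. C i k \<le> C i j + C j k"
    and dual: "\<And>\<phi>. (\<And>i. i \<le> n \<Longrightarrow> 0 \<le> \<phi> i \<and> \<phi> i \<le> 1) \<Longrightarrow>
        (\<And>i j. i \<le> n \<Longrightarrow> j \<le> n \<Longrightarrow> \<phi> i - \<phi> j \<le> C i j) \<Longrightarrow>
        (\<Sum>i\<le>n. \<phi> i * (p i - q i)) \<le> V"
  obtains \<pi> :: "nat \<Rightarrow> nat \<Rightarrow> real" where "\<And>i j. 0 \<le> \<pi> i j"
    "\<And>i. i \<le> n \<Longrightarrow> (\<Sum>j\<le>n. \<pi> i j) = p i" "\<And>j. j \<le> n \<Longrightarrow> (\<Sum>i\<le>n. \<pi> i j) = q j"
    "(\<Sum>i\<le>n. \<Sum>j\<le>n. \<pi> i j * C i j) \<le> V"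
proof -
  define I where "I = {..n} \<times> {..n}"
  define K where "K = {e :: nat \<times> nat \<Rightarrow> real. (\<forall>z. 0 \<le> e z \<and> e z \<le> 1) \<and> sum e I = 1}"
  define r where "r e i = (\<Sum>j\<le>n. e (i, j))" for e :: "nat \<times> nat \<Rightarrow> real" and i
  define s where "s e j = (\<Sum>i\<le>n. e (i, j))" for e :: "nat \<times> nat \<Rightarrow> real" and j
  define k where "k e = (\<Sum>i\<le>n. \<Sum>j\<le>n. e (i, j) * C i j)" for e :: "nat \<times> nat \<Rightarrow> real"
  define Q where "Q e = (\<Sum>i\<le>n. (r e i - p i)\<^sup>2) + (\<Sum>j\<le>n. (s e j - q j)\<^sup>2) + (max 0 (k e - V))\<^sup>2" for e
  have "finite I" by (simp add: I_def)
  then have "compact K" unfolding K_def by (rule compact_simplex)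
  moreover have delta_K: "(\<lambda>z. if z = (i, j) then 1 else 0) \<in> K" if "i \<le> n" "j \<le> n" for i j
    using that \<open>finite I\<close> by (auto simp: K_def I_def sum.delta)
  then have "K \<noteq> {}" by blast
  moreover have "continuous_on K Q"
    unfolding Q_def r_def s_def k_def
    by (intro continuous_intros continuous_on_subset[OF continuous_on_product_coordinates]) auto
  ultimately obtain e where e: "e \<in> K" and min: "\<And>e'. e' \<in> K \<Longrightarrow> Q e \<le> Q e'"
    using continuous_attains_inf[of K Q] by blast
  define a where "a i = r e i - p i" for i
  define b where "b j = s e j - q j" for j
  define t where "t = max 0 (k e - V)"
  \<comment> \<open>Half the derivative of \<open>Q\<close> at the minimiser, as a linear function
    of the plan. Minimality of \<open>Q\<close> on the convex set \<open>K\<close> makes the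
    minimiser also minimise \<open>L\<close>.\<close>
  define L where "L e = (\<Sum>i\<le>n. a i * r e i) + (\<Sum>j\<le>n. b j * s e j) + t * k e" for e
  have L_min: "L e \<le> L e'" if e': "e' \<in> K" for e'
  proof -
    define M where "M = (\<Sum>i\<le>n. (r e' i - r e i)\<^sup>2) + (\<Sum>j\<le>n. (s e' j - s e j)\<^sup>2) + (k e' - k e)\<^sup>2"
    have "0 \<le> 2 * \<theta> * (L e' - L e) + \<theta>\<^sup>2 * M" if t01: "0 < \<theta>" "\<theta> \<le> 1" for \<theta>
    proof -
      define g where "g = (\<lambda>z. e z + \<theta> * (e' z - e z))"
      have r: "r g i = r e i + \<theta> * (r e' i - r e i)" for i
        by (simp add: r_def g_def sum.distrib sum_distrib_left sum_subtractf right_diff_distrib)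
      have s: "s g i = s e i + \<theta> * (s e' i - s e i)" for i
        by (simp add: s_def g_def sum.distrib sum_distrib_left sum_subtractf right_diff_distrib)
      have kg: "k g = k e + \<theta> * (k e' - k e)"
        by (simp add: k_def g_def sum.distrib sum_distrib_left sum_subtractf algebra_simps)
      have geq: "g z = (1 - \<theta>) * e z + \<theta> * e' z" for z by (simp add: g_def algebra_simps)
      have "sum g I = (1 - \<theta>) * sum e I + \<theta> * sum e' I"
        by (simp add: geq sum.distrib sum_distrib_left)
      then have "sum g I = 1" using e e' by (simp add: K_def)
      moreover have "0 \<le> g z \<and> g z \<le> 1" for z
      proof -
        have "0 \<le> e z" "e z \<le> 1" "0 \<le> e' z" "e' z \<le> 1" using e e' unfolding K_def by blast+
        then show ?thesis unfolding geq using t01 convex_bound_le[of "e z" 1 "e' z" "1 - \<theta>" \<theta>]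
          by auto
      qed
      ultimately have "g \<in> K" by (simp add: K_def)
      then have "Q e \<le> Q g" by (rule min)
      also have "Q g \<le> Q e + 2 * \<theta> * (L e' - L e) + \<theta>\<^sup>2 * M"
      proof -
        have "(\<Sum>i\<le>n. (r g i - p i)\<^sup>2) = (\<Sum>i\<le>n. (r e i - p i)\<^sup>2) +
            2 * \<theta> * ((\<Sum>i\<le>n. a i * r e' i) - (\<Sum>i\<le>n. a i * r e i)) + \<theta>\<^sup>2 * (\<Sum>i\<le>n. (r e' i - r e i)\<^sup>2)"
          unfolding sum_distrib_left sum_subtractf[symmetric] sum.distrib[symmetric] r a_def
          by (intro sum.cong refl) (simp add: power2_eq_square algebra_simps)
        moreover have "(\<Sum>j\<le>n. (s g j - q j)\<^sup>2) = (\<Sum>j\<le>n. (s e j - q j)\<^sup>2) +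
            2 * \<theta> * ((\<Sum>j\<le>n. b j * s e' j) - (\<Sum>j\<le>n. b j * s e j)) + \<theta>\<^sup>2 * (\<Sum>j\<le>n. (s e' j - s e j)\<^sup>2)"
          unfolding sum_distrib_left sum_subtractf[symmetric] sum.distrib[symmetric] s b_def
          by (intro sum.cong refl) (simp add: power2_eq_square algebra_simps)
        moreover have "(max 0 (k g - V))\<^sup>2 \<le>
            (max 0 (k e - V))\<^sup>2 + 2 * \<theta> * (t * k e' - t * k e) + \<theta>\<^sup>2 * (k e' - k e)\<^sup>2"
        proof -
          have "k g - V = (k e - V) + \<theta> * (k e' - k e)" by (simp add: kg)
          moreover have "2 * (\<theta> * (k e' - k e)) * t = 2 * \<theta> * (t * k e' - t * k e)"
            by (simp add: algebra_simps)
          ultimately show ?thesis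
            using max_square_le[of "k e - V" "\<theta> * (k e' - k e)"]
            by (simp only: t_def power_mult_distrib)
        qed
        ultimately show ?thesis unfolding Q_def L_def M_def by (simp add: algebra_simps)
      qed
      finally show ?thesis by simp
    qed
    then show ?thesis using nonneg_if_quadratic_nonneg[of "L e' - L e" M] by simp
  qed
  have Le: "L e = Q e + (\<Sum>i\<le>n. a i * p i) + (\<Sum>j\<le>n. b j * q j) + t * V"
  proof -
    have "(\<Sum>i\<le>n. a i * r e i) = (\<Sum>i\<le>n. (r e i - p i)\<^sup>2) + (\<Sum>i\<le>n. a i * p i)"
      unfolding sum.distrib[symmetric] a_def by (intro sum.cong refl) (simp add: power2_eq_square algebra_simps)
    moreover have "(\<Sum>j\<le>n. b j * s e j) = (\<Sum>j\<le>n. (s e j - q j)\<^sup>2) + (\<Sum>j\<le>n. b j * q j)"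
      unfolding sum.distrib[symmetric] b_def by (intro sum.cong refl) (simp add: power2_eq_square algebra_simps)
    moreover have "t * k e = (max 0 (k e - V))\<^sup>2 + t * V"
      unfolding t_def by (auto simp: max_def power2_eq_square algebra_simps)
    ultimately show ?thesis unfolding L_def Q_def by simp
  qed
  \<comment> \<open>Testing the linear function \<open>L\<close> on the point mass at
    \<open>(i, j)\<close> gives one inequality per pair: up to sign, the residuals \<open>a\<close>
    and \<open>b\<close> are dual potentials for the cost scaled by \<open>t\<close>, with surplus
    \<open>Q e\<close>.\<close>
  have key: "Q e + (\<Sum>i\<le>n. a i * p i) + (\<Sum>j\<le>n. b j * q j) + t * V \<le> a i + b j + t * C i j"
    if ij: "i \<le> n" "j \<le> n" for i j
  proof -
    let ?d = "\<lambda>z. if z = (i, j) then 1 else 0 :: real"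
    have r: "r ?d i' = (if i' = i then 1 else 0)" for i'
    proof -
      have "r ?d i' = (\<Sum>j'\<le>n. if j' = j then (if i' = i then 1 else 0) else 0)"
        unfolding r_def by (intro sum.cong) auto
      then show ?thesis using ij by simp
    qed
    have s: "s ?d j' = (if j' = j then 1 else 0)" for j'
    proof -
      have "s ?d j' = (\<Sum>i'\<le>n. if i' = i then (if j' = j then 1 else 0) else 0)"
        unfolding s_def by (intro sum.cong) auto
      then show ?thesis using ij by simp
    qed
    have k: "k ?d = C i j"
    proof -
      have "(\<Sum>j'\<le>n. ?d (i', j') * C i' j') = (if i' = i then C i j else 0)" for i'
      proof -
        have "(\<Sum>j'\<le>n. ?d (i', j') * C i' j') = (\<Sum>j'\<le>n. if j' = j then (if i' = i then C i j else 0) else 0)"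
          by (intro sum.cong) auto
        then show ?thesis using ij by simp
      qed
      then show ?thesis unfolding k_def using ij by simp
    qed
    have "L ?d = a i + b j + t * C i j"
      unfolding L_def r s k using ij by (simp add: if_distrib[of "(*) _"] cong: if_cong)
    then show ?thesis using L_min[OF delta_K[OF ij]] Le by simp
  qed
  have "Q e \<le> 0"
  proof (rule ccontr)
    assume "\<not> Q e \<le> 0"
    then have Q: "0 < Q e" by simp
    define S where "S = (\<Sum>i\<le>n. a i * p i) + (\<Sum>j\<le>n. b j * q j)"
    have t0: "0 \<le> t" by (simp add: t_def)
    show False
    proof (cases "t = 0")
      case True
      \<comment> \<open>The cost bound holds in this case. Averaging over the product plan
        \<open>p i * q j\<close>, which has the right marginals, turns the right-hand side into
        \<open>S\<close>, so the surplus cannot be positive.\<close>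
      have "Q e + S \<le> a i + b j" if "i \<le> n" "j \<le> n" for i j
        using key[OF that] True by (simp add: S_def)
      then have "(\<Sum>i\<le>n. \<Sum>j\<le>n. (p i * q j) * (Q e + S)) \<le> (\<Sum>i\<le>n. \<Sum>j\<le>n. (p i * q j) * (a i + b j))"
        using p0 q0 by (intro sum_mono mult_left_mono) auto
      moreover have "(\<Sum>i\<le>n. \<Sum>j\<le>n. (p i * q j) * (Q e + S)) = Q e + S"
        using p1 q1 by (simp add: sum_distrib_right[symmetric] sum_distrib_left[symmetric])
      moreover have "(\<Sum>i\<le>n. \<Sum>j\<le>n. (p i * q j) * (a i + b j)) = S"
      proof -
        have "(\<Sum>i\<le>n. \<Sum>j\<le>n. (p i * q j) * (a i + b j)) =
            (\<Sum>i\<le>n. a i * p i * (\<Sum>j\<le>n. q j) + p i * (\<Sum>j\<le>n. b j * q j))"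
          unfolding sum_distrib_left sum.distrib[symmetric]
          by (intro sum.cong refl) (simp add: algebra_simps)
        then show ?thesis
          unfolding q1 S_def by (simp add: sum.distrib sum_distrib_right[symmetric] p1)
      qed
      ultimately show False using Q by simp
    next
      case False
      then have t: "0 < t" using t0 by simp
      \<comment> \<open>After division by \<open>t\<close> the negated residuals are potentials for
        \<open>C\<close> itself; the constant \<kappa>, added to the first, collects the left-hand
        side. The dual value becomes \<open>V + Q e / t\<close>, above the assumed bound
        \<open>V\<close>.\<close>
      define \<kappa> where "\<kappa> = (Q e + S) / t + V"
      have "(\<kappa> - a i / t) + (- b j / t) \<le> C i j" if "i \<le> n" "j \<le> n" for i j
      proof -
        have "Q e + S + t * V \<le> a i + b j + t * C i j" using key[OF that] by (simp add: S_def)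
        then have "(Q e + S + t * V) / t \<le> (a i + b j + t * C i j) / t"
          using t by (intro divide_right_mono) auto
        then show ?thesis using t by (simp add: \<kappa>_def add_divide_distrib)
      qed
      then obtain u where u: "\<And>i. i \<le> n \<Longrightarrow> 0 \<le> u i \<and> u i \<le> 1"
          "\<And>i j. i \<le> n \<Longrightarrow> j \<le> n \<Longrightarrow> u i - u j \<le> C i j"
          "(\<Sum>i\<le>n. (\<kappa> - a i / t) * p i) + (\<Sum>j\<le>n. (- b j / t) * q j) \<le> (\<Sum>i\<le>n. u i * (p i - q i))"
        using Lipschitz_potential[of p q n C "\<lambda>i. \<kappa> - a i / t" "\<lambda>j. - b j / t"] p0 q0 p1 q1 C by blast
      have "(\<Sum>i\<le>n. (\<kappa> - a i / t) * p i) + (\<Sum>j\<le>n. (- b j / t) * q j) = \<kappa> - S / t"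
      proof -
        have "(\<Sum>i\<le>n. (\<kappa> - a i / t) * p i) = \<kappa> * (\<Sum>i\<le>n. p i) - (\<Sum>i\<le>n. a i * p i) / t"
          by (simp add: left_diff_distrib sum_subtractf sum_distrib_left sum_divide_distrib)
        moreover have "(\<Sum>j\<le>n. (- b j / t) * q j) = - (\<Sum>j\<le>n. b j * q j) / t"
          by (simp add: sum_divide_distrib sum_negf)
        ultimately show ?thesis by (simp add: p1 S_def add_divide_distrib)
      qed
      moreover have "\<kappa> - S / t = V + Q e / t" by (simp add: \<kappa>_def add_divide_distrib)
      moreover have "(\<Sum>i\<le>n. u i * (p i - q i)) \<le> V" using u by (intro dual) auto
      moreover have "0 < Q e / t" using Q t by simp
      ultimately show False using u(3) by linarith
    qed
  qed
  have nn: "0 \<le> (\<Sum>i\<le>n. (r e i - p i)\<^sup>2)" "0 \<le> (\<Sum>j\<le>n. (s e j - q j)\<^sup>2)" "0 \<le> (max 0 (k e - V))\<^sup>2"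
    by (auto intro: sum_nonneg)
  have "(\<Sum>i\<le>n. (r e i - p i)\<^sup>2) = 0" "(\<Sum>j\<le>n. (s e j - q j)\<^sup>2) = 0" and t: "(max 0 (k e - V))\<^sup>2 = 0"
    using nn \<open>Q e \<le> 0\<close> unfolding Q_def by linarith+
  then have "\<And>i. i \<le> n \<Longrightarrow> r e i = p i" "\<And>j. j \<le> n \<Longrightarrow> s e j = q j"
    by (simp_all add: sum_nonneg_eq_0_iff)
  moreover have "k e \<le> V" using t by simp
  moreover have "0 \<le> e z" for z using e unfolding K_def by blast
  ultimately show thesis
    by (intro that[of "\<lambda>i j. e (i, j)"]) (simp_all add: r_def s_def k_def)
qed

section \<open>Couplings and weak duality\<close>

lemma couplingsD:
  assumes "\<gamma> \<in> couplings \<mu> \<nu>" "prob_space \<mu>" "prob_space \<nu>"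
  shows "prob_space \<gamma>" "sets \<gamma> = sets (\<mu> \<Otimes>\<^sub>M \<nu>)"
    "fst \<in> \<gamma> \<rightarrow>\<^sub>M \<mu>" "snd \<in> \<gamma> \<rightarrow>\<^sub>M \<nu>"
    "distr \<gamma> \<mu> fst = \<mu>" "distr \<gamma> \<nu> snd = \<nu>"
proof -
  show s: "sets \<gamma> = sets (\<mu> \<Otimes>\<^sub>M \<nu>)" using assms by (simp add: couplings_def)
  show "fst \<in> \<gamma> \<rightarrow>\<^sub>M \<mu>" "snd \<in> \<gamma> \<rightarrow>\<^sub>M \<nu>"
    by (simp_all add: measurable_cong_sets[OF s refl])
qed (use assms in \<open>simp_all add: couplings_def\<close>)

text \<open>Ensures that the infimum defining \<open>transport_cost\<close> is over a nonempty set,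
  without which no lower bound on it could be inferred from the couplings.\<close>

lemma pair_measure_in_couplings:
  assumes "prob_space \<mu>" "prob_space \<nu>"
  shows "\<mu> \<Otimes>\<^sub>M \<nu> \<in> couplings \<mu> \<nu>"
proof -
  interpret \<mu>: prob_space \<mu> by fact
  interpret \<nu>: prob_space \<nu> by fact
  interpret pair_prob_space \<mu> \<nu> ..
  have "distr (\<mu> \<Otimes>\<^sub>M \<nu>) \<mu> fst = \<mu>" by (rule \<nu>.distr_pair_fst)
  moreover have "distr (\<mu> \<Otimes>\<^sub>M \<nu>) \<nu> snd = \<nu>"
  proof (rule measure_eqI)
    fix A assume "A \<in> sets (distr (\<mu> \<Otimes>\<^sub>M \<nu>) \<nu> snd)"
    then have A: "A \<in> sets \<nu>" by simp
    then have "snd -` A \<inter> space (\<mu> \<Otimes>\<^sub>M \<nu>) = space \<mu> \<times> A"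
      by (auto simp: space_pair_measure dest: sets.sets_into_space)
    with A show "emeasure (distr (\<mu> \<Otimes>\<^sub>M \<nu>) \<nu> snd) A = emeasure \<nu> A"
      by (simp add: emeasure_distr \<nu>.emeasure_pair_measure_Times \<mu>.emeasure_space_1)
  qed simp
  ultimately show ?thesis using prob_space_axioms by (simp add: couplings_def)
qed

lemma transport_cost_le:
  assumes "\<gamma> \<in> couplings \<mu> \<nu>" "\<And>x y. 0 \<le> k x y"
  shows "transport_cost k \<mu> \<nu> \<le> (\<integral>p. k (fst p) (snd p) \<partial>\<gamma>)"
  unfolding transport_cost_def using assms
  by (intro cINF_lower bdd_belowI2[where m=0]) (auto intro!: integral_nonneg)

lemma transport_cost_greatest:
  assumes "prob_space \<mu>" "prob_space \<nu>"
    and "\<And>\<gamma>. \<gamma> \<in> couplings \<mu> \<nu> \<Longrightarrow> a \<le> (\<integral>p. k (fst p) (snd p) \<partial>\<gamma>)"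
  shows "a \<le> transport_cost k \<mu> \<nu>"
  unfolding transport_cost_def using assms pair_measure_in_couplings[of \<mu> \<nu>]
  by (intro cINF_greatest) auto

lemma transport_cost_nonneg:
  assumes "prob_space \<mu>" "prob_space \<nu>" "\<And>x y. 0 \<le> k x y"
  shows "0 \<le> transport_cost k \<mu> \<nu>"
  using assms by (intro transport_cost_greatest) (auto intro!: integral_nonneg)

lemma integrable_unit_interval:
  fixes f :: "'a \<Rightarrow> real"
  assumes "prob_space \<mu>" "f \<in> borel_measurable \<mu>" "\<And>x. x \<in> space \<mu> \<Longrightarrow> 0 \<le> f x \<and> f x \<le> 1"
  shows "integrable \<mu> f"
proof -
  interpret prob_space \<mu> by fact
  show ?thesis using assms by (intro integrable_const_bound[where B=1]) (auto intro!: AE_I2)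
qed

lemma integral_unit_interval:
  fixes f :: "'a \<Rightarrow> real"
  assumes "prob_space \<mu>" "f \<in> borel_measurable \<mu>" "\<And>x. x \<in> space \<mu> \<Longrightarrow> 0 \<le> f x \<and> f x \<le> 1"
  shows "0 \<le> (\<integral>x. f x \<partial>\<mu>) \<and> (\<integral>x. f x \<partial>\<mu>) \<le> 1"
proof -
  interpret prob_space \<mu> by fact
  have "(\<integral>x. f x \<partial>\<mu>) \<le> (\<integral>x. 1 \<partial>\<mu>)"
    using integrable_unit_interval[OF assms] assms by (intro integral_mono) auto
  moreover have "0 \<le> (\<integral>x. f x \<partial>\<mu>)" using assms by (intro integral_nonneg_AE AE_I2) auto
  ultimately show ?thesis by (simp add: prob_space)
qed

lemma transport_cost_le_1:
  assumes "prob_space \<mu>" "prob_space \<nu>" "\<And>x y. 0 \<le> k x y \<and> k x y \<le> 1"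
    "(\<lambda>p. k (fst p) (snd p)) \<in> borel_measurable (\<mu> \<Otimes>\<^sub>M \<nu>)"
  shows "transport_cost k \<mu> \<nu> \<le> 1"
proof -
  note c = pair_measure_in_couplings[OF assms(1,2)]
  have "transport_cost k \<mu> \<nu> \<le> (\<integral>p. k (fst p) (snd p) \<partial>(\<mu> \<Otimes>\<^sub>M \<nu>))"
    using assms c by (intro transport_cost_le) auto
  also have "\<dots> \<le> 1"
    using integral_unit_interval[of "\<mu> \<Otimes>\<^sub>M \<nu>" "\<lambda>p. k (fst p) (snd p)"] c assms
    by (simp add: couplings_def)
  finally show ?thesis .
qed

text \<open>Under any coupling the difference of the two integrals is the integral of
  \<open>h (fst p) - h (snd p)\<close>, which \<open>k\<close> dominates pointwise. Measurability of
  \<open>k\<close> secures its integrability; the Bochner integral of a non-integrable cost would be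
  0 by convention.\<close>

lemma transport_weak_duality:
  fixes h :: "'a \<Rightarrow> real"
  assumes ps: "prob_space \<mu>" "prob_space \<nu>" and sets: "sets \<nu> = sets \<mu>"
    and k: "\<And>x y. 0 \<le> k x y \<and> k x y \<le> 1"
      "(\<lambda>p. k (fst p) (snd p)) \<in> borel_measurable (\<mu> \<Otimes>\<^sub>M \<nu>)"
    and h: "h \<in> borel_measurable \<mu>" "\<And>x. x \<in> space \<mu> \<Longrightarrow> 0 \<le> h x \<and> h x \<le> 1"
      "\<And>x y. x \<in> space \<mu> \<Longrightarrow> y \<in> space \<mu> \<Longrightarrow> \<bar>h x - h y\<bar> \<le> k x y"
  shows "\<bar>(\<integral>x. h x \<partial>\<mu>) - (\<integral>x. h x \<partial>\<nu>)\<bar> \<le> transport_cost k \<mu> \<nu>"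
proof (intro transport_cost_greatest ps)
  fix \<gamma> assume \<gamma>: "\<gamma> \<in> couplings \<mu> \<nu>"
  note D = couplingsD[OF \<gamma> ps]
  interpret prob_space \<gamma> by (rule D)
  have sp: "space \<nu> = space \<mu>" using sets by (rule sets_eq_imp_space_eq)
  have spg: "space \<gamma> = space \<mu> \<times> space \<mu>"
    using sets_eq_imp_space_eq[OF D(2)] by (simp add: space_pair_measure sp)
  have h': "h \<in> borel_measurable \<nu>" using h(1) measurable_cong_sets[OF sets refl] by blast
  have k': "(\<lambda>p. k (fst p) (snd p)) \<in> borel_measurable \<gamma>"
    using k(2) measurable_cong_sets[OF D(2) refl] by blast
  have m: "(\<lambda>p. h (fst p)) \<in> borel_measurable \<gamma>" "(\<lambda>p. h (snd p)) \<in> borel_measurable \<gamma>"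
    using measurable_compose[OF D(3) h(1)] measurable_compose[OF D(4) h'] by auto
  have i: "integrable \<gamma> (\<lambda>p. h (fst p))" "integrable \<gamma> (\<lambda>p. h (snd p))"
    "integrable \<gamma> (\<lambda>p. k (fst p) (snd p))"
    using m k' h(2) k(1) spg by (auto intro!: integrable_unit_interval D(1))
  have "(\<integral>x. h x \<partial>\<mu>) = (\<integral>p. h (fst p) \<partial>\<gamma>)"
    using integral_distr[OF D(3) h(1)] by (simp add: D(5))
  moreover have "(\<integral>x. h x \<partial>\<nu>) = (\<integral>p. h (snd p) \<partial>\<gamma>)"
    using integral_distr[OF D(4) h'] by (simp add: D(6))
  ultimately have "(\<integral>x. h x \<partial>\<mu>) - (\<integral>x. h x \<partial>\<nu>) = (\<integral>p. h (fst p) - h (snd p) \<partial>\<gamma>)"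
    using i by simp
  also have "\<bar>\<dots>\<bar> \<le> (\<integral>p. \<bar>h (fst p) - h (snd p)\<bar> \<partial>\<gamma>)" by (rule integral_abs_bound)
  also have "\<dots> \<le> (\<integral>p. k (fst p) (snd p) \<partial>\<gamma>)"
    using i h(3) spg by (intro integral_mono) auto
  finally show "\<bar>(\<integral>x. h x \<partial>\<mu>) - (\<integral>x. h x \<partial>\<nu>)\<bar> \<le> (\<integral>p. k (fst p) (snd p) \<partial>\<gamma>)" .
qed

section \<open>Measures cut into finitely many cells\<close>

lemma nn_integral_finite_range:
  fixes k :: "'a \<Rightarrow> nat" and F :: "nat \<Rightarrow> ennreal"
  assumes [measurable]: "k \<in> \<mu> \<rightarrow>\<^sub>M count_space UNIV" and k: "\<And>x. x \<in> space \<mu> \<Longrightarrow> k x \<le> n"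
  shows "(\<integral>\<^sup>+x. F (k x) \<partial>\<mu>) = (\<Sum>i\<le>n. F i * emeasure \<mu> {x \<in> space \<mu>. k x = i})"
proof -
  have "(\<integral>\<^sup>+x. F (k x) \<partial>\<mu>) = (\<integral>\<^sup>+x. (\<Sum>i\<le>n. F i * indicator {x \<in> space \<mu>. k x = i} x) \<partial>\<mu>)"
  proof (rule nn_integral_cong)
    fix x assume x: "x \<in> space \<mu>"
    have "(\<Sum>i\<le>n. F i * indicator {x \<in> space \<mu>. k x = i} x) = (\<Sum>i\<le>n. if i = k x then F i else 0)"
      using x by (intro sum.cong) (auto simp: indicator_def)
    then show "F (k x) = (\<Sum>i\<le>n. F i * indicator {x \<in> space \<mu>. k x = i} x)" using k[OF x] by simp
  qed
  also have "\<dots> = (\<Sum>i\<le>n. F i * emeasure \<mu> {x \<in> space \<mu>. k x = i})"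
    by (subst nn_integral_sum) (auto simp: nn_integral_cmult_indicator)
  finally show ?thesis .
qed

lemma integral_finite_range:
  fixes k :: "'a \<Rightarrow> nat" and F :: "nat \<Rightarrow> real"
  assumes "prob_space \<mu>"
    and [measurable]: "k \<in> \<mu> \<rightarrow>\<^sub>M count_space UNIV" and k: "\<And>x. x \<in> space \<mu> \<Longrightarrow> k x \<le> n"
  shows "(\<integral>x. F (k x) \<partial>\<mu>) = (\<Sum>i\<le>n. F i * measure \<mu> {x \<in> space \<mu>. k x = i})"
proof -
  interpret prob_space \<mu> by fact
  have "(\<integral>x. F (k x) \<partial>\<mu>) = (\<integral>x. (\<Sum>i\<le>n. F i * indicator {x \<in> space \<mu>. k x = i} x) \<partial>\<mu>)"
  proof (rule Bochner_Integration.integral_cong[OF refl])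
    fix x assume x: "x \<in> space \<mu>"
    have "(\<Sum>i\<le>n. F i * indicator {x \<in> space \<mu>. k x = i} x) = (\<Sum>i\<le>n. if i = k x then F i else 0)"
      using x by (intro sum.cong) (auto simp: indicator_def)
    then show "F (k x) = (\<Sum>i\<le>n. F i * indicator {x \<in> space \<mu>. k x = i} x)" using k[OF x] by simp
  qed
  also have "\<dots> = (\<Sum>i\<le>n. F i * measure \<mu> {x \<in> space \<mu>. k x = i})"
  proof -
    have "integrable \<mu> (indicat_real {x \<in> space \<mu>. k x = i})" for i
      by (rule integrable_real_indicator) (simp_all add: emeasure_eq_measure)
    then show ?thesis by (subst Bochner_Integration.integral_sum) auto
  qed
  finally show ?thesis .
qed

text \<open>Distributes the mass \<open>\<pi> i j\<close> over the product of the \<open>i\<close>-th and \<open>j\<close>-th cells proportionally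
  to the product measure. Cells of measure zero make no difference although the density is \<open>0\<close>
  there, division by zero being \<open>0\<close>.\<close>

lemma cell_coupling:
  fixes k :: "'a \<Rightarrow> nat" and l :: "'b \<Rightarrow> nat" and \<pi> :: "nat \<Rightarrow> nat \<Rightarrow> real"
  assumes ps: "prob_space \<mu>" "prob_space \<nu>"
    and [measurable]: "k \<in> \<mu> \<rightarrow>\<^sub>M count_space UNIV" "l \<in> \<nu> \<rightarrow>\<^sub>M count_space UNIV"
    and k: "\<And>x. x \<in> space \<mu> \<Longrightarrow> k x \<le> n" and l: "\<And>x. x \<in> space \<nu> \<Longrightarrow> l x \<le> n"
    and \<pi>0: "\<And>i j. 0 \<le> \<pi> i j"
    and \<pi>p: "\<And>i. i \<le> n \<Longrightarrow> (\<Sum>j\<le>n. \<pi> i j) = measure \<mu> {x \<in> space \<mu>. k x = i}"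
    and \<pi>q: "\<And>j. j \<le> n \<Longrightarrow> (\<Sum>i\<le>n. \<pi> i j) = measure \<nu> {x \<in> space \<nu>. l x = j}"
  obtains \<gamma> where "\<gamma> \<in> couplings \<mu> \<nu>"
    "\<And>G :: nat \<Rightarrow> nat \<Rightarrow> real. (\<And>i j. 0 \<le> G i j) \<Longrightarrow>
      integrable \<gamma> (\<lambda>z. G (k (fst z)) (l (snd z))) \<and>
      (\<integral>z. G (k (fst z)) (l (snd z)) \<partial>\<gamma>) = (\<Sum>i\<le>n. \<Sum>j\<le>n. \<pi> i j * G i j)"
proof -
  interpret \<mu>: prob_space \<mu> by fact
  interpret \<nu>: prob_space \<nu> by fact
  interpret pair_prob_space \<mu> \<nu> ..
  define p where "p i = measure \<mu> {x \<in> space \<mu>. k x = i}" for i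
  define q where "q i = measure \<nu> {x \<in> space \<nu>. l x = i}" for i
  have pq0: "0 \<le> p i" "0 \<le> q i" for i by (auto simp: p_def q_def)
  have ep: "emeasure \<mu> {x \<in> space \<mu>. k x = i} = ennreal (p i)" for i
    by (simp add: p_def \<mu>.emeasure_eq_measure)
  have eq: "emeasure \<nu> {x \<in> space \<nu>. l x = i} = ennreal (q i)" for i
    by (simp add: q_def \<nu>.emeasure_eq_measure)
  \<comment> \<open>The marginal conditions leave no mass in a null cell, so the value 0 of the
    density there loses nothing.\<close>
  have zero: "\<pi> i j = 0" if "i \<le> n" "j \<le> n" "p i = 0 \<or> q j = 0" for i j
  proof -
    have "\<pi> i j \<le> (\<Sum>j\<le>n. \<pi> i j)" using that \<pi>0 by (intro member_le_sum) auto
    moreover have "\<pi> i j \<le> (\<Sum>i\<le>n. \<pi> i j)" using that \<pi>0 by (intro member_le_sum[of i "{..n}" "\<lambda>i. \<pi> i j"]) auto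
    ultimately show ?thesis using that \<pi>0[of i j] \<pi>p[of i] \<pi>q[of j] by (auto simp: p_def q_def)
  qed
  define w where "w i j = \<pi> i j / (p i * q j)" for i j
  have w0: "0 \<le> w i j" for i j using \<pi>0 pq0 by (simp add: w_def)
  have wpq: "w i j * p i * q j = \<pi> i j" if "i \<le> n" "j \<le> n" for i j
    using zero[OF that] by (auto simp: w_def)
  have row: "(\<Sum>j\<le>n. w i j * q j) = (if p i = 0 then 0 else 1)" if "i \<le> n" for i
  proof (cases "p i = 0")
    case False
    have "(\<Sum>j\<le>n. w i j * q j) = (\<Sum>j\<le>n. \<pi> i j) / p i"
      unfolding sum_divide_distrib using zero that by (intro sum.cong refl) (auto simp: w_def)
    with False show ?thesis using \<pi>p[OF that] by (simp add: p_def)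
  qed (simp add: w_def)
  have col: "(\<Sum>i\<le>n. w i j * p i) = (if q j = 0 then 0 else 1)" if "j \<le> n" for j
  proof (cases "q j = 0")
    case False
    have "(\<Sum>i\<le>n. w i j * p i) = (\<Sum>i\<le>n. \<pi> i j) / q j"
      unfolding sum_divide_distrib using zero that by (intro sum.cong refl) (auto simp: w_def)
    with False show ?thesis using \<pi>q[OF that] by (simp add: q_def)
  qed (simp add: w_def)
  have AEp: "AE x in \<mu>. p (k x) \<noteq> 0"
  proof -
    have "AE x in \<mu>. p i = 0 \<longrightarrow> k x \<noteq> i" for i
      by (cases "p i = 0") (auto intro!: AE_I[where N="{x \<in> space \<mu>. k x = i}"] simp: ep)
    then have "AE x in \<mu>. \<forall>i. p i = 0 \<longrightarrow> k x \<noteq> i" by (simp add: AE_all_countable)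
    then show ?thesis by eventually_elim auto
  qed
  have AEq: "AE x in \<nu>. q (l x) \<noteq> 0"
  proof -
    have "AE x in \<nu>. q i = 0 \<longrightarrow> l x \<noteq> i" for i
      by (cases "q i = 0") (auto intro!: AE_I[where N="{x \<in> space \<nu>. l x = i}"] simp: eq)
    then have "AE x in \<nu>. \<forall>i. q i = 0 \<longrightarrow> l x \<noteq> i" by (simp add: AE_all_countable)
    then show ?thesis by eventually_elim auto
  qed
  define d where "d = (\<lambda>z. ennreal (w (k (fst z)) (l (snd z))))"
  have [measurable]: "(\<lambda>z. F (k (fst z)) (l (snd z))) \<in> borel_measurable (\<mu> \<Otimes>\<^sub>M \<nu>)"
    for F :: "nat \<Rightarrow> nat \<Rightarrow> real" by measurable
  have dm[measurable]: "d \<in> borel_measurable (\<mu> \<Otimes>\<^sub>M \<nu>)" unfolding d_def by measurable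
  define \<gamma> where "\<gamma> = density (\<mu> \<Otimes>\<^sub>M \<nu>) d"
  have sg[measurable_cong]: "sets \<gamma> = sets (\<mu> \<Otimes>\<^sub>M \<nu>)" by (simp add: \<gamma>_def)
  have int_row: "(\<integral>\<^sup>+y. d (x, y) \<partial>\<nu>) = (if p (k x) = 0 then 0 else 1)" if "x \<in> space \<mu>" for x
  proof -
    have "(\<integral>\<^sup>+y. d (x, y) \<partial>\<nu>) = (\<Sum>j\<le>n. ennreal (w (k x) j) * ennreal (q j))"
      unfolding d_def fst_conv snd_conv eq[symmetric]
      by (rule nn_integral_finite_range[of l \<nu> n "\<lambda>j. ennreal (w (k x) j)"]) (simp_all add: l)
    also have "\<dots> = ennreal (\<Sum>j\<le>n. w (k x) j * q j)"
      using w0 pq0 by (simp add: ennreal_mult[symmetric])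
    finally show ?thesis using row[OF k[OF that]] by simp
  qed
  have int_col: "(\<integral>\<^sup>+x. d (x, y) \<partial>\<mu>) = (if q (l y) = 0 then 0 else 1)" if "y \<in> space \<nu>" for y
  proof -
    have "(\<integral>\<^sup>+x. d (x, y) \<partial>\<mu>) = (\<Sum>i\<le>n. ennreal (w i (l y)) * ennreal (p i))"
      unfolding d_def fst_conv snd_conv ep[symmetric]
      by (rule nn_integral_finite_range[of k \<mu> n "\<lambda>i. ennreal (w i (l y))"]) (simp_all add: k)
    also have "\<dots> = ennreal (\<Sum>i\<le>n. w i (l y) * p i)"
      using w0 pq0 by (simp add: ennreal_mult[symmetric])
    finally show ?thesis using col[OF l[OF that]] by simp
  qed
  have "distr \<gamma> \<mu> fst = \<mu>"
  proof (rule measure_eqI)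
    fix A assume "A \<in> sets (distr \<gamma> \<mu> fst)"
    then have A[measurable]: "A \<in> sets \<mu>" by simp
    have "emeasure (distr \<gamma> \<mu> fst) A = (\<integral>\<^sup>+z. indicator A (fst z) \<partial>\<gamma>)"
    proof -
      have "(\<integral>\<^sup>+z. indicator A (fst z) \<partial>\<gamma>) = (\<integral>\<^sup>+x. indicator A x \<partial>distr \<gamma> \<mu> fst)"
        by (rule nn_integral_distr[symmetric]) simp_all
      then show ?thesis by simp
    qed
    also have "\<dots> = (\<integral>\<^sup>+z. d z * indicator A (fst z) \<partial>(\<mu> \<Otimes>\<^sub>M \<nu>))"
      unfolding \<gamma>_def by (rule nn_integral_density) simp_all
    also have "\<dots> = (\<integral>\<^sup>+x. \<integral>\<^sup>+y. d (x, y) * indicator A x \<partial>\<nu> \<partial>\<mu>)"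
      by (subst \<nu>.nn_integral_fst[symmetric]) simp_all
    also have "\<dots> = (\<integral>\<^sup>+x. (\<integral>\<^sup>+y. d (x, y) \<partial>\<nu>) * indicator A x \<partial>\<mu>)"
      by (intro nn_integral_cong nn_integral_multc) simp
    also have "\<dots> = (\<integral>\<^sup>+x. indicator A x \<partial>\<mu>)"
      using AEp by (intro nn_integral_cong_AE) (use int_row in auto)
    finally show "emeasure (distr \<gamma> \<mu> fst) A = emeasure \<mu> A" by simp
  qed simp
  moreover have "distr \<gamma> \<nu> snd = \<nu>"
  proof (rule measure_eqI)
    fix A assume "A \<in> sets (distr \<gamma> \<nu> snd)"
    then have A[measurable]: "A \<in> sets \<nu>" by simp
    have "emeasure (distr \<gamma> \<nu> snd) A = (\<integral>\<^sup>+z. indicator A (snd z) \<partial>\<gamma>)"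
    proof -
      have "(\<integral>\<^sup>+z. indicator A (snd z) \<partial>\<gamma>) = (\<integral>\<^sup>+x. indicator A x \<partial>distr \<gamma> \<nu> snd)"
        by (rule nn_integral_distr[symmetric]) simp_all
      then show ?thesis by simp
    qed
    also have "\<dots> = (\<integral>\<^sup>+z. d z * indicator A (snd z) \<partial>(\<mu> \<Otimes>\<^sub>M \<nu>))"
      unfolding \<gamma>_def by (rule nn_integral_density) simp_all
    also have "\<dots> = (\<integral>\<^sup>+y. \<integral>\<^sup>+x. d (x, y) * indicator A y \<partial>\<mu> \<partial>\<nu>)"
      by (subst nn_integral_snd[symmetric]) simp_all
    also have "\<dots> = (\<integral>\<^sup>+y. (\<integral>\<^sup>+x. d (x, y) \<partial>\<mu>) * indicator A y \<partial>\<nu>)"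
      by (intro nn_integral_cong nn_integral_multc) simp
    also have "\<dots> = (\<integral>\<^sup>+x. indicator A x \<partial>\<nu>)"
      using AEq by (intro nn_integral_cong_AE) (use int_col in auto)
    finally show "emeasure (distr \<gamma> \<nu> snd) A = emeasure \<nu> A" by simp
  qed simp
  moreover have "prob_space \<gamma>"
    using \<open>distr \<gamma> \<mu> fst = \<mu>\<close> prob_space_distrD[of fst \<gamma> \<mu>] ps(1) by simp
  ultimately have "\<gamma> \<in> couplings \<mu> \<nu>" using sg by (simp add: couplings_def)
  \<comment> \<open>For nonnegative \<open>G\<close> the integral is computed by Tonelli; its
    finiteness then gives integrability and value together.\<close>
  moreover have "integrable \<gamma> (\<lambda>z. G (k (fst z)) (l (snd z))) \<and>
      (\<integral>z. G (k (fst z)) (l (snd z)) \<partial>\<gamma>) = (\<Sum>i\<le>n. \<Sum>j\<le>n. \<pi> i j * G i j)"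
    if G: "\<And>i j. 0 \<le> G i j" for G :: "nat \<Rightarrow> nat \<Rightarrow> real"
  proof -
    have "(\<integral>\<^sup>+z. ennreal (G (k (fst z)) (l (snd z))) \<partial>\<gamma>) =
        (\<integral>\<^sup>+z. d z * ennreal (G (k (fst z)) (l (snd z))) \<partial>(\<mu> \<Otimes>\<^sub>M \<nu>))"
      unfolding \<gamma>_def by (rule nn_integral_density) measurable
    also have "\<dots> = (\<integral>\<^sup>+x. \<integral>\<^sup>+y. ennreal (w (k x) (l y) * G (k x) (l y)) \<partial>\<nu> \<partial>\<mu>)"
      by (subst \<nu>.nn_integral_fst[symmetric]) (simp_all add: d_def ennreal_mult w0 G)
    also have "\<dots> = (\<integral>\<^sup>+x. (\<Sum>j\<le>n. ennreal (w (k x) j * G (k x) j) * ennreal (q j)) \<partial>\<mu>)"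
      unfolding eq[symmetric] using l
      by (intro nn_integral_cong nn_integral_finite_range[where F="\<lambda>j. ennreal (w _ j * G _ j)"]) simp_all
    also have "\<dots> = (\<Sum>i\<le>n. (\<Sum>j\<le>n. ennreal (w i j * G i j) * ennreal (q j)) * ennreal (p i))"
      unfolding ep[symmetric] using k
      by (intro nn_integral_finite_range[where F="\<lambda>i. \<Sum>j\<le>n. ennreal (w i j * G i j) * ennreal (q j)"]) simp_all
    also have "\<dots> = (\<Sum>i\<le>n. ennreal ((\<Sum>j\<le>n. w i j * G i j * q j) * p i))"
      using w0 pq0 G by (intro sum.cong refl) (simp add: ennreal_mult[symmetric] sum_nonneg)
    also have "\<dots> = ennreal (\<Sum>i\<le>n. (\<Sum>j\<le>n. w i j * G i j * q j) * p i)"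
      using w0 pq0 G by (intro sum_ennreal) (auto intro!: mult_nonneg_nonneg sum_nonneg)
    also have "(\<Sum>i\<le>n. (\<Sum>j\<le>n. w i j * G i j * q j) * p i) = (\<Sum>i\<le>n. \<Sum>j\<le>n. \<pi> i j * G i j)"
      unfolding sum_distrib_right using wpq by (intro sum.cong refl) (simp add: algebra_simps)
    finally have nn: "(\<integral>\<^sup>+z. ennreal (G (k (fst z)) (l (snd z))) \<partial>\<gamma>) = ennreal (\<Sum>i\<le>n. \<Sum>j\<le>n. \<pi> i j * G i j)" .
    have "0 \<le> (\<Sum>i\<le>n. \<Sum>j\<le>n. \<pi> i j * G i j)" using \<pi>0 G by (intro sum_nonneg) simp
    moreover have "(\<lambda>z. G (k (fst z)) (l (snd z))) \<in> borel_measurable \<gamma>" by measurable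
    ultimately show ?thesis
      using nn G by (simp add: integrableI_nn_integral_finite integral_eq_nn_integral)
  qed
  ultimately show thesis by (rule that)
qed

section \<open>Duality for separable bounded pseudometrics\<close>

text \<open>The test functions of Kantorovich duality. Range and measurability are included so that
  membership alone makes a function integrable for every probability measure with the sets of
  \<open>M\<close>.\<close>

definition nonexpansive :: "'a measure \<Rightarrow> ('a \<Rightarrow> 'a \<Rightarrow> real) \<Rightarrow> ('a \<Rightarrow> real) \<Rightarrow> bool" where
  "nonexpansive M U h \<longleftrightarrow> h \<in> borel_measurable M \<and> (\<forall>x\<in>space M. 0 \<le> h x \<and> h x \<le> 1) \<and>
    (\<forall>x\<in>space M. \<forall>y\<in>space M. \<bar>h x - h y\<bar> \<le> U x y)"

text \<open>This and the closure properties below cover the propositional connectives of both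
  logics: they do not enlarge distances in the unit interval and so keep the cost \<open>U\<close>.
  Only the modalities change the cost.\<close>

lemma nonexpansive_compl: "nonexpansive M U h \<Longrightarrow> nonexpansive M U (\<lambda>x. 1 - h x)"
  unfolding nonexpansive_def by (fastforce simp: abs_minus_commute)

lemma nonexpansive_min:
  "nonexpansive M U g \<Longrightarrow> nonexpansive M U h \<Longrightarrow> nonexpansive M U (\<lambda>x. min (g x) (h x))"
  unfolding nonexpansive_def by (auto simp: min_def; smt (verit))

lemma nonexpansive_max:
  "nonexpansive M U g \<Longrightarrow> nonexpansive M U h \<Longrightarrow> nonexpansive M U (\<lambda>x. max (g x) (h x))"
  unfolding nonexpansive_def by (auto simp: max_def; smt (verit))

lemma nonexpansive_minus:
  "nonexpansive M U g \<Longrightarrow> 0 \<le> q \<Longrightarrow> nonexpansive M U (\<lambda>x. max 0 (g x - q))"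
  unfolding nonexpansive_def by (auto simp: max_def; smt (verit))

lemma nonexpansive_plus:
  "nonexpansive M U g \<Longrightarrow> 0 \<le> q \<Longrightarrow> nonexpansive M U (\<lambda>x. min 1 (g x + q))"
  unfolding nonexpansive_def by (auto simp: min_def; smt (verit))

lemma nonexpansive_mono:
  "nonexpansive M U h \<Longrightarrow> (\<And>x y. U x y \<le> V x y) \<Longrightarrow> nonexpansive M V h"
  unfolding nonexpansive_def by (blast intro: order_trans)

text \<open>Instantiated by \<open>m\<close> on \<open>borel\<close> and by \<open>U_op c m\<close>
  on trajectories. Separability refers to \<open>U\<close> itself rather than to a topology: the
  uniform metric on trajectories is in general not separable, the discounted cost is.\<close>

locale separable_cost =
  fixes M :: "'a measure" and U :: "'a \<Rightarrow> 'a \<Rightarrow> real"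
  assumes U_ge_0: "0 \<le> U x y" and U_le_1: "U x y \<le> 1" and U_refl: "U x x = 0"
    and U_sym: "U x y = U y x" and U_triangle: "U x z \<le> U x y + U y z"
    and U_measurable: "(\<lambda>p. U (fst p) (snd p)) \<in> borel_measurable (M \<Otimes>\<^sub>M M)"
    and U_separable: "\<exists>D. countable D \<and> D \<subseteq> space M \<and> (\<forall>x\<in>space M. \<forall>\<epsilon>>0. \<exists>d\<in>D. U x d < \<epsilon>)"
begin

lemma dense_sequence:
  assumes "space M \<noteq> {}"
  obtains a :: "nat \<Rightarrow> 'a" where "\<And>i. a i \<in> space M"
    "\<And>x \<epsilon>. x \<in> space M \<Longrightarrow> 0 < \<epsilon> \<Longrightarrow> \<exists>i. U x (a i) < \<epsilon>"
proof -
  obtain D where D: "countable D" "D \<subseteq> space M" "\<And>x \<epsilon>. x \<in> space M \<Longrightarrow> 0 < \<epsilon> \<Longrightarrow> \<exists>d\<in>D. U x d < \<epsilon>"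
    using U_separable by blast
  have "D \<noteq> {}" using assms D(3)[of _ 1] by fastforce
  then have r: "range (from_nat_into D) = D" using D(1) by simp
  show thesis
  proof (rule that[of "from_nat_into D"])
    show "from_nat_into D i \<in> space M" for i using from_nat_into[OF \<open>D \<noteq> {}\<close>] D(2) by blast
    show "\<exists>i. U x (from_nat_into D i) < \<epsilon>" if "x \<in> space M" "0 < \<epsilon>" for x \<epsilon>
      using D(3)[OF that] r by (metis imageE)
  qed
qed

lemma U_section_measurable:
  assumes "a \<in> space M"
  shows "(\<lambda>x. U x a) \<in> borel_measurable M"
  using measurable_compose[OF measurable_Pair1'[OF assms] U_measurable]
    measurable_compose[OF measurable_Pair2'[OF assms] U_measurable] by simp

lemma nonexpansive_abs:
  assumes "\<And>x y. x \<in> space M \<Longrightarrow> y \<in> space M \<Longrightarrow> h x - h y \<le> U x y"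
    "x \<in> space M" "y \<in> space M"
  shows "\<bar>h x - h y\<bar> \<le> U x y"
  using assms(1)[OF assms(2,3)] assms(1)[OF assms(3,2)] U_sym[of x y] by simp

text \<open>Stone's lattice argument. For a fixed \<open>i\<close>, the minimum over
  \<open>j\<close> of functions matching \<phi> at \<open>i\<close> and \<open>j\<close> is still
  right at \<open>i\<close> and nowhere too large; the maximum of these over \<open>i\<close> is
  nowhere too small either.\<close>

lemma lattice_interpolation:
  fixes H :: "('a \<Rightarrow> real) set"
  assumes Hmin: "\<And>g h. g \<in> H \<Longrightarrow> h \<in> H \<Longrightarrow> (\<lambda>x. min (g x) (h x)) \<in> H"
    and Hmax: "\<And>g h. g \<in> H \<Longrightarrow> h \<in> H \<Longrightarrow> (\<lambda>x. max (g x) (h x)) \<in> H"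
    and two_points: "\<And>i j. i \<le> n \<Longrightarrow> j \<le> n \<Longrightarrow> \<exists>h\<in>H. \<bar>h (a i) - \<phi> i\<bar> < \<epsilon> \<and> \<bar>h (a j) - \<phi> j\<bar> < \<epsilon>"
  shows "\<exists>h\<in>H. \<forall>i\<le>n::nat. \<bar>h (a i) - \<phi> i\<bar> < \<epsilon>"
proof -
  have row: "\<exists>h\<in>H. \<bar>h (a i) - \<phi> i\<bar> < \<epsilon> \<and> (\<forall>j\<le>m. h (a j) < \<phi> j + \<epsilon>)" if i: "i \<le> n" and "m \<le> n" for i m
    using \<open>m \<le> n\<close>
  proof (induction m)
    case 0
    obtain h where "h \<in> H" "\<bar>h (a i) - \<phi> i\<bar> < \<epsilon>" "\<bar>h (a 0) - \<phi> 0\<bar> < \<epsilon>"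
      using two_points[OF i, of 0] by auto
    then show ?case by (intro bexI[of _ h]) auto
  next
    case (Suc m)
    then obtain g where g: "g \<in> H" "\<bar>g (a i) - \<phi> i\<bar> < \<epsilon>" "\<forall>j\<le>m. g (a j) < \<phi> j + \<epsilon>" by auto
    obtain h where "h \<in> H" "\<bar>h (a i) - \<phi> i\<bar> < \<epsilon>" "\<bar>h (a (Suc m)) - \<phi> (Suc m)\<bar> < \<epsilon>"
      using two_points[OF i Suc.prems] by auto
    with g show ?case
      by (intro bexI[of _ "\<lambda>x. min (g x) (h x)"] Hmin) (auto simp: le_Suc_eq min_def)
  qed
  have "\<exists>h\<in>H. (\<forall>j\<le>n. h (a j) < \<phi> j + \<epsilon>) \<and> (\<forall>i\<le>m. \<phi> i - \<epsilon> < h (a i))" if "m \<le> n" for m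
    using that
  proof (induction m)
    case 0
    obtain h where "h \<in> H" "\<bar>h (a 0) - \<phi> 0\<bar> < \<epsilon>" "\<forall>j\<le>n. h (a j) < \<phi> j + \<epsilon>"
      using row[of 0 n] by auto
    then show ?case by (intro bexI[of _ h]) auto
  next
    case (Suc m)
    then obtain g where g: "g \<in> H" "\<forall>j\<le>n. g (a j) < \<phi> j + \<epsilon>" "\<forall>i\<le>m. \<phi> i - \<epsilon> < g (a i)" by auto
    obtain h where "h \<in> H" "\<bar>h (a (Suc m)) - \<phi> (Suc m)\<bar> < \<epsilon>" "\<forall>j\<le>n. h (a j) < \<phi> j + \<epsilon>"
      using row[OF Suc.prems order_refl] by auto
    with g show ?case
      by (intro bexI[of _ "\<lambda>x. max (g x) (h x)"] Hmax) (auto simp: le_Suc_eq max_def)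
  qed
  from this[of n] obtain h where "h \<in> H" "\<forall>j\<le>n. h (a j) < \<phi> j + \<epsilon>" "\<forall>i\<le>n. \<phi> i - \<epsilon> < h (a i)"
    by auto
  then show ?thesis by (intro bexI[of _ h]) (auto simp: abs_less_iff; fastforce)
qed

text \<open>The parts left uncovered by the first \<open>n\<close> balls decrease to the empty set,
  so continuity from above applies. This takes the place of tightness.\<close>

lemma uncovered_measure_small:
  assumes "prob_space \<mu>" and sets: "sets \<mu> = sets M"
    and a: "\<And>i. a i \<in> space M" "\<And>x \<epsilon>. x \<in> space M \<Longrightarrow> 0 < \<epsilon> \<Longrightarrow> \<exists>i::nat. U x (a i) < \<epsilon>"
    and "0 < \<epsilon>" "0 < \<delta>"
  shows "\<forall>\<^sub>F n in sequentially. measure \<mu> {x \<in> space \<mu>. \<forall>i<n. \<epsilon> \<le> U x (a i)} < \<delta>"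
proof -
  interpret prob_space \<mu> by fact
  have sp: "space \<mu> = space M" using sets by (rule sets_eq_imp_space_eq)
  define A where "A n = {x \<in> space \<mu>. \<forall>i<n. \<epsilon> \<le> U x (a i)}" for n
  have [measurable]: "(\<lambda>x. U x (a i)) \<in> borel_measurable \<mu>" for i
    using U_section_measurable[OF a(1)] measurable_cong_sets[OF sets refl] by blast
  have "range A \<subseteq> sets \<mu>" unfolding A_def by auto
  moreover have "decseq A" by (auto simp: decseq_def A_def)
  ultimately have "(\<lambda>n. measure \<mu> (A n)) \<longlonglongrightarrow> measure \<mu> (\<Inter>n. A n)"
    by (rule finite_Lim_measure_decseq)
  moreover have "(\<Inter>n. A n) = {}"
  proof -
    have "x \<notin> (\<Inter>n. A n)" for x
    proof
      assume x: "x \<in> (\<Inter>n. A n)"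
      then have "x \<in> space M" by (auto simp: A_def sp)
      then obtain i where "U x (a i) < \<epsilon>" using a(2)[OF _ \<open>0 < \<epsilon>\<close>] by blast
      moreover have "x \<in> A (Suc i)" using x by blast
      ultimately show False by (auto simp: A_def)
    qed
    then show ?thesis by blast
  qed
  ultimately have "(\<lambda>n. measure \<mu> (A n)) \<longlonglongrightarrow> 0" by simp
  then show ?thesis unfolding A_def by (rule order_tendstoD) fact
qed

text \<open>The space is cut into finitely many cells of small diameter and a remainder of small measure;
  the coupling comes from an optimal plan between the cell masses.\<close>

theorem transport_strong_duality:
  assumes ps: "prob_space \<mu>" "prob_space \<nu>" and sets: "sets \<mu> = sets M" "sets \<nu> = sets M"
    and H_nonexp: "\<And>h. h \<in> H \<Longrightarrow> nonexpansive M U h"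
    and Hmin: "\<And>g h. g \<in> H \<Longrightarrow> h \<in> H \<Longrightarrow> (\<lambda>x. min (g x) (h x)) \<in> H"
    and Hmax: "\<And>g h. g \<in> H \<Longrightarrow> h \<in> H \<Longrightarrow> (\<lambda>x. max (g x) (h x)) \<in> H"
    and two_points: "\<And>x y \<alpha> \<beta> \<epsilon>. x \<in> space M \<Longrightarrow> y \<in> space M \<Longrightarrow> 0 \<le> \<alpha> \<Longrightarrow> \<alpha> \<le> 1 \<Longrightarrow>
        0 \<le> \<beta> \<Longrightarrow> \<beta> \<le> 1 \<Longrightarrow> \<bar>\<alpha> - \<beta>\<bar> \<le> U x y \<Longrightarrow> 0 < \<epsilon> \<Longrightarrow>
        \<exists>h\<in>H. \<bar>h x - \<alpha>\<bar> < \<epsilon> \<and> \<bar>h y - \<beta>\<bar> < \<epsilon>"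
    and S: "\<And>h. h \<in> H \<Longrightarrow> \<bar>(\<integral>x. h x \<partial>\<mu>) - (\<integral>x. h x \<partial>\<nu>)\<bar> \<le> S"
  shows "transport_cost U \<mu> \<nu> \<le> S"
proof (rule field_le_epsilon)
  have H: "\<And>h. h \<in> H \<Longrightarrow> h \<in> borel_measurable M"
      "\<And>h x. h \<in> H \<Longrightarrow> x \<in> space M \<Longrightarrow> 0 \<le> h x \<and> h x \<le> 1"
      "\<And>h x y. h \<in> H \<Longrightarrow> x \<in> space M \<Longrightarrow> y \<in> space M \<Longrightarrow> \<bar>h x - h y\<bar> \<le> U x y"
    using H_nonexp unfolding nonexpansive_def by blast+
  fix e :: real assume "0 < e"
  \<comment> \<open>The dual bound below loses 6 \<epsilon>, three for each measure; the primal
    estimate loses 2 \<epsilon> for the cell radii and \<epsilon> for each of the two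
    remainders.\<close>
  define \<epsilon> where "\<epsilon> = e / 10"
  have \<epsilon>: "0 < \<epsilon>" using \<open>0 < e\<close> by (simp add: \<epsilon>_def)
  interpret \<mu>: prob_space \<mu> by fact
  interpret \<nu>: prob_space \<nu> by fact
  have sp: "space \<mu> = space M" "space \<nu> = space M" using sets[THEN sets_eq_imp_space_eq] by auto
  then have "space M \<noteq> {}" using \<mu>.not_empty by simp
  then obtain a :: "nat \<Rightarrow> 'a" where a: "\<And>i. a i \<in> space M"
      "\<And>x \<epsilon>. x \<in> space M \<Longrightarrow> 0 < \<epsilon> \<Longrightarrow> \<exists>i. U x (a i) < \<epsilon>"
    using dense_sequence by blast
  have "\<forall>\<^sub>F n in sequentially. measure \<mu> {x \<in> space \<mu>. \<forall>i<n. \<epsilon> \<le> U x (a i)} < \<epsilon> \<and>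
      measure \<nu> {x \<in> space \<nu>. \<forall>i<n. \<epsilon> \<le> U x (a i)} < \<epsilon>"
    by (intro eventually_conj uncovered_measure_small ps sets a \<epsilon>)
  then obtain n where n: "measure \<mu> {x \<in> space \<mu>. \<forall>i<n. \<epsilon> \<le> U x (a i)} < \<epsilon>"
      "measure \<nu> {x \<in> space \<nu>. \<forall>i<n. \<epsilon> \<le> U x (a i)} < \<epsilon>"
    unfolding eventually_sequentially by blast
  \<comment> \<open>Cell \<open>i < n\<close> holds the points within \<epsilon> of
    \<open>a i\<close> and of no earlier centre, cell \<open>n\<close> all the rest. The point
    \<open>a n\<close> is only a formal centre of that remainder, chosen so that \<open>C\<close> is
    a pseudometric on all indices up to \<open>n\<close>.\<close>
  define k where "k x = (LEAST i. i = n \<or> U x (a i) < \<epsilon>)" for x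
  have k_n: "k x \<le> n" for x unfolding k_def by (intro Least_le) simp
  have k_lt: "U x (a (k x)) < \<epsilon>" if "k x \<noteq> n" for x
    using LeastI[of "\<lambda>i. i = n \<or> U x (a i) < \<epsilon>" n] that unfolding k_def by blast
  have k_eq: "{x \<in> space M. k x = n} = {x \<in> space M. \<forall>i<n. \<epsilon> \<le> U x (a i)}"
  proof -
    have "k x = n \<longleftrightarrow> (\<forall>i<n. \<epsilon> \<le> U x (a i))" for x
      using not_less_Least[of _ "\<lambda>i. i = n \<or> U x (a i) < \<epsilon>"] k_n[of x] k_lt[of x]
      unfolding k_def[symmetric] by (metis nat_less_le linorder_not_less)
    then show ?thesis by simp
  qed
  have [measurable]: "(\<lambda>x. U x (a i)) \<in> borel_measurable M" for i
    using U_section_measurable[OF a(1)] .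
  have kM: "k \<in> M \<rightarrow>\<^sub>M count_space UNIV" unfolding k_def by measurable
  then have km: "k \<in> \<mu> \<rightarrow>\<^sub>M count_space UNIV" "k \<in> \<nu> \<rightarrow>\<^sub>M count_space UNIV"
    using measurable_cong_sets[OF sets(1) refl] measurable_cong_sets[OF sets(2) refl] by blast+
  define p where "p i = measure \<mu> {x \<in> space \<mu>. k x = i}" for i
  define q where "q i = measure \<nu> {x \<in> space \<nu>. k x = i}" for i
  define C where "C i j = U (a i) (a j)" for i j
  have int_p: "(\<integral>x. F (k x) \<partial>\<mu>) = (\<Sum>i\<le>n. F i * p i)" for F :: "nat \<Rightarrow> real"
    unfolding p_def by (intro integral_finite_range ps km k_n)
  have int_q: "(\<integral>x. F (k x) \<partial>\<nu>) = (\<Sum>i\<le>n. F i * q i)" for F :: "nat \<Rightarrow> real"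
    unfolding q_def by (intro integral_finite_range ps km k_n)
  have pq1: "(\<Sum>i\<le>n. p i) = 1" "(\<Sum>i\<le>n. q i) = 1"
    using int_p[of "\<lambda>_. 1"] int_q[of "\<lambda>_. 1"] by (simp_all add: \<mu>.prob_space \<nu>.prob_space)
  have pqn: "p n < \<epsilon>" "q n < \<epsilon>" using n unfolding p_def q_def sp k_eq by auto
  have pq0: "0 \<le> p i" "0 \<le> q i" for i by (auto simp: p_def q_def)
  have dual: "(\<Sum>i\<le>n. \<phi> i * (p i - q i)) \<le> S + 6 * \<epsilon>"
    if \<phi>: "\<And>i. i \<le> n \<Longrightarrow> 0 \<le> \<phi> i \<and> \<phi> i \<le> 1" "\<And>i j. i \<le> n \<Longrightarrow> j \<le> n \<Longrightarrow> \<phi> i - \<phi> j \<le> C i j" for \<phi>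
  proof -
    \<comment> \<open>A potential on the indices is replaced by a member of \<open>H\<close>, about
      which the bound \<open>S\<close> is known.\<close>
    have "\<exists>h\<in>H. \<forall>i\<le>n. \<bar>h (a i) - \<phi> i\<bar> < \<epsilon>"
    proof (intro lattice_interpolation Hmin Hmax two_points a \<epsilon>)
      fix i j assume ij: "i \<le> n" "j \<le> n"
      show "\<bar>\<phi> i - \<phi> j\<bar> \<le> U (a i) (a j)"
        using \<phi>(2)[OF ij] \<phi>(2)[OF ij(2,1)] U_sym[of "a i" "a j"] by (simp add: C_def)
    qed (use \<phi>(1) in auto)
    then obtain h where h: "h \<in> H" "\<And>i. i \<le> n \<Longrightarrow> \<bar>h (a i) - \<phi> i\<bar> < \<epsilon>" by blast
    \<comment> \<open>One \<epsilon> for the interpolation error at the centre and one for the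
      distance to it; on the remainder both values merely lie in the unit interval.\<close>
    have hb: "\<bar>h x - \<phi> (k x)\<bar> \<le> 2 * \<epsilon> + (if k x = n then 1 else 0)" if x: "x \<in> space M" for x
    proof (cases "k x = n")
      case True
      then show ?thesis using H(2)[OF h(1) x] \<phi>(1)[OF k_n[of x]] \<epsilon> by auto
    next
      case False
      then show ?thesis using h(2)[OF k_n[of x]] H(3)[OF h(1) x a(1)[of "k x"]] k_lt[of x] by auto
    qed
    have phm: "(\<lambda>x. \<phi> (k x)) \<in> borel_measurable M" using kM by measurable
    have diff: "\<bar>(\<integral>x. h x \<partial>\<rho>) - (\<integral>x. \<phi> (k x) \<partial>\<rho>)\<bar> \<le> 2 * \<epsilon> + (\<integral>x. (if k x = n then 1 else 0) \<partial>\<rho>)"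
      if \<rho>: "prob_space \<rho>" "sets \<rho> = sets M" for \<rho>
    proof -
      interpret \<rho>: prob_space \<rho> by fact
      have spr: "space \<rho> = space M" using \<rho>(2) by (rule sets_eq_imp_space_eq)
      have i: "integrable \<rho> h" "integrable \<rho> (\<lambda>x. \<phi> (k x))" "integrable \<rho> (\<lambda>x. if k x = n then 1 else 0 :: real)"
        using H(1,2)[OF h(1)] \<phi>(1) k_n phm kM
        by (auto intro!: integrable_unit_interval \<rho>(1) simp: measurable_cong_sets[OF \<rho>(2) refl] spr)
      have "\<bar>\<integral>x. h x - \<phi> (k x) \<partial>\<rho>\<bar> \<le> (\<integral>x. \<bar>h x - \<phi> (k x)\<bar> \<partial>\<rho>)" by (rule integral_abs_bound)
      also have "\<dots> \<le> (\<integral>x. 2 * \<epsilon> + (if k x = n then 1 else 0) \<partial>\<rho>)"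
        using i hb spr by (intro integral_mono) auto
      finally show ?thesis using i by (simp add: \<rho>.prob_space)
    qed
    have "(\<integral>x. (if k x = n then 1 else 0) \<partial>\<mu>) = p n" "(\<integral>x. (if k x = n then 1 else 0) \<partial>\<nu>) = q n"
      using int_p[of "\<lambda>i. if i = n then 1 else 0"] int_q[of "\<lambda>i. if i = n then 1 else 0"]
      by (simp_all add: if_distrib[of "\<lambda>x. x * _"] cong: if_cong)
    then have "(\<Sum>i\<le>n. \<phi> i * p i) - (\<Sum>i\<le>n. \<phi> i * q i) \<le> S + 6 * \<epsilon>"
      using diff[OF ps(1) sets(1)] diff[OF ps(2) sets(2)] S[OF h(1)] pqn
      unfolding int_p int_q by linarith
    then show ?thesis by (simp add: right_diff_distrib sum_subtractf)
  qed
  obtain \<pi> where \<pi>: "\<And>i j. 0 \<le> \<pi> i j"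
    "\<And>i. i \<le> n \<Longrightarrow> (\<Sum>j\<le>n. \<pi> i j) = p i" "\<And>j. j \<le> n \<Longrightarrow> (\<Sum>i\<le>n. \<pi> i j) = q j"
    "(\<Sum>i\<le>n. \<Sum>j\<le>n. \<pi> i j * C i j) \<le> S + 6 * \<epsilon>"
    by (rule finite_transport_duality[of p q n C "S + 6 * \<epsilon>"])
      (use pq0 pq1 dual in \<open>auto simp: C_def U_le_1 U_refl U_triangle\<close>)
  obtain \<gamma> where \<gamma>: "\<gamma> \<in> couplings \<mu> \<nu>" and int_\<gamma>: "\<And>G :: nat \<Rightarrow> nat \<Rightarrow> real. (\<And>i j. 0 \<le> G i j) \<Longrightarrow>
      integrable \<gamma> (\<lambda>z. G (k (fst z)) (k (snd z))) \<and>
      (\<integral>z. G (k (fst z)) (k (snd z)) \<partial>\<gamma>) = (\<Sum>i\<le>n. \<Sum>j\<le>n. \<pi> i j * G i j)"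
    using cell_coupling[OF ps km k_n k_n \<pi>(1) \<pi>(2)[unfolded p_def] \<pi>(3)[unfolded q_def]] by blast
  interpret \<gamma>: prob_space \<gamma> using \<gamma> by (simp add: couplings_def)
  have sg: "sets \<gamma> = sets (M \<Otimes>\<^sub>M M)"
    using couplingsD(2)[OF \<gamma> ps] sets by (simp cong: sets_pair_measure_cong)
  \<comment> \<open>\<open>G1\<close> and \<open>G2\<close> mark the remainder in the first and in
    the second coordinate, where the cost is bounded only by 1. Their integrals are the masses
    \<open>p n\<close> and \<open>q n\<close>.\<close>
  define G1 where "G1 i j = (if i = n then 1 else 0 :: real)" for i j :: nat
  define G2 where "G2 i j = (if j = n then 1 else 0 :: real)" for i j :: nat
  have "transport_cost U \<mu> \<nu> \<le> (\<integral>z. U (fst z) (snd z) \<partial>\<gamma>)"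
    by (intro transport_cost_le \<gamma> U_ge_0)
  also have "\<dots> \<le> (\<integral>z. 2 * \<epsilon> + (C (k (fst z)) (k (snd z)) + (G1 (k (fst z)) (k (snd z)) + G2 (k (fst z)) (k (snd z)))) \<partial>\<gamma>)"
  proof (rule integral_mono)
    show "integrable \<gamma> (\<lambda>z. U (fst z) (snd z))"
      using U_measurable by (intro integrable_unit_interval \<gamma>.prob_space_axioms)
        (auto simp: U_ge_0 U_le_1 measurable_cong_sets[OF sg refl])
    show "integrable \<gamma> (\<lambda>z. 2 * \<epsilon> + (C (k (fst z)) (k (snd z)) + (G1 (k (fst z)) (k (snd z)) + G2 (k (fst z)) (k (snd z)))))"
      using int_\<gamma>[of C] int_\<gamma>[of G1] int_\<gamma>[of G2] by (simp add: G1_def G2_def C_def U_ge_0)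
    fix z :: "'a \<times> 'a"
    let ?x = "fst z" and ?y = "snd z"
    have C0: "0 \<le> C i j" for i j by (simp add: C_def U_ge_0)
    show "U ?x ?y \<le> 2 * \<epsilon> + (C (k ?x) (k ?y) + (G1 (k ?x) (k ?y) + G2 (k ?x) (k ?y)))"
    proof (cases "k ?x = n \<or> k ?y = n")
      case True
      then show ?thesis using U_le_1[of ?x ?y] C0[of "k ?x" "k ?y"] \<epsilon> by (auto simp: G1_def G2_def)
    next
      case False
      then show ?thesis
        using k_lt[of ?x] k_lt[of ?y] U_triangle[of ?x ?y "a (k ?x)"]
          U_triangle[of "a (k ?x)" ?y "a (k ?y)"] U_sym[of "a (k ?y)" ?y]
        by (auto simp: G1_def G2_def C_def)
    qed
  qed
  also have "\<dots> = 2 * \<epsilon> + ((\<Sum>i\<le>n. \<Sum>j\<le>n. \<pi> i j * C i j) +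
      ((\<Sum>i\<le>n. \<Sum>j\<le>n. \<pi> i j * G1 i j) + (\<Sum>i\<le>n. \<Sum>j\<le>n. \<pi> i j * G2 i j)))"
    using int_\<gamma>[of C] int_\<gamma>[of G1] int_\<gamma>[of G2] by (simp add: G1_def G2_def C_def U_ge_0 \<gamma>.prob_space)
  also have "(\<Sum>i\<le>n. \<Sum>j\<le>n. \<pi> i j * G1 i j) = p n"
  proof -
    have "(\<Sum>i\<le>n. \<Sum>j\<le>n. \<pi> i j * G1 i j) = (\<Sum>i\<le>n. p i * (if i = n then 1 else 0))"
      using \<pi>(2) by (intro sum.cong refl) (simp add: G1_def sum_distrib_right[symmetric])
    then show ?thesis by (simp add: if_distrib[of "(*) _"] cong: if_cong)
  qed
  also have "(\<Sum>i\<le>n. \<Sum>j\<le>n. \<pi> i j * G2 i j) = q n"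
  proof -
    have "(\<Sum>i\<le>n. \<Sum>j\<le>n. \<pi> i j * G2 i j) = (\<Sum>i\<le>n. \<pi> i n)"
      by (intro sum.cong refl) (simp add: G2_def if_distrib[of "(*) _"] cong: if_cong)
    then show ?thesis using \<pi>(3) by simp
  qed
  finally show "transport_cost U \<mu> \<nu> \<le> S + e" using \<pi>(4) pqn by (simp add: \<epsilon>_def)
qed

lemma nonexpansiveI:
  assumes "h \<in> borel_measurable M" "\<And>x. x \<in> space M \<Longrightarrow> 0 \<le> h x" "\<And>x. x \<in> space M \<Longrightarrow> h x \<le> 1"
    "\<And>x y. x \<in> space M \<Longrightarrow> y \<in> space M \<Longrightarrow> h x - h y \<le> U x y"
  shows "nonexpansive M U h"
  unfolding nonexpansive_def using assms by (auto intro!: nonexpansive_abs)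

lemma nonexpansive_Max:
  assumes "finite I" "I \<noteq> {}" "\<And>i. i \<in> I \<Longrightarrow> nonexpansive M U (f i)"
  shows "nonexpansive M U (\<lambda>x. Max ((\<lambda>i. f i x) ` I))"
proof (rule nonexpansiveI)
  have Max_in: "\<exists>i\<in>I. Max ((\<lambda>i. f i x) ` I) = f i x" for x
  proof -
    have "Max ((\<lambda>i. f i x) ` I) \<in> (\<lambda>i. f i x) ` I" using assms(1,2) by (intro Max_in) auto
    then show ?thesis by blast
  qed
  show "(\<lambda>x. Max ((\<lambda>i. f i x) ` I)) \<in> borel_measurable M"
    using assms by (intro borel_measurable_Max) (auto simp: nonexpansive_def)
  fix x assume x: "x \<in> space M"
  obtain i where i: "i \<in> I" "Max ((\<lambda>i. f i x) ` I) = f i x" using Max_in by blast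
  show "0 \<le> Max ((\<lambda>i. f i x) ` I)" "Max ((\<lambda>i. f i x) ` I) \<le> 1"
    unfolding i(2) using assms(3)[OF i(1)] x by (auto simp: nonexpansive_def)
  fix y assume y: "y \<in> space M"
  have "f i y \<le> Max ((\<lambda>i. f i y) ` I)" using assms(1) i(1) by simp
  moreover have "\<bar>f i x - f i y\<bar> \<le> U x y"
    using assms(3)[OF i(1)] x y by (auto simp: nonexpansive_def)
  ultimately show "Max ((\<lambda>i. f i x) ` I) - Max ((\<lambda>i. f i y) ` I) \<le> U x y"
    unfolding i(2) by linarith
qed

lemma nonexpansive_U: "a \<in> space M \<Longrightarrow> nonexpansive M U (\<lambda>x. U x a)"
  by (intro nonexpansiveI U_section_measurable)
    (use U_triangle in \<open>auto simp: U_ge_0 U_le_1 diff_le_eq\<close>)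

lemma nonexpansive_cone:
  assumes "a \<in> space M" "0 \<le> c" "c \<le> 1"
  shows "nonexpansive M U (\<lambda>x. max 0 (c - U x a))"
proof (rule nonexpansiveI)
  show "(\<lambda>x. max 0 (c - U x a)) \<in> borel_measurable M"
    using U_section_measurable[OF assms(1)] by measurable
  fix x y
  show "max 0 (c - U x a) - max 0 (c - U y a) \<le> U x y"
    using U_triangle[of y a x] U_sym[of x y] U_ge_0[of x y] by (auto simp: max_def)
qed (use assms U_ge_0 in \<open>auto simp: diff_le_eq add_increasing2\<close>)

text \<open>Up to a function of small integral, a nonexpansive function is one of finitely many maxima
  of cones, which the cones' heights at finitely many dense points determine.\<close>

theorem eventually_integrals_close:
  fixes \<mu> :: "'b \<Rightarrow> 'a measure"
  assumes \<mu>0: "prob_space \<mu>0" "sets \<mu>0 = sets M"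
    and \<mu>: "\<And>y. prob_space (\<mu> y)" "\<And>y. sets (\<mu> y) = sets M"
    and conv: "\<And>h. nonexpansive M U h \<Longrightarrow> ((\<lambda>y. \<integral>x. h x \<partial>\<mu> y) \<longlongrightarrow> (\<integral>x. h x \<partial>\<mu>0)) F"
    and "0 < e"
  shows "\<forall>\<^sub>F y in F. \<forall>h. nonexpansive M U h \<longrightarrow> \<bar>(\<integral>x. h x \<partial>\<mu>0) - (\<integral>x. h x \<partial>\<mu> y)\<bar> \<le> e"
proof -
  \<comment> \<open>A generous choice: the final comparison adds \<epsilon> for \<open>g\<close>, 4
    \<epsilon> for twice the integral of \<open>r\<close>, and \<epsilon> for
    \<open>1 / N\<close>.\<close>
  define \<epsilon> where "\<epsilon> = e / 20"
  have \<epsilon>: "0 < \<epsilon>" using \<open>0 < e\<close> by (simp add: \<epsilon>_def)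
  interpret \<mu>0: prob_space \<mu>0 by fact
  have sp0: "space \<mu>0 = space M" and sp: "space (\<mu> y) = space M" for y
    using \<mu>0(2) \<mu>(2) by (auto dest: sets_eq_imp_space_eq)
  then have "space M \<noteq> {}" using \<mu>0.not_empty by simp
  then obtain a :: "nat \<Rightarrow> 'a" where a: "\<And>i. a i \<in> space M"
      "\<And>x \<epsilon>. x \<in> space M \<Longrightarrow> 0 < \<epsilon> \<Longrightarrow> \<exists>i. U x (a i) < \<epsilon>"
    using dense_sequence by blast
  obtain n where n: "measure \<mu>0 {x \<in> space \<mu>0. \<forall>i<n. \<epsilon> \<le> U x (a i)} < \<epsilon>"
    using uncovered_measure_small[OF \<mu>0 a \<epsilon> \<epsilon>] unfolding eventually_sequentially by blast
  \<comment> \<open>The distance to the finite set \<open>a 0, ..., a n\<close>, written with a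
    maximum so that the closure properties make it nonexpansive. As a test function it has integrals
    that converge, hence its integral stays small along \<open>F\<close>.\<close>
  define r where "r x = 1 - Max ((\<lambda>i. 1 - U x (a i)) ` {..n})" for x
  have r: "nonexpansive M U r"
    unfolding r_def by (intro nonexpansive_compl nonexpansive_Max nonexpansive_U a) auto
  have r_le: "r x \<le> U x (a i)" if "i \<le> n" for x i
  proof -
    have "1 - U x (a i) \<le> Max ((\<lambda>i. 1 - U x (a i)) ` {..n})" using that by (intro Max_ge) auto
    then show ?thesis unfolding r_def by linarith
  qed
  have r_in: "\<exists>i\<le>n. r x = U x (a i)" for x
  proof -
    have "Max ((\<lambda>i. 1 - U x (a i)) ` {..n}) \<in> (\<lambda>i. 1 - U x (a i)) ` {..n}" by (intro Max_in) auto
    then obtain i where "Max ((\<lambda>i. 1 - U x (a i)) ` {..n}) = 1 - U x (a i)" "i \<in> {..n}" by (rule imageE)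
    then have "i \<le> n \<and> r x = U x (a i)" unfolding r_def by simp
    then show ?thesis by blast
  qed
  have int: "integrable \<rho> h" if "nonexpansive M U h" "prob_space \<rho>" "sets \<rho> = sets M" for h \<rho>
    using that sets_eq_imp_space_eq[OF that(3)]
    by (intro integrable_unit_interval) (auto simp: nonexpansive_def measurable_cong_sets[OF that(3) refl])
  have r0: "(\<integral>x. r x \<partial>\<mu>0) < 2 * \<epsilon>"
  proof -
    let ?A = "{x \<in> space \<mu>0. \<forall>i<n. \<epsilon> \<le> U x (a i)}"
    have [measurable]: "(\<lambda>x. U x (a i)) \<in> borel_measurable \<mu>0" for i
      using U_section_measurable[OF a(1)] measurable_cong_sets[OF \<mu>0(2) refl] by blast
    have A: "?A \<in> sets \<mu>0" by measurable
    then have iA: "integrable \<mu>0 (indicat_real ?A)"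
      by (intro integrable_real_indicator) (simp_all add: \<mu>0.emeasure_eq_measure)
    have "(\<integral>x. r x \<partial>\<mu>0) \<le> (\<integral>x. \<epsilon> + indicat_real ?A x \<partial>\<mu>0)"
    proof (rule integral_mono)
      fix x assume x: "x \<in> space \<mu>0"
      show "r x \<le> \<epsilon> + indicat_real ?A x"
      proof (cases "x \<in> ?A")
        case True
        then show ?thesis using r x \<epsilon> by (auto simp: nonexpansive_def sp0)
      next
        case False
        then obtain i where "i < n" "U x (a i) < \<epsilon>" using x by auto
        then show ?thesis using r_le[of i x] by (simp add: indicator_def)
      qed
    qed (use int[OF r \<mu>0] iA in auto)
    also have "\<dots> = \<epsilon> + measure \<mu>0 ?A" using iA A by (simp add: \<mu>0.prob_space)
    finally show ?thesis using n by simp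
  qed
  obtain N :: nat where N: "0 < N" "1 / N < \<epsilon>"
    using \<epsilon> by (metis nat_approx_posE of_nat_Suc zero_less_Suc)
  \<comment> \<open>The McShane extension of the heights \<open>\<phi> i / N\<close> from the
    centres, cut off at 0. The family is fixed before any \<open>h\<close> is chosen, so finitely
    many limits settle all \<open>h\<close> at once.\<close>
  define g where "g \<phi> x = Max ((\<lambda>i. max 0 (real (\<phi> i) / N - U x (a i))) ` {..n})" for \<phi> :: "nat \<Rightarrow> nat" and x
  define \<Phi> where "\<Phi> = PiE {..n} (\<lambda>_. {..N})"
  have "finite \<Phi>" unfolding \<Phi>_def by (intro finite_PiE) auto
  have g: "nonexpansive M U (g \<phi>)" if "\<phi> \<in> \<Phi>" for \<phi>
    unfolding g_def using that N(1)
    by (intro nonexpansive_Max nonexpansive_cone a) (auto simp: \<Phi>_def PiE_def Pi_def)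
  have "\<forall>\<^sub>F y in F. (\<integral>x. r x \<partial>\<mu> y) < 2 * \<epsilon>"
    using conv[OF r] r0 by (rule order_tendstoD)
  moreover have "\<forall>\<^sub>F y in F. \<forall>\<phi>\<in>\<Phi>. \<bar>(\<integral>x. g \<phi> x \<partial>\<mu> y) - (\<integral>x. g \<phi> x \<partial>\<mu>0)\<bar> < \<epsilon>"
    using conv[OF g, THEN tendstoD, OF _ \<epsilon>] \<open>finite \<Phi>\<close>
    by (auto intro!: eventually_ball_finite simp: dist_real_def)
  ultimately show ?thesis
  proof eventually_elim
    case (elim y)
    show ?case
    proof (intro allI impI)
      fix h assume h: "nonexpansive M U h"
      \<comment> \<open>Rounding down makes the extension a minorant of \<open>h\<close>;
        restricting makes the code an element of the finite set \<open>\<Phi>\<close>.\<close>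
      define \<phi> where "\<phi> = restrict (\<lambda>i. nat \<lfloor>N * h (a i)\<rfloor>) {..n}"
      have h01: "0 \<le> h (a i)" "h (a i) \<le> 1" for i using h a(1) by (auto simp: nonexpansive_def)
      have fl: "real (\<phi> i) \<le> N * h (a i)" "N * h (a i) < real (\<phi> i) + 1" if "i \<le> n" for i
        using that h01[of i] by (auto simp: \<phi>_def)
      have fl': "real (\<phi> i) / N \<le> h (a i)" "h (a i) \<le> real (\<phi> i) / N + 1 / N" if "i \<le> n" for i
        using fl[OF that] N(1) by (auto simp: field_simps)
      have "real (\<phi> i) \<le> N" if "i \<le> n" for i
        using fl(1)[OF that] h01[of i] N(1) mult_left_le[of "h (a i)" "real N"] by linarith
      then have \<phi>: "\<phi> \<in> \<Phi>" by (auto simp: \<Phi>_def PiE_def Pi_def \<phi>_def)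
      have lower: "g \<phi> x \<le> h x" if x: "x \<in> space M" for x
      proof -
        have "max 0 (real (\<phi> i) / N - U x (a i)) \<le> h x" if i: "i \<le> n" for i
        proof -
          have "0 \<le> h x" "\<bar>h x - h (a i)\<bar> \<le> U x (a i)" using h x a(1) by (auto simp: nonexpansive_def)
          then show ?thesis using fl'(1)[OF i] by auto
        qed
        then show ?thesis unfolding g_def by (intro Max.boundedI) auto
      qed
      \<comment> \<open>The distance \<open>r x\<close> to the nearest centre is paid twice, once by
        \<open>h\<close> and once by the slope of the cone; \<open>1 / N\<close> is the rounding
        error.\<close>
      have upper: "h x \<le> g \<phi> x + (2 * r x + 1 / N)" if x: "x \<in> space M" for x
      proof -
        obtain i where i: "i \<le> n" "r x = U x (a i)" using r_in by blast
        have "max 0 (real (\<phi> i) / N - U x (a i)) \<le> g \<phi> x"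
          unfolding g_def using i(1) by (intro Max_ge) auto
        moreover have "\<bar>h x - h (a i)\<bar> \<le> U x (a i)" using h x a(1) by (auto simp: nonexpansive_def)
        ultimately show ?thesis using fl'(2)[OF i(1)] i(2) by linarith
      qed
      have close: "(\<integral>x. g \<phi> x \<partial>\<rho>) \<le> (\<integral>x. h x \<partial>\<rho>) \<and> (\<integral>x. h x \<partial>\<rho>) \<le> (\<integral>x. g \<phi> x \<partial>\<rho>) + (2 * (\<integral>x. r x \<partial>\<rho>) + 1 / N)"
        if \<rho>: "prob_space \<rho>" "sets \<rho> = sets M" for \<rho>
      proof -
        interpret \<rho>: prob_space \<rho> by fact
        have spr: "space \<rho> = space M" using \<rho>(2) by (rule sets_eq_imp_space_eq)
        note i = int[OF h \<rho>] int[OF g[OF \<phi>] \<rho>] int[OF r \<rho>]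
        have "(\<integral>x. g \<phi> x \<partial>\<rho>) \<le> (\<integral>x. h x \<partial>\<rho>)" using i lower spr by (intro integral_mono) auto
        moreover have "(\<integral>x. h x \<partial>\<rho>) \<le> (\<integral>x. g \<phi> x + (2 * r x + 1 / N) \<partial>\<rho>)"
          using i upper spr by (intro integral_mono) auto
        ultimately show ?thesis using i by (simp add: \<rho>.prob_space)
      qed
      show "\<bar>(\<integral>x. h x \<partial>\<mu>0) - (\<integral>x. h x \<partial>\<mu> y)\<bar> \<le> e"
        using close[OF \<mu>0] close[OF \<mu>(1)[of y] \<mu>(2)[of y]] elim(1) bspec[OF elim(2) \<phi>] r0 N(2) \<epsilon>
        unfolding \<epsilon>_def by linarith
    qed
  qed
qed

end

section \<open>Continuous pseudometrics and trajectories\<close>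

text \<open>Continuity is demanded at the diagonal only, the form in which it can be checked for an
  iterate; by the triangle inequality it amounts to joint continuity, see
  \<open>cont\<close>.\<close>

locale continuous_pseudometric =
  fixes m :: "'e::{second_countable_topology, t2_space} \<Rightarrow> 'e \<Rightarrow> real"
  assumes ge_0: "0 \<le> m x y" and le_1: "m x y \<le> 1" and refl: "m x x = 0"
    and sym: "m x y = m y x" and triangle: "m x z \<le> m x y + m y z"
    and small: "0 < e \<Longrightarrow> \<forall>\<^sub>F y in nhds x. m x y < e"
begin

lemma diff_le: "\<bar>m x y - m x' y'\<bar> \<le> m x' x + m y' y"
  using triangle[of x y x'] triangle[of x' y y'] triangle[of x' y' x] triangle[of x y' y]
    sym[of x x'] sym[of y y'] by linarith

lemma cont: "continuous_on UNIV (\<lambda>p. m (fst p) (snd p))"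
proof (rule continuous_at_imp_continuous_on, rule ballI)
  fix p :: "'e \<times> 'e"
  have ev: "\<forall>\<^sub>F q in nhds p. m (fst p) (fst q) < e / 2 \<and> m (snd p) (snd q) < e / 2" if "0 < e" for e
  proof (rule eventually_conj)
    have "filterlim fst (nhds (fst p)) (nhds p)" "filterlim snd (nhds (snd p)) (nhds p)"
      by (auto intro!: tendsto_intros filterlim_ident)
    then show "\<forall>\<^sub>F q in nhds p. m (fst p) (fst q) < e / 2" "\<forall>\<^sub>F q in nhds p. m (snd p) (snd q) < e / 2"
      using small[of "e / 2"] that by (auto simp: filterlim_iff)
  qed
  have "((\<lambda>p. m (fst p) (snd p)) \<longlongrightarrow> m (fst p) (snd p)) (nhds p)"
  proof (rule tendstoI)
    fix e :: real assume "0 < e"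
    from ev[OF this] show "\<forall>\<^sub>F q in nhds p. dist (m (fst q) (snd q)) (m (fst p) (snd p)) < e"
    proof eventually_elim
      case (elim q)
      then show ?case using diff_le[of "fst q" "snd q" "fst p" "snd p"] by (simp add: dist_real_def)
    qed
  qed
  then show "isCont (\<lambda>p. m (fst p) (snd p)) p"
    unfolding isCont_def by (rule iffD2[OF tendsto_at_iff_tendsto_nhds[of "\<lambda>p. m (fst p) (snd p)" p]])
qed

lemma cont2: "continuous_on S f \<Longrightarrow> continuous_on S g \<Longrightarrow> continuous_on S (\<lambda>x. m (f x) (g x))"
  using continuous_on_compose2[OF cont continuous_on_Pair[of S f g]] by simp

lemma measurable2: "f \<in> borel_measurable N \<Longrightarrow> g \<in> borel_measurable N \<Longrightarrow>
    (\<lambda>x. m (f x) (g x)) \<in> borel_measurable N"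
  using measurable_compose[OF borel_measurable_Pair[of f N g] borel_measurable_continuous_onI[OF cont]]
  by simp

sublocale separable_cost borel m
proof
  show "(\<lambda>p. m (fst p) (snd p)) \<in> borel_measurable (borel \<Otimes>\<^sub>M borel)"
    by (intro measurable2) measurable
  obtain D :: "'e set" where D: "countable D" "\<And>X. open X \<Longrightarrow> X \<noteq> {} \<Longrightarrow> \<exists>d\<in>D. d \<in> X"
    using countable_dense_setE by blast
  have "\<exists>d\<in>D. m x d < e" if e: "0 < e" for x e
  proof -
    obtain S where "open S" "x \<in> S" "\<forall>y\<in>S. m x y < e"
      using small[OF e, of x] unfolding eventually_nhds by blast
    then show ?thesis using D(2)[of S] by blast
  qed
  with D(1) show "\<exists>D. countable D \<and> D \<subseteq> space borel \<and> (\<forall>x\<in>space borel. \<forall>\<epsilon>>0. \<exists>d\<in>D. m x d < \<epsilon>)"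
    by auto
qed (auto intro: ge_0 le_1 refl sym triangle)

end

section \<open>Evaluations, rational times and the discounted cost on trajectories\<close>

lemma space_trajectory_space [simp]: "space trajectory_space = trajectories"
  unfolding trajectory_space_def by (rule space_measure_of) auto

lemma measurable_evaluation:
  assumes "0 \<le> t"
  shows "(\<lambda>\<omega>. \<omega> t) \<in> borel_measurable (trajectory_space :: (real \<Rightarrow> 'e::topological_space) measure)"
proof (rule measurableI)
  fix A :: "'e set" assume "A \<in> sets borel"
  then have "{\<omega> \<in> trajectories. \<omega> t \<in> A} \<in> sets trajectory_space"
    unfolding trajectory_space_def using assms by (intro in_measure_of) auto
  then show "(\<lambda>\<omega>. \<omega> t) -` A \<inter> space trajectory_space \<in> sets trajectory_space"
    by (simp add: vimage_def Int_def conj_commute)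
qed simp

text \<open>Formulas mention rational times only, suprema run over all times; this bridges the two.
  The rational is taken to the right of \<open>t\<close> so that it stays nonnegative.\<close>

lemma rational_approximation:
  fixes f :: "real \<Rightarrow> real"
  assumes "continuous_on {0..} f" "0 \<le> t" "0 < e"
  obtains q where "q \<in> \<rat>" "0 \<le> q" "\<bar>f q - f t\<bar> < e"
proof -
  have "t \<in> {0..}" using assms(2) by simp
  with assms(1)[unfolded continuous_on_iff] assms(3)
  obtain d where d: "0 < d" "\<And>s. s \<in> {0..} \<Longrightarrow> dist s t < d \<Longrightarrow> dist (f s) (f t) < e"
    by blast
  obtain q where "q \<in> \<rat>" "t < q" "q < t + d" using Rats_dense_in_real[of t "t + d"] d(1) by auto
  then show thesis using d(2)[of q] assms(2) by (intro that[of q]) (auto simp: dist_real_def)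
qed

lemma discount_small:
  fixes c e :: real
  assumes "0 < c" "c < 1" "0 < e"
  obtains N :: nat where "\<And>t. real N \<le> t \<Longrightarrow> c powr t \<le> e"
proof -
  obtain N where N: "c ^ N < e" using real_arch_pow_inv[of e c] assms by auto
  show thesis
  proof (rule that)
    fix t assume "real N \<le> t"
    then have "c powr t \<le> c powr real N" using assms by (intro powr_mono') auto
    then show "c powr t \<le> e" using N assms by (simp add: powr_realpow)
  qed
qed

locale discounted = continuous_pseudometric m
  for m :: "'e::{second_countable_topology, t2_space} \<Rightarrow> 'e \<Rightarrow> real" +
  fixes c :: real
  assumes c: "0 < c" "c < 1"
begin

lemma powr_le_1: "0 \<le> t \<Longrightarrow> c powr t \<le> 1"
  using c powr_mono'[of 0 t c] by simp

lemma discounted_le: "0 \<le> t \<Longrightarrow> c powr t * m x y \<le> m x y"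
  using mult_right_mono[OF powr_le_1 ge_0] by simp

lemma U_upper: "0 \<le> t \<Longrightarrow> c powr t * m (\<omega> t) (\<omega>' t) \<le> U_op c m \<omega> \<omega>'"
  unfolding U_op_def
  by (intro cSUP_upper bdd_aboveI2[where M=1]) (auto intro: order_trans[OF discounted_le le_1])

lemma U_least: "(\<And>t. 0 \<le> t \<Longrightarrow> c powr t * m (\<omega> t) (\<omega>' t) \<le> a) \<Longrightarrow> U_op c m \<omega> \<omega>' \<le> a"
  unfolding U_op_def by (intro cSUP_least) auto

lemma U_ge_initial: "m (\<omega> 0) (\<omega>' 0) \<le> U_op c m \<omega> \<omega>'"
  using U_upper[of 0 \<omega> \<omega>'] c by simp

text \<open>Beyond \<open>T\<close> the discount alone is at most \<open>e\<close>, as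
  \<open>m\<close> is at most 1. So \<open>U_op c m\<close> is controlled by a compact time
  interval, the source both of separability and of its continuity along the uniform metric.\<close>

lemma U_le_if_close:
  assumes "\<And>t. 0 \<le> t \<Longrightarrow> t \<le> T \<Longrightarrow> m (\<omega> t) (\<omega>' t) \<le> e" "\<And>t. T \<le> t \<Longrightarrow> c powr t \<le> e"
  shows "U_op c m \<omega> \<omega>' \<le> e"
proof (rule U_least)
  fix t :: real assume t: "0 \<le> t"
  show "c powr t * m (\<omega> t) (\<omega>' t) \<le> e"
  proof (cases "t \<le> T")
    case True
    then show ?thesis using assms(1)[OF t] discounted_le[OF t, of "\<omega> t" "\<omega>' t"] by simp
  next
    case False
    then have "c powr t * m (\<omega> t) (\<omega>' t) \<le> c powr t"
      using le_1 c by (intro mult_left_le) auto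
    then show ?thesis using assms(2)[of t] False by simp
  qed
qed

lemma continuous_discounted:
  assumes "\<omega> \<in> trajectories" "\<omega>' \<in> trajectories"
  shows "continuous_on {0..} (\<lambda>t. c powr t * m (\<omega> t) (\<omega>' t))"
  using assms c by (intro continuous_intros cont2) (auto simp: trajectories_def)

text \<open>Along two trajectories the discounted distance is continuous in time. The countable
  supremum yields measurability of \<open>U_op c m\<close> and times that formulas can name.\<close>

lemma U_rational:
  assumes "\<omega> \<in> trajectories" "\<omega>' \<in> trajectories"
  shows "U_op c m \<omega> \<omega>' = (SUP t\<in>{0..} \<inter> \<rat>. c powr t * m (\<omega> t) (\<omega>' t))"
proof (rule antisym)
  have bdd: "bdd_above ((\<lambda>t. c powr t * m (\<omega> t) (\<omega>' t)) ` ({0..} \<inter> \<rat>))"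
    by (intro bdd_aboveI2[where M=1]) (auto intro: order_trans[OF discounted_le le_1])
  show "U_op c m \<omega> \<omega>' \<le> (SUP t\<in>{0..} \<inter> \<rat>. c powr t * m (\<omega> t) (\<omega>' t))"
  proof (rule U_least, rule field_le_epsilon)
    fix t e :: real assume "0 \<le> t" "0 < e"
    then obtain q where q: "q \<in> \<rat>" "0 \<le> q" "\<bar>c powr q * m (\<omega> q) (\<omega>' q) - c powr t * m (\<omega> t) (\<omega>' t)\<bar> < e"
      by (rule rational_approximation[OF continuous_discounted[OF assms]])
    then have "c powr q * m (\<omega> q) (\<omega>' q) \<le> (SUP t\<in>{0..} \<inter> \<rat>. c powr t * m (\<omega> t) (\<omega>' t))"
      by (intro cSUP_upper bdd) auto
    then show "c powr t * m (\<omega> t) (\<omega>' t) \<le> (SUP t\<in>{0..} \<inter> \<rat>. c powr t * m (\<omega> t) (\<omega>' t)) + e"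
      using q(3) by linarith
  qed
  have "0 \<in> {0..} \<inter> (\<rat> :: real set)" by simp
  then show "(SUP t\<in>{0..} \<inter> \<rat>. c powr t * m (\<omega> t) (\<omega>' t)) \<le> U_op c m \<omega> \<omega>'"
    by (intro cSUP_least U_upper) auto
qed

lemma U_measurable_trajectories:
  "(\<lambda>p. U_op c m (fst p) (snd p)) \<in> borel_measurable (trajectory_space \<Otimes>\<^sub>M trajectory_space)"
proof -
  have "(\<lambda>p. SUP t\<in>{0..} \<inter> \<rat>. c powr t * m (fst p t) (snd p t)) \<in>
      borel_measurable (trajectory_space \<Otimes>\<^sub>M trajectory_space)"
  proof (intro borel_measurable_cSUP borel_measurable_times measurable2)
    show "countable ({0..} \<inter> (\<rat> :: real set))" using countable_rat by blast
    fix t :: real assume "t \<in> {0..} \<inter> \<rat>"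
    then have "0 \<le> t" by simp
    from measurable_evaluation[OF this] show
      "(\<lambda>p. fst p t) \<in> borel_measurable (trajectory_space \<Otimes>\<^sub>M trajectory_space)"
      "(\<lambda>p. snd p t) \<in> borel_measurable (trajectory_space \<Otimes>\<^sub>M trajectory_space)"
      by measurable
  qed (auto intro!: bdd_aboveI2[where M=1] intro: order_trans[OF discounted_le le_1])
  then show ?thesis
    by (rule measurable_cong[THEN iffD2, rotated]) (auto simp: space_pair_measure U_rational)
qed

text \<open>Uniform continuity is applied to the real function
  \<open>m (\<omega> s) (\<omega> t)\<close> on a compact square rather than to \<omega>, as
  \<open>m\<close> need not induce the topology of the state space. The function vanishes on the
  diagonal, and every \<open>t\<close> lies close to the grid point on its left.\<close>

lemma trajectory_grid:
  assumes "\<omega> \<in> trajectories" "0 < e"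
  shows "\<exists>k. \<forall>t\<in>{0..real N}. m (\<omega> t) (\<omega> (real (nat \<lfloor>t * real (Suc k)\<rfloor>) / real (Suc k))) < e"
proof -
  let ?I = "{0..real N} \<times> {0..real N}"
  have tr: "continuous_on {0..real N} \<omega>"
    using assms(1) by (auto simp: trajectories_def intro: continuous_on_subset)
  have "continuous_on ?I (\<lambda>p. \<omega> (fst p))" "continuous_on ?I (\<lambda>p. \<omega> (snd p))"
    by (intro continuous_on_compose2[OF tr] continuous_intros; auto)+
  then have "uniformly_continuous_on ?I (\<lambda>p. m (\<omega> (fst p)) (\<omega> (snd p)))"
    by (intro compact_uniformly_continuous cont2 compact_Times compact_Icc)
  then obtain d where d: "0 < d" "\<And>p q. p \<in> ?I \<Longrightarrow> q \<in> ?I \<Longrightarrow> dist q p < d \<Longrightarrow>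
      dist (m (\<omega> (fst q)) (\<omega> (snd q))) (m (\<omega> (fst p)) (\<omega> (snd p))) < e"
    unfolding uniformly_continuous_on_def using \<open>0 < e\<close> by metis
  obtain k where k: "1 / real (Suc k) < d" by (rule nat_approx_posE[OF d(1)])
  show ?thesis
  proof (intro exI ballI)
    fix t assume t: "t \<in> {0..real N}"
    define s where "s = real (nat \<lfloor>t * real (Suc k)\<rfloor>) / real (Suc k)"
    have fl: "real (nat \<lfloor>t * real (Suc k)\<rfloor>) \<le> t * real (Suc k)"
      "t * real (Suc k) < real (nat \<lfloor>t * real (Suc k)\<rfloor>) + 1"
      using t by (simp_all del: of_nat_Suc)
    have "s \<le> t" using fl(1) unfolding s_def by (simp add: field_simps)
    moreover have "t - s \<le> 1 / real (Suc k)"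
    proof -
      have "s * real (Suc k) = real (nat \<lfloor>t * real (Suc k)\<rfloor>)" unfolding s_def by (simp del: of_nat_Suc)
      then have "(t - s) * real (Suc k) \<le> 1" using fl(2) unfolding left_diff_distrib by linarith
      then show ?thesis by (simp only: pos_le_divide_eq of_nat_0_less_iff zero_less_Suc)
    qed
    moreover have "0 \<le> s" by (simp add: s_def)
    ultimately have "dist (t, s) (t, t) < d" "s \<in> {0..real N}"
      using k t by (auto simp: dist_Pair_Pair dist_real_def)
    then show "m (\<omega> t) (\<omega> (real (nat \<lfloor>t * real (Suc k)\<rfloor>) / real (Suc k))) < e"
      unfolding s_def[symmetric]
      using d(2)[of "(t, t)" "(t, s)"] t by (auto simp: refl dist_real_def)
  qed
qed

text \<open>Trajectories that share a grid size and, at every grid point, a nearby point of a dense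
  sequence are close; there are countably many such codes.\<close>

lemma trajectory_codes:
  assumes "0 < e"
  obtains \<kappa> :: "(real \<Rightarrow> 'e) \<Rightarrow> nat" where
    "\<And>\<omega> \<omega>'. \<omega> \<in> trajectories \<Longrightarrow> \<omega>' \<in> trajectories \<Longrightarrow> \<kappa> \<omega> = \<kappa> \<omega>' \<Longrightarrow> U_op c m \<omega> \<omega>' \<le> e"
proof -
  \<comment> \<open>Four legs join two trajectories of equal code at time \<open>t\<close>: each to
    its value at the grid point, and from there to the common dense point.\<close>
  have e4: "0 < e / 4" using assms by simp
  obtain a :: "nat \<Rightarrow> 'e" where a: "\<And>x \<epsilon>. 0 < \<epsilon> \<Longrightarrow> \<exists>i. m x (a i) < \<epsilon>"
    using dense_sequence by auto
  obtain N :: nat where N: "\<And>t. real N \<le> t \<Longrightarrow> c powr t \<le> e"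
    using discount_small[OF c assms] by blast
  define g where "g k i = real i / real (Suc k)" for k i :: nat
  define K where "K \<omega> = (SOME k. \<forall>t\<in>{0..real N}. m (\<omega> t) (\<omega> (g k (nat \<lfloor>t * real (Suc k)\<rfloor>))) < e / 4)" for \<omega>
  have K: "m (\<omega> t) (\<omega> (g (K \<omega>) (nat \<lfloor>t * real (Suc (K \<omega>))\<rfloor>))) < e / 4"
    if "\<omega> \<in> trajectories" "0 \<le> t" "t \<le> real N" for \<omega> t
    using someI_ex[OF trajectory_grid[OF that(1) e4, of N]] that(2,3)
    unfolding K_def g_def by auto
  define J where "J x = (SOME i. m x (a i) < e / 4)" for x
  have J: "m x (a (J x)) < e / 4" for x
    unfolding J_def using a[OF e4, of x] by (rule someI_ex)
  \<comment> \<open>The list includes index \<open>N * Suc (K \<omega>)\<close>, the grid point of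
    the end time \<open>N\<close>; hence the extra \<open>Suc\<close>.\<close>
  define \<kappa> where "\<kappa> \<omega> = to_nat (K \<omega>, map (\<lambda>i. J (\<omega> (g (K \<omega>) i))) [0..<Suc (N * Suc (K \<omega>))])" for \<omega>
  show thesis
  proof (rule that)
    fix \<omega> \<omega>' :: "real \<Rightarrow> 'e" assume \<omega>: "\<omega> \<in> trajectories" "\<omega>' \<in> trajectories" "\<kappa> \<omega> = \<kappa> \<omega>'"
    then have KK: "K \<omega>' = K \<omega>" and JJ: "\<And>i. i < Suc (N * Suc (K \<omega>)) \<Longrightarrow> J (\<omega>' (g (K \<omega>) i)) = J (\<omega> (g (K \<omega>) i))"
      unfolding \<kappa>_def by (auto simp del: upt_Suc)
    show "U_op c m \<omega> \<omega>' \<le> e"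
    proof (rule U_le_if_close[OF _ N])
      fix t :: real assume t: "0 \<le> t" "t \<le> real N"
      define i where "i = nat \<lfloor>t * real (Suc (K \<omega>))\<rfloor>"
      have "t * real (Suc (K \<omega>)) \<le> real N * real (Suc (K \<omega>))" using t(2) by (intro mult_right_mono) auto
      then have "t * real (Suc (K \<omega>)) \<le> real (N * Suc (K \<omega>))" by (simp only: of_nat_mult)
      then have "i \<le> N * Suc (K \<omega>)" unfolding i_def by linarith
      then have eq: "J (\<omega>' (g (K \<omega>) i)) = J (\<omega> (g (K \<omega>) i))" by (intro JJ) simp
      have "m (\<omega> t) (\<omega> (g (K \<omega>) i)) < e / 4" "m (\<omega>' t) (\<omega>' (g (K \<omega>) i)) < e / 4"
        using K[OF \<omega>(1) t] K[OF \<omega>(2) t] by (simp_all only: i_def KK)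
      moreover have "m (\<omega> (g (K \<omega>) i)) (a (J (\<omega> (g (K \<omega>) i)))) < e / 4"
          "m (\<omega>' (g (K \<omega>) i)) (a (J (\<omega> (g (K \<omega>) i)))) < e / 4"
        using J[of "\<omega> (g (K \<omega>) i)"] J[of "\<omega>' (g (K \<omega>) i)"] unfolding eq .
      ultimately show "m (\<omega> t) (\<omega>' t) \<le> e"
        using triangle[of "\<omega> t" "\<omega>' t" "\<omega> (g (K \<omega>) i)"]
          triangle[of "\<omega> (g (K \<omega>) i)" "\<omega>' t" "a (J (\<omega> (g (K \<omega>) i)))"]
          triangle[of "a (J (\<omega> (g (K \<omega>) i)))" "\<omega>' t" "\<omega>' (g (K \<omega>) i)"]
          sym[of "a (J (\<omega> (g (K \<omega>) i)))" "\<omega>' (g (K \<omega>) i)"] sym[of "\<omega>' (g (K \<omega>) i)" "\<omega>' t"]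
        by linarith
    qed auto
  qed
qed

lemma separable_cost_trajectories: "separable_cost trajectory_space (U_op c m)"
proof
  show "0 \<le> U_op c m \<omega> \<omega>'" for \<omega> \<omega>' using U_ge_initial ge_0 by (rule order_trans[rotated])
  show "U_op c m \<omega> \<omega>' \<le> 1" for \<omega> \<omega>'
    by (rule U_least) (auto intro: order_trans[OF discounted_le le_1])
  show "U_op c m \<omega> \<omega> = 0" for \<omega> by (simp add: U_op_def refl)
  show "U_op c m \<omega> \<omega>' = U_op c m \<omega>' \<omega>" for \<omega> \<omega>' by (simp add: U_op_def sym)
  show "U_op c m \<omega> \<omega>'' \<le> U_op c m \<omega> \<omega>' + U_op c m \<omega>' \<omega>''" for \<omega> \<omega>' \<omega>''
  proof (rule U_least)
    fix t :: real assume t: "0 \<le> t"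
    have "c powr t * m (\<omega> t) (\<omega>'' t) \<le> c powr t * (m (\<omega> t) (\<omega>' t) + m (\<omega>' t) (\<omega>'' t))"
      by (intro mult_left_mono triangle) simp
    then show "c powr t * m (\<omega> t) (\<omega>'' t) \<le> U_op c m \<omega> \<omega>' + U_op c m \<omega>' \<omega>''"
      using U_upper[OF t, of \<omega> \<omega>'] U_upper[OF t, of \<omega>' \<omega>''] by (simp add: distrib_left)
  qed
  show "(\<lambda>p. U_op c m (fst p) (snd p)) \<in> borel_measurable (trajectory_space \<Otimes>\<^sub>M trajectory_space)"
    by (rule U_measurable_trajectories)
  have ex: "\<exists>D. countable D \<and> D \<subseteq> trajectories \<and> (\<forall>\<omega>\<in>trajectories. \<exists>d\<in>D. U_op c m \<omega> d \<le> 1 / real (Suc n))" for n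
  proof -
    have p: "0 < 1 / real (Suc n)" by simp
    obtain \<kappa> :: "(real \<Rightarrow> 'e) \<Rightarrow> nat" where \<kappa>: "\<And>\<omega> \<omega>'. \<omega> \<in> trajectories \<Longrightarrow> \<omega>' \<in> trajectories \<Longrightarrow>
        \<kappa> \<omega> = \<kappa> \<omega>' \<Longrightarrow> U_op c m \<omega> \<omega>' \<le> 1 / real (Suc n)"
      using trajectory_codes[OF p] by blast
    \<comment> \<open>One trajectory for each code that occurs. Choosing representatives avoids
      interpolating between points of the state space, which need not be joined by a path.\<close>
    let ?D = "inv_into trajectories \<kappa> ` \<kappa> ` trajectories"
    have "countable ?D" by (rule countable_image, rule countableI_type)
    moreover have "?D \<subseteq> trajectories" by (auto intro: inv_into_into)
    moreover have "\<exists>d\<in>?D. U_op c m \<omega> d \<le> 1 / real (Suc n)" if "\<omega> \<in> trajectories" for \<omega>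
      using that by (intro bexI[of _ "inv_into trajectories \<kappa> (\<kappa> \<omega>)"] \<kappa>) (auto simp: f_inv_into_f inv_into_into)
    ultimately show ?thesis by blast
  qed
  obtain D where D: "\<forall>n. countable (D n) \<and> D n \<subseteq> trajectories \<and>
      (\<forall>\<omega>\<in>trajectories. \<exists>d\<in>D n. U_op c m \<omega> d \<le> 1 / real (Suc n))"
    using choice[OF allI, OF ex] ..
  show "\<exists>D. countable D \<and> D \<subseteq> space trajectory_space \<and>
      (\<forall>\<omega>\<in>space trajectory_space. \<forall>\<epsilon>>0. \<exists>d\<in>D. U_op c m \<omega> d < \<epsilon>)"
  proof (intro exI[of _ "\<Union>n. D n"] conjI ballI allI impI)
    fix \<omega> :: "real \<Rightarrow> 'e" and \<epsilon> :: real assume \<omega>: "\<omega> \<in> space trajectory_space" "0 < \<epsilon>"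
    obtain n where n: "1 / real (Suc n) < \<epsilon>" by (rule nat_approx_posE[OF \<omega>(2)])
    obtain d where "d \<in> D n" "U_op c m \<omega> d \<le> 1 / real (Suc n)" using D \<omega>(1) unfolding space_trajectory_space by blast
    then show "\<exists>d\<in>\<Union>n. D n. U_op c m \<omega> d < \<epsilon>" using n by (intro bexI[of _ d]) auto
  next
    show "countable (\<Union>n. D n)" using D by (intro countable_UN) auto
    show "(\<Union>n. D n) \<subseteq> space trajectory_space" using D unfolding space_trajectory_space by blast
  qed
qed

end

section \<open>Path measures and their marginals\<close>

context diffusion
begin

lemma Delta_metric: "0 \<le> \<Delta> x y" "\<Delta> x y = 0 \<longleftrightarrow> x = y" "\<Delta> x y = \<Delta> y x" "\<Delta> x z \<le> \<Delta> x y + \<Delta> y z"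
proof -
  interpret Metric_space UNIV \<Delta> by (rule metric)
  show "0 \<le> \<Delta> x y" "\<Delta> x y = 0 \<longleftrightarrow> x = y" "\<Delta> x y = \<Delta> y x" "\<Delta> x z \<le> \<Delta> x y + \<Delta> y z"
    using commute[of x y] triangle[of x y z] by auto
qed

lemma open_iff_Delta: "open S \<longleftrightarrow> (\<forall>x\<in>S. \<exists>r>0. \<forall>y. \<Delta> x y < r \<longrightarrow> y \<in> S)"
proof -
  interpret Metric_space UNIV \<Delta> by (rule metric)
  have "open S \<longleftrightarrow> openin mtopology S" by (simp add: metric_topology)
  then show ?thesis by (simp add: openin_mtopology subset_iff Ball_def)
qed

lemma eventually_nhds_Delta: "eventually Q (nhds x) \<longleftrightarrow> (\<exists>r>0. \<forall>y. \<Delta> x y < r \<longrightarrow> Q y)"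
proof
  assume "eventually Q (nhds x)"
  then show "\<exists>r>0. \<forall>y. \<Delta> x y < r \<longrightarrow> Q y"
    unfolding eventually_nhds open_iff_Delta by blast
next
  assume "\<exists>r>0. \<forall>y. \<Delta> x y < r \<longrightarrow> Q y"
  then obtain r where r: "0 < r" "\<And>y. \<Delta> x y < r \<Longrightarrow> Q y" by blast
  have "open {y. \<Delta> x y < r}"
    unfolding open_iff_Delta
  proof safe
    fix y assume "\<Delta> x y < r"
    then show "\<exists>s>0. \<forall>z. \<Delta> y z < s \<longrightarrow> z \<in> {y. \<Delta> x y < r}"
      using Delta_metric(4)[of x _ y] by (intro exI[of _ "r - \<Delta> x y"]) (auto; smt (verit))
  qed
  then show "eventually Q (nhds x)"
    unfolding eventually_nhds using r Delta_metric(2)[of x x] by (intro exI[of _ "{y. \<Delta> x y < r}"]) auto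
qed

lemma open_Delta_ball: "open {y. \<Delta> x y < r}"
proof -
  interpret Metric_space UNIV \<Delta> by (rule metric)
  have "openin mtopology (mball x r)" by (rule openin_mball)
  moreover have "mball x r = {y. \<Delta> x y < r}" by auto
  ultimately show ?thesis by (simp add: metric_topology)
qed

lemma uniform_metric_ge: "0 \<le> t \<Longrightarrow> \<Delta> (\<omega> t) (\<omega>' t) \<le> uniform_metric \<Delta> \<omega> \<omega>'"
  unfolding uniform_metric_def using metric_le_1 by (intro cSUP_upper bdd_aboveI2[where M=1]) auto

lemma uniform_metric_least: "(\<And>t. 0 \<le> t \<Longrightarrow> \<Delta> (\<omega> t) (\<omega>' t) \<le> a) \<Longrightarrow> uniform_metric \<Delta> \<omega> \<omega>' \<le> a"
  unfolding uniform_metric_def by (intro cSUP_least) auto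

lemma Metric_space_trajectories: "Metric_space trajectories (uniform_metric \<Delta>)"
proof
  fix \<omega> \<omega>' \<omega>'' :: "real \<Rightarrow> 'e"
  show ge: "0 \<le> uniform_metric \<Delta> \<omega> \<omega>'"
    using Delta_metric(1)[of "\<omega> 0" "\<omega>' 0"] uniform_metric_ge[of 0 \<omega> \<omega>'] by simp
  show "uniform_metric \<Delta> \<omega> \<omega>' = uniform_metric \<Delta> \<omega>' \<omega>"
    unfolding uniform_metric_def by (simp add: Delta_metric(3))
  assume \<omega>: "\<omega> \<in> trajectories" "\<omega>' \<in> trajectories"
  show "uniform_metric \<Delta> \<omega> \<omega>' = 0 \<longleftrightarrow> \<omega> = \<omega>'"
  proof
    assume 0: "uniform_metric \<Delta> \<omega> \<omega>' = 0"
    have "\<omega> t = \<omega>' t" if "0 \<le> t" for t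
    proof -
      have "\<Delta> (\<omega> t) (\<omega>' t) = 0"
        using uniform_metric_ge[OF that, of \<omega> \<omega>'] 0 Delta_metric(1)[of "\<omega> t" "\<omega>' t"] by simp
      then show ?thesis by (simp add: Delta_metric(2))
    qed
    \<comment> \<open>Agreement at nonnegative times suffices because trajectories are
      \<open>undefined\<close> at negative ones.\<close>
    then show "\<omega> = \<omega>'" using \<omega> by (intro extensionalityI[of _ "{0..}"]) (auto simp: trajectories_def)
  next
    assume "\<omega> = \<omega>'"
    then have "uniform_metric \<Delta> \<omega> \<omega>' \<le> 0"
      by (intro uniform_metric_least) (simp add: iffD2[OF Delta_metric(2)])
    then show "uniform_metric \<Delta> \<omega> \<omega>' = 0" using ge by simp
  qed
  show "uniform_metric \<Delta> \<omega> \<omega>'' \<le> uniform_metric \<Delta> \<omega> \<omega>' + uniform_metric \<Delta> \<omega>' \<omega>''"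
  proof (rule uniform_metric_least)
    fix t :: real assume "0 \<le> t"
    then show "\<Delta> (\<omega> t) (\<omega>'' t) \<le> uniform_metric \<Delta> \<omega> \<omega>' + uniform_metric \<Delta> \<omega>' \<omega>''"
      using uniform_metric_ge[of t \<omega> \<omega>'] uniform_metric_ge[of t \<omega>' \<omega>'']
        Delta_metric(4)[of "\<omega> t" "\<omega>'' t" "\<omega>' t"] by linarith
  qed
qed

lemma continuous_map_trajectoriesI:
  fixes h :: "(real \<Rightarrow> 'e) \<Rightarrow> real"
  assumes "\<And>\<omega> e. \<omega> \<in> trajectories \<Longrightarrow> 0 < e \<Longrightarrow>
    \<exists>d>0. \<forall>\<omega>'\<in>trajectories. uniform_metric \<Delta> \<omega> \<omega>' < d \<longrightarrow> dist (h \<omega>') (h \<omega>) < e"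
  shows "continuous_map (Metric_space.mtopology trajectories (uniform_metric \<Delta>)) euclidean h"
proof -
  interpret Metric_space trajectories "uniform_metric \<Delta>" by (rule Metric_space_trajectories)
  show ?thesis
    unfolding continuous_map
  proof (intro conjI allI impI)
    fix V :: "real set" assume "openin euclidean V"
    then have V: "open V" by simp
    show "openin mtopology {\<omega> \<in> topspace mtopology. h \<omega> \<in> V}"
      unfolding openin_mtopology
    proof (intro conjI allI impI)
      fix \<omega> assume "\<omega> \<in> {\<omega> \<in> topspace mtopology. h \<omega> \<in> V}"
      then have \<omega>: "\<omega> \<in> trajectories" "h \<omega> \<in> V" by auto
      obtain e where e: "0 < e" "\<And>y. dist y (h \<omega>) < e \<Longrightarrow> y \<in> V"
        using V \<omega>(2) unfolding open_dist by blast
      obtain d where "0 < d" "\<forall>\<omega>'\<in>trajectories. uniform_metric \<Delta> \<omega> \<omega>' < d \<longrightarrow> dist (h \<omega>') (h \<omega>) < e"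
        using assms[OF \<omega>(1) e(1)] by blast
      then show "\<exists>r>0. mball \<omega> r \<subseteq> {\<omega> \<in> topspace mtopology. h \<omega> \<in> V}"
        using e(2) by (intro exI[of _ d]) auto
    qed auto
  qed auto
qed

lemma path_integral_continuous:
  fixes h :: "(real \<Rightarrow> 'e) \<Rightarrow> real"
  assumes "h \<in> borel_measurable trajectory_space" "\<And>\<omega>. \<omega> \<in> trajectories \<Longrightarrow> 0 \<le> h \<omega> \<and> h \<omega> \<le> 1"
    and "\<And>\<omega> e. \<omega> \<in> trajectories \<Longrightarrow> 0 < e \<Longrightarrow>
      \<exists>d>0. \<forall>\<omega>'\<in>trajectories. uniform_metric \<Delta> \<omega> \<omega>' < d \<longrightarrow> dist (h \<omega>') (h \<omega>) < e"
  shows "continuous_on UNIV (\<lambda>x. \<integral>\<omega>. h \<omega> \<partial>\<P> x)"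
proof (rule path_weakly_continuous[OF assms(1) _ continuous_map_trajectoriesI[OF assms(3)]])
  show "bounded (h ` trajectories)"
    using assms(2) by (intro boundedI[where B=1]) auto
qed

lemma space_path [simp]: "space (\<P> x) = trajectories"
  using sets_eq_imp_space_eq[OF path_sets] by simp

lemma path_measurable: "f \<in> trajectory_space \<rightarrow>\<^sub>M N \<Longrightarrow> f \<in> \<P> x \<rightarrow>\<^sub>M N"
  using measurable_cong_sets[OF path_sets refl] by blast

lemma sets_kernel: "0 \<le> t \<Longrightarrow> sets (P t x) = sets borel"
  using measurable_space[OF kernel, of t x] by (simp add: space_prob_algebra)

lemma prob_space_kernel: "0 \<le> t \<Longrightarrow> prob_space (P t x)"
  using measurable_space[OF kernel, of t x] by (simp add: space_prob_algebra)

lemma initial_law: "distr (\<P> x) borel (\<lambda>\<omega>. \<omega> 0) = return borel x"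
proof (rule measure_eqI)
  fix A :: "'e set" assume "A \<in> sets (distr (\<P> x) borel (\<lambda>\<omega>. \<omega> 0))"
  then have A: "A \<in> sets borel" by simp
  have "emeasure (distr (\<P> x) borel (\<lambda>\<omega>. \<omega> 0)) A = emeasure (\<P> x) {\<omega> \<in> trajectories. \<omega> 0 \<in> A}"
    using A by (subst emeasure_distr) (auto intro!: path_measurable measurable_evaluation arg_cong[where f="emeasure _"])
  also have "\<dots> = indicator A x" using path_fdd[OF A, of "[]"] A by (simp add: nn_integral_return)
  finally show "emeasure (distr (\<P> x) borel (\<lambda>\<omega>. \<omega> 0)) A = emeasure (return borel x) A" using A by simp
qed simp

text \<open>Local compactness enters here: the tent of radius \<open>min r s\<close> around
  \<open>x\<close> vanishes outside a neighbourhood contained in a compact set, hence vanishes at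
  infinity.\<close>

lemma C0_bump:
  assumes "0 < r"
  obtains f :: "'e \<Rightarrow> real" where "f \<in> C0" "f x = 1" "\<And>y. 0 \<le> f y \<and> f y \<le> 1" "\<And>y. r \<le> \<Delta> x y \<Longrightarrow> f y = 0"
proof -
  have "\<forall>x::'e. \<exists>U. open U \<and> (\<exists>K. compact K \<and> x \<in> U \<and> U \<subseteq> K)"
    using locally_compact by (simp add: locally_compact_space_def)
  then obtain V K where VK: "open V" "compact K" "x \<in> V" "V \<subseteq> K" by blast
  obtain s where s: "0 < s" "\<And>y. \<Delta> x y < s \<Longrightarrow> y \<in> V"
    using VK(1,3) unfolding open_iff_Delta by blast
  define n where "n = 1 / min r s"
  have n: "0 < n" using assms s by (simp add: n_def)
  define f where "f y = max 0 (1 - n * \<Delta> x y)" for y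
  have zero: "f y = 0" if "min r s \<le> \<Delta> x y" for y
  proof -
    have "1 \<le> n * \<Delta> x y" using that assms s(1) by (simp add: n_def)
    then show ?thesis by (simp add: f_def)
  qed
  have "isCont (\<Delta> x) z" for z
  proof -
    have "(\<Delta> x \<longlongrightarrow> \<Delta> x z) (nhds z)"
    proof (rule tendstoI)
      fix e :: real assume "0 < e"
      moreover have "dist (\<Delta> x y) (\<Delta> x z) \<le> \<Delta> z y" for y
        using Delta_metric(4)[of x y z] Delta_metric(4)[of x z y] Delta_metric(3)[of y z]
        by (simp add: dist_real_def)
      ultimately show "\<forall>\<^sub>F y in nhds z. dist (\<Delta> x y) (\<Delta> x z) < e"
        unfolding eventually_nhds_Delta by (meson le_less_trans)
    qed
    then show ?thesis by (simp add: isCont_def tendsto_at_iff_tendsto_nhds)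
  qed
  then have "continuous_on UNIV f"
    unfolding f_def by (intro continuous_intros) (simp add: continuous_at_imp_continuous_on)
  moreover have "y \<notin> K \<Longrightarrow> f y = 0" for y using VK(4) s(2)[of y] by (intro zero) force
  ultimately have "f \<in> C0" unfolding C0_def using VK(2) by auto
  moreover have "f x = 1" using Delta_metric(2)[of x x] by (simp add: f_def)
  ultimately show thesis
    using zero n Delta_metric(1)[of x] by (intro that[of f]) (auto simp: f_def)
qed

text \<open>The semigroup is the identity at time 0 on \<open>C0\<close> only. Applied to bumps
  equal to 1 at \<open>x\<close>, this forces \<open>P 0 x\<close> to give full mass to every ball
  around \<open>x\<close>, and hence to \<open>x\<close> itself.\<close>

lemma kernel_zero: "P 0 x = return borel x"
proof -
  interpret prob_space "P 0 x" by (rule prob_space_kernel) simp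
  have sets: "sets (P 0 x) = sets borel" by (rule sets_kernel) simp
  then have sp: "space (P 0 x) = UNIV" using sets_eq_imp_space_eq by fastforce
  have "AE y in P 0 x. \<Delta> x y < 1 / real (Suc n)" for n
  proof -
    have pos: "0 < 1 / real (Suc n)" by simp
    obtain f :: "'e \<Rightarrow> real" where f: "f \<in> C0" "f x = 1" "\<And>y. 0 \<le> f y \<and> f y \<le> 1"
        "\<And>y. 1 / real (Suc n) \<le> \<Delta> x y \<Longrightarrow> f y = 0"
      using C0_bump[OF pos] by blast
    have "f \<in> borel_measurable borel" using f(1) by (intro borel_measurable_continuous_onI) (simp add: C0_def)
    then have fm: "f \<in> borel_measurable (P 0 x)" by (simp add: measurable_cong_sets[OF sets refl])
    have i: "integrable (P 0 x) f" using fm f(3) by (intro integrable_unit_interval prob_space_axioms) auto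
    have "(\<integral>y. 1 - f y \<partial>P 0 x) = 0"
      using kernel_represents[of 0 f x] semigroup_zero[OF f(1)] f(1,2) i by (simp add: prob_space)
    then have "AE y in P 0 x. 1 - f y = 0"
      using f(3) i by (subst (asm) integral_nonneg_eq_0_iff_AE) (auto simp: less_eq_real_def)
    then show ?thesis
    proof eventually_elim
      case (elim y)
      then show ?case using f(4)[of y] by force
    qed
  qed
  then have "AE y in P 0 x. \<forall>n. \<Delta> x y < 1 / real (Suc n)" by (simp add: AE_all_countable)
  then have ae: "AE y in P 0 x. y = x"
  proof eventually_elim
    case (elim y)
    have "\<not> 0 < \<Delta> x y"
    proof
      assume "0 < \<Delta> x y"
      then obtain n where "1 / real (Suc n) < \<Delta> x y" by (rule nat_approx_posE)
      then show False using elim by (meson less_asym)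
    qed
    then show ?case using Delta_metric(1,2)[of x y] by auto
  qed
  show ?thesis
  proof (rule measure_eqI)
    fix A assume "A \<in> sets (P 0 x)"
    then have A: "A \<in> sets borel" by (simp add: sets)
    have "emeasure (P 0 x) A = (\<integral>\<^sup>+y. indicator A y \<partial>P 0 x)" using A by (simp add: sets)
    also have "\<dots> = (\<integral>\<^sup>+y. indicator A x \<partial>P 0 x)" using ae by (intro nn_integral_cong_AE) auto
    finally show "emeasure (P 0 x) A = emeasure (return borel x) A" using A by (simp add: emeasure_space_1)
  qed (simp add: sets)
qed

text \<open>Turns kernel integrals into path integrals, from which measurability in
  \<open>x\<close>, continuity in \<open>t\<close> and the comparison of the functionals are
  obtained. Time 0 is separate, as the listed times of the finite-dimensional distributions are
  positive.\<close>

lemma kernel_eq_distr: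
  assumes "0 \<le> t"
  shows "P t x = distr (\<P> x) borel (\<lambda>\<omega>. \<omega> t)"
proof (cases "t = 0")
  case True
  then show ?thesis by (simp add: kernel_zero initial_law)
next
  case False
  then have t: "0 < t" using assms by simp
  show ?thesis
  proof (rule measure_eqI)
    fix A assume "A \<in> sets (P t x)"
    then have A: "A \<in> sets borel" by (simp add: sets_kernel[OF assms])
    have "(\<lambda>y. emeasure (P t y) A) \<in> borel_measurable borel"
      by (rule measurable_compose[OF measurable_prob_algebraD[OF kernel[OF assms]]
            measurable_emeasure_subprob_algebra[OF A]])
    moreover have "(\<integral>\<^sup>+z. indicator A z \<partial>P t y) = emeasure (P t y) A" for y
      using A assms by (simp add: sets_kernel)
    ultimately have "emeasure (\<P> x) {\<omega> \<in> trajectories. \<omega> t \<in> A} = emeasure (P t x) A"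
      using path_fdd[of UNIV "[(t, A)]" x] A t by (simp add: nn_integral_return)
    then show "emeasure (P t x) A = emeasure (distr (\<P> x) borel (\<lambda>\<omega>. \<omega> t)) A"
      using A assms by (subst emeasure_distr)
        (auto intro!: path_measurable measurable_evaluation simp: sets_kernel vimage_def Int_def conj_commute)
  qed (simp add: sets_kernel assms)
qed

end

section \<open>Pseudometrics attained by families of functions\<close>

lemma transport_weak_duality_nonexpansive:
  assumes "prob_space \<mu>" "prob_space \<nu>" "sets \<mu> = sets M" "sets \<nu> = sets M"
    and "separable_cost M U" "nonexpansive M U h"
  shows "\<bar>(\<integral>x. h x \<partial>\<mu>) - (\<integral>x. h x \<partial>\<nu>)\<bar> \<le> transport_cost U \<mu> \<nu>"
proof -
  interpret separable_cost M U by fact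
  have sp: "space \<mu> = space M" using assms(3) by (rule sets_eq_imp_space_eq)
  show ?thesis
  proof (rule transport_weak_duality)
    show "(\<lambda>p. U (fst p) (snd p)) \<in> borel_measurable (\<mu> \<Otimes>\<^sub>M \<nu>)"
      using U_measurable measurable_cong_sets[OF sets_pair_measure_cong[OF assms(3,4)] refl] by blast
    show "h \<in> borel_measurable \<mu>"
      using assms(6) measurable_cong_sets[OF assms(3) refl] unfolding nonexpansive_def by blast
  qed (use assms U_ge_0 U_le_1 in \<open>auto simp: nonexpansive_def sp\<close>)
qed

lemma (in separable_cost) transport_cost_bounds:
  assumes "prob_space \<mu>" "prob_space \<nu>" "sets \<mu> = sets M" "sets \<nu> = sets M"
  shows "0 \<le> transport_cost U \<mu> \<nu>" "transport_cost U \<mu> \<nu> \<le> 1"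
proof -
  show "0 \<le> transport_cost U \<mu> \<nu>" using assms U_ge_0 by (intro transport_cost_nonneg) auto
  have "(\<lambda>p. U (fst p) (snd p)) \<in> borel_measurable (\<mu> \<Otimes>\<^sub>M \<nu>)"
    using U_measurable measurable_cong_sets[OF sets_pair_measure_cong[OF assms(3,4)] refl] by blast
  then show "transport_cost U \<mu> \<nu> \<le> 1" using assms U_ge_0 U_le_1 by (intro transport_cost_le_1) auto
qed

lemma nonexpansive_integral:
  assumes "nonexpansive M U h" "prob_space \<mu>" "sets \<mu> = sets M"
  shows "0 \<le> (\<integral>x. h x \<partial>\<mu>) \<and> (\<integral>x. h x \<partial>\<mu>) \<le> 1" "integrable \<mu> h"
proof -
  have m: "h \<in> borel_measurable \<mu>"
    using assms(1) measurable_cong_sets[OF assms(3) refl] unfolding nonexpansive_def by blast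
  have r: "0 \<le> h x \<and> h x \<le> 1" if "x \<in> space \<mu>" for x
    using assms(1) sets_eq_imp_space_eq[OF assms(3)] that unfolding nonexpansive_def by blast
  show "0 \<le> (\<integral>x. h x \<partial>\<mu>) \<and> (\<integral>x. h x \<partial>\<mu>) \<le> 1"
    by (rule integral_unit_interval[OF assms(2) m r])
  show "integrable \<mu> h" by (rule integrable_unit_interval[OF assms(2) m r])
qed

text \<open>Rounding is upward but not strict, so that \<open>a = 1\<close> is met by
  \<open>q = 1\<close>.\<close>

lemma unit_rational_approximation:
  fixes a d :: real
  assumes "0 \<le> a" "a \<le> 1" "0 < d"
  obtains q where "q \<in> \<rat>" "0 \<le> q" "q \<le> 1" "a \<le> q" "q < a + d"
proof (cases "a = 1")
  case True
  then show thesis using assms by (intro that[of 1]) auto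
next
  case False
  then obtain q where "q \<in> \<rat>" "a < q" "q < min 1 (a + d)"
    using Rats_dense_in_real[of a "min 1 (a + d)"] assms by auto
  then show thesis using assms by (intro that[of q]) auto
qed

text \<open>Truncated subtraction brings the value at \<open>y\<close> down to about \<open>0\<close> and that at \<open>x\<close> to about
  \<open>\<alpha> - \<beta>\<close>, truncated addition then shifts both by \<open>\<beta>\<close>.\<close>

lemma two_point_approximation:
  fixes H :: "('a \<Rightarrow> real) set"
  assumes minus: "\<And>h q. h \<in> H \<Longrightarrow> q \<in> \<rat> \<Longrightarrow> 0 \<le> q \<Longrightarrow> q \<le> 1 \<Longrightarrow> (\<lambda>x. max 0 (h x - q)) \<in> H"
    and plus: "\<And>h q. h \<in> H \<Longrightarrow> q \<in> \<rat> \<Longrightarrow> 0 \<le> q \<Longrightarrow> q \<le> 1 \<Longrightarrow> (\<lambda>x. min 1 (h x + q)) \<in> H"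
    and range: "\<And>h. h \<in> H \<Longrightarrow> 0 \<le> h x \<and> h x \<le> 1 \<and> 0 \<le> h y \<and> h y \<le> 1"
    and sep: "\<And>e. 0 < e \<Longrightarrow> \<exists>h\<in>H. r - e < h x - h y" "\<And>e. 0 < e \<Longrightarrow> \<exists>h\<in>H. r - e < h y - h x"
    and ab: "0 \<le> \<alpha>" "\<alpha> \<le> 1" "0 \<le> \<beta>" "\<beta> \<le> 1" "\<bar>\<alpha> - \<beta>\<bar> \<le> r" and \<epsilon>: "0 < \<epsilon>"
  shows "\<exists>h\<in>H. \<bar>h x - \<alpha>\<bar> < \<epsilon> \<and> \<bar>h y - \<beta>\<bar> < \<epsilon>"
proof -
  have *: "\<exists>h\<in>H. \<bar>h x - \<alpha>\<bar> < \<epsilon> \<and> \<bar>h y - \<beta>\<bar> < \<epsilon>"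
    if range: "\<And>h. h \<in> H \<Longrightarrow> 0 \<le> h x \<and> h x \<le> 1 \<and> 0 \<le> h y \<and> h y \<le> 1"
      and sep: "\<And>e. 0 < e \<Longrightarrow> \<exists>h\<in>H. r - e < h x - h y"
      and ab: "0 \<le> \<beta>" "\<beta> \<le> \<alpha>" "\<alpha> \<le> 1" "\<alpha> - \<beta> \<le> r" for x y \<alpha> \<beta>
  proof -
    have \<epsilon>4: "0 < \<epsilon> / 4" using \<epsilon> by simp
    obtain h where h: "h \<in> H" "r - \<epsilon> / 4 < h x - h y" using sep[OF \<epsilon>4] by blast
    \<comment> \<open>Subtracting \<open>a\<close> leaves \<open>\<alpha> - \<beta>\<close> at
      \<open>x\<close>, unless \<open>h x\<close> is already below that value; then nothing is
      subtracted and \<open>h x\<close> falls short by less than \<open>\<epsilon> / 4\<close>,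
      since \<open>h y\<close> is nonnegative.\<close>
    define a where "a = max 0 (h x - (\<alpha> - \<beta>))"
    have "0 \<le> a" "a \<le> 1" using range[OF h(1)] ab by (auto simp: a_def)
    then obtain q where q: "q \<in> \<rat>" "0 \<le> q" "q \<le> 1" "a \<le> q" "q < a + \<epsilon> / 4"
      using unit_rational_approximation[OF _ _ \<epsilon>4] by blast
    have "\<beta> \<le> 1" using ab by simp
    then obtain q' where q': "q' \<in> \<rat>" "0 \<le> q'" "q' \<le> 1" "\<beta> \<le> q'" "q' < \<beta> + \<epsilon> / 4"
      using unit_rational_approximation[OF ab(1) _ \<epsilon>4] by blast
    have "h x - (\<alpha> - \<beta>) \<le> a" "\<alpha> - \<beta> - \<epsilon> / 4 < h x - a"
      using h(2) range[OF h(1)] ab \<epsilon> by (auto simp: a_def max_def)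
    then have X: "h x - q \<le> \<alpha> - \<beta>" "\<alpha> - \<beta> - \<epsilon> / 2 < h x - q" "h y - q < \<epsilon> / 4"
      using h(2) q(4,5) ab by linarith+
    show ?thesis
    proof (intro bexI conjI)
      show "(\<lambda>x. min 1 (max 0 (h x - q) + q')) \<in> H" by (intro minus plus h q q')
      show "\<bar>min 1 (max 0 (h x - q) + q') - \<alpha>\<bar> < \<epsilon>" "\<bar>min 1 (max 0 (h y - q) + q') - \<beta>\<bar> < \<epsilon>"
        using X q'(4,5) ab \<epsilon> by (auto simp: abs_if min_def max_def)
    qed
  qed
  show ?thesis
  proof (cases "\<beta> \<le> \<alpha>")
    case True
    then show ?thesis using *[OF range sep(1)] ab by auto
  next
    case False
    then have "\<exists>h\<in>H. \<bar>h y - \<beta>\<bar> < \<epsilon> \<and> \<bar>h x - \<alpha>\<bar> < \<epsilon>"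
      using *[of y x \<alpha> \<beta>] range sep(2) ab by auto
    then show ?thesis by blast
  qed
qed

text \<open>The invariant carried through both iterations. The functions are nonexpansive for
  \<open>m\<close> itself, which supplies the reverse inequality, and the difference is oriented, as
  interpolation at two points requires.\<close>

definition attained_by :: "('e::topological_space \<Rightarrow> 'e \<Rightarrow> real) \<Rightarrow> ('e \<Rightarrow> real) set \<Rightarrow> bool" where
  "attained_by m S \<longleftrightarrow> (\<forall>x y e. 0 < e \<longrightarrow> (\<exists>f\<in>S. nonexpansive borel m f \<and> m x y - e < f x - f y))"

lemma attained_byD:
  assumes "attained_by m S" "0 < e"
  obtains f where "f \<in> S" "nonexpansive borel m f" "m x y - e < f x - f y"
  using assms unfolding attained_by_def by blast

text \<open>Complementing a function reverses the sign of its differences, so closure under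
  complement removes the absolute value that duality produces.\<close>

lemma attained_byI:
  assumes "\<And>x y e. 0 < e \<Longrightarrow> \<exists>f\<in>S. nonexpansive borel m f \<and> m x y - e < \<bar>f x - f y\<bar>"
    and compl: "\<And>f. f \<in> S \<Longrightarrow> (\<lambda>x. 1 - f x) \<in> S"
  shows "attained_by m S"
  unfolding attained_by_def
proof (intro allI impI)
  fix x y :: 'a and e :: real assume "0 < e"
  then obtain f where f: "f \<in> S" "nonexpansive borel m f" "m x y - e < \<bar>f x - f y\<bar>"
    using assms(1) by blast
  show "\<exists>f\<in>S. nonexpansive borel m f \<and> m x y - e < f x - f y"
  proof (cases "0 \<le> f x - f y")
    case True
    then show ?thesis using f by auto
  next
    case False
    then show ?thesis using f
      by (intro bexI[of _ "\<lambda>x. 1 - f x"] conjI nonexpansive_compl compl) auto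
  qed
qed

text \<open>A supremum of pseudometrics \<open>\<bar>f x - f y\<bar>\<close> is a pseudometric. This
  gives symmetry and the triangle inequality of transport distances without reversing or gluing
  couplings.\<close>

lemma continuous_pseudometric_if_attained:
  fixes m :: "'e::{second_countable_topology, t2_space} \<Rightarrow> 'e \<Rightarrow> real"
  assumes att: "attained_by m S" and small: "\<And>x e. 0 < e \<Longrightarrow> \<forall>\<^sub>F y in nhds x. m x y < e"
  shows "continuous_pseudometric m"
proof
  have ne: "\<bar>f x - f y\<bar> \<le> m x y" "0 \<le> f x" "f x \<le> 1" if "nonexpansive borel m f" for f x y
    using that by (auto simp: nonexpansive_def)
  show "0 \<le> m x y" for x y
    by (rule attained_byD[OF att zero_less_one, of x y]) (use ne(1)[of _ x y] in fastforce)
  show "m x y \<le> 1" for x y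
  proof (rule field_le_epsilon)
    fix e :: real assume e: "0 < e"
    obtain f where "nonexpansive borel m f" "m x y - e < f x - f y" using attained_byD[OF att e] by blast
    then show "m x y \<le> 1 + e" using ne(3)[of f x] ne(2)[of f y] by linarith
  qed
  have "m x y \<le> m y x" for x y
  proof (rule field_le_epsilon)
    fix e :: real assume e: "0 < e"
    obtain f where "nonexpansive borel m f" "m x y - e < f x - f y" using attained_byD[OF att e] by blast
    then show "m x y \<le> m y x + e" using ne(1)[of f y x] by linarith
  qed
  then show "m x y = m y x" for x y by (simp add: antisym)
  show "m x z \<le> m x y + m y z" for x y z
  proof (rule field_le_epsilon)
    fix e :: real assume e: "0 < e"
    obtain f where "nonexpansive borel m f" "m x z - e < f x - f z" using attained_byD[OF att e] by blast
    then show "m x z \<le> m x y + m y z + e" using ne(1)[of f x y] ne(1)[of f y z] by linarith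
  qed
  show "m x x = 0" for x
  proof (rule antisym)
    show "m x x \<le> 0"
    proof (rule field_le_epsilon)
      fix e :: real assume e: "0 < e"
      obtain f where "m x x - e < f x - f x" using attained_byD[OF att e] by blast
      then show "m x x \<le> 0 + e" by simp
    qed
  qed fact
qed (rule small)

section \<open>The two functionals and their logics\<close>

locale diffusion_observable = diffusion T P \<Delta> \<P>
  for T :: "real \<Rightarrow> ('e::{second_countable_topology, t2_space} \<Rightarrow> real) \<Rightarrow> 'e \<Rightarrow> real"
    and P :: "real \<Rightarrow> 'e \<Rightarrow> 'e measure"
    and \<Delta> :: "'e \<Rightarrow> 'e \<Rightarrow> real"
    and \<P> :: "'e \<Rightarrow> (real \<Rightarrow> 'e) measure" +
  fixes obs :: "'e \<Rightarrow> real" and c :: real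
  assumes obs_continuous: "continuous_on UNIV obs"
    and obs_range: "\<And>x. 0 \<le> obs x \<and> obs x \<le> 1"
    and c: "0 < c" "c < 1"
begin

lemma discountedI: "continuous_pseudometric m \<Longrightarrow> discounted m c"
  using c by (intro discounted.intro discounted_axioms.intro)

text \<open>Continuity of \<open>m\<close> need not be uniform with respect to
  \<open>\<Delta>\<close>. On the compact image of a finite time interval a Lebesgue number restores
  uniformity, and the discount takes care of later times.\<close>

lemma U_op_small:
  assumes "discounted m c" and \<omega>: "\<omega> \<in> trajectories" and "0 < e"
  shows "\<exists>d>0. \<forall>\<omega>'. uniform_metric \<Delta> \<omega> \<omega>' < d \<longrightarrow> U_op c m \<omega> \<omega>' \<le> e"
proof -
  interpret discounted m c by fact
  obtain N where N: "\<And>t. real N \<le> t \<Longrightarrow> c powr t \<le> e" using discount_small[OF c \<open>0 < e\<close>] by blast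
  have "\<exists>r>0. \<forall>y. \<Delta> x y < 2 * r \<longrightarrow> m x y < e / 2" for x
  proof -
    have "\<forall>\<^sub>F y in nhds x. m x y < e / 2" using \<open>0 < e\<close> by (intro small) simp
    then obtain r where "0 < r" "\<forall>y. \<Delta> x y < r \<longrightarrow> m x y < e / 2"
      unfolding eventually_nhds_Delta by blast
    then show ?thesis by (intro exI[of _ "r / 2"]) auto
  qed
  \<comment> \<open>Balls of radius \<open>r x\<close> will cover the image of \<omega>; the margin
    up to \<open>2 * r x\<close> keeps the perturbed trajectory near the same centre.\<close>
  then obtain r where r: "\<And>x. 0 < r x" "\<And>x y. \<Delta> x y < 2 * r x \<Longrightarrow> m x y < e / 2" by metis
  have "continuous_on {0..real N} \<omega>"
    using \<omega> by (auto simp: trajectories_def intro: continuous_on_subset)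
  then have "compact (\<omega> ` {0..real N})" by (rule compact_continuous_image) simp
  moreover have "\<omega> ` {0..real N} \<subseteq> (\<Union>x\<in>\<omega> ` {0..real N}. {y. \<Delta> x y < r x})"
  proof
    fix x assume x: "x \<in> \<omega> ` {0..real N}"
    have "\<Delta> x x < r x" using r(1)[of x] Delta_metric(2)[of x x] by simp
    with x show "x \<in> (\<Union>x\<in>\<omega> ` {0..real N}. {y. \<Delta> x y < r x})" by blast
  qed
  ultimately obtain C where C: "C \<subseteq> \<omega> ` {0..real N}" "finite C"
      "\<omega> ` {0..real N} \<subseteq> (\<Union>x\<in>C. {y. \<Delta> x y < r x})"
    using compactE_image[of "\<omega> ` {0..real N}" "\<omega> ` {0..real N}" "\<lambda>x. {y. \<Delta> x y < r x}"] open_Delta_ball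
    by blast
  have "\<omega> 0 \<in> \<omega> ` {0..real N}" by simp
  then have "C \<noteq> {}" using C(3) by blast
  define d where "d = Min (r ` C)"
  have "0 < d" unfolding d_def using C(2) \<open>C \<noteq> {}\<close> r(1) by simp
  moreover have "U_op c m \<omega> \<omega>' \<le> e" if \<omega>': "uniform_metric \<Delta> \<omega> \<omega>' < d" for \<omega>'
  proof (rule U_le_if_close[OF _ N])
    fix t :: real assume t: "0 \<le> t" "t \<le> real N"
    then obtain x where x: "x \<in> C" "\<Delta> x (\<omega> t) < r x" using C(3) by fastforce
    have "\<Delta> (\<omega> t) (\<omega>' t) < d" using uniform_metric_ge[OF t(1), of \<omega> \<omega>'] \<omega>' by simp
    also have "d \<le> r x" unfolding d_def using C(2) x(1) by (intro Min_le) auto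
    finally have "\<Delta> x (\<omega>' t) < 2 * r x" "\<Delta> x (\<omega> t) < 2 * r x"
      using x(2) r(1)[of x] Delta_metric(4)[of x "\<omega>' t" "\<omega> t"] by auto
    then show "m (\<omega> t) (\<omega>' t) \<le> e"
      using r(2)[of x "\<omega> t"] r(2)[of x "\<omega>' t"] triangle[of "\<omega> t" "\<omega>' t" x] sym[of x "\<omega> t"] by linarith
  qed
  ultimately show ?thesis by blast
qed

text \<open>Smallness of \<open>U_op c m\<close> along the uniform metric makes \<open>h\<close>
  continuous for that metric, hence admissible in the weak continuity of
  \<open>\<P>\<close>.\<close>

lemma nonexpansive_path_integral_continuous:
  assumes m: "discounted m c" and h: "nonexpansive trajectory_space (U_op c m) h"
  shows "continuous_on UNIV (\<lambda>x. \<integral>\<omega>. h \<omega> \<partial>\<P> x)"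
proof (rule path_integral_continuous)
  interpret S: separable_cost trajectory_space "U_op c m"
    using m by (rule discounted.separable_cost_trajectories)
  show "h \<in> borel_measurable trajectory_space" "\<And>\<omega>. \<omega> \<in> trajectories \<Longrightarrow> 0 \<le> h \<omega> \<and> h \<omega> \<le> 1"
    using h by (auto simp: nonexpansive_def)
  fix \<omega> :: "real \<Rightarrow> 'e" and e :: real assume \<omega>: "\<omega> \<in> trajectories" "0 < e"
  then obtain d where d: "0 < d" "\<And>\<omega>'. uniform_metric \<Delta> \<omega> \<omega>' < d \<Longrightarrow> U_op c m \<omega> \<omega>' \<le> e / 2"
    using U_op_small[OF m \<omega>(1), of "e / 2"] by auto
  show "\<exists>d>0. \<forall>\<omega>'\<in>trajectories. uniform_metric \<Delta> \<omega> \<omega>' < d \<longrightarrow> dist (h \<omega>') (h \<omega>) < e"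
  proof (intro exI[of _ d] conjI ballI impI d(1))
    fix \<omega>' :: "real \<Rightarrow> 'e" assume \<omega>': "\<omega>' \<in> trajectories" "uniform_metric \<Delta> \<omega> \<omega>' < d"
    have "\<bar>h \<omega> - h \<omega>'\<bar> \<le> U_op c m \<omega> \<omega>'" using h \<omega>(1) \<omega>'(1) by (simp add: nonexpansive_def)
    then show "dist (h \<omega>') (h \<omega>) < e" using d(2)[OF \<omega>'(2)] \<omega>(2) by (simp add: dist_real_def)
  qed
qed

lemma nonexpansive_evaluation:
  fixes m :: "'e \<Rightarrow> 'e \<Rightarrow> real"
  assumes "discounted m c" "nonexpansive borel m f" "0 \<le> t"
  shows "nonexpansive trajectory_space (U_op c m) (\<lambda>\<omega>. c powr t * f (\<omega> t))"
proof -
  interpret discounted m c by fact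
  have f: "f \<in> borel_measurable borel" "0 \<le> f x" "f x \<le> 1" "\<bar>f x - f y\<bar> \<le> m x y" for x y
    using assms(2) by (auto simp: nonexpansive_def)
  show ?thesis
    unfolding nonexpansive_def
  proof (intro conjI ballI)
    show "(\<lambda>\<omega>. c powr t * f (\<omega> t)) \<in> borel_measurable trajectory_space"
      using measurable_compose[OF measurable_evaluation[OF assms(3)] f(1)] by simp
    fix \<omega> \<omega>' :: "real \<Rightarrow> 'e"
    show "0 \<le> c powr t * f (\<omega> t)" using f(2) by simp
    show "c powr t * f (\<omega> t) \<le> 1" using f(2,3) powr_le_1[OF assms(3)] by (intro mult_le_one) auto
    have "\<bar>c powr t * f (\<omega> t) - c powr t * f (\<omega>' t)\<bar> = c powr t * \<bar>f (\<omega> t) - f (\<omega>' t)\<bar>"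
      by (simp add: abs_mult right_diff_distrib[symmetric])
    also have "\<dots> \<le> c powr t * m (\<omega> t) (\<omega>' t)" by (intro mult_left_mono f(4)) simp
    also have "\<dots> \<le> U_op c m \<omega> \<omega>'" by (rule U_upper) fact
    finally show "\<bar>c powr t * f (\<omega> t) - c powr t * f (\<omega>' t)\<bar> \<le> U_op c m \<omega> \<omega>'" .
  qed
qed

lemma integral_evaluation:
  fixes f :: "'e \<Rightarrow> real"
  assumes "f \<in> borel_measurable borel" "0 \<le> t"
  shows "(\<integral>\<omega>. c powr t * f (\<omega> t) \<partial>\<P> x) = c powr t * (\<integral>y. f y \<partial>P t x)"
  using integral_distr[OF path_measurable[OF measurable_evaluation[OF assms(2)]] assms(1), of x]
  by (simp add: kernel_eq_distr[OF assms(2)])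

lemma integral_kernel_zero:
  fixes f :: "'e \<Rightarrow> real"
  shows "f \<in> borel_measurable borel \<Longrightarrow> (\<integral>y. f y \<partial>P 0 x) = f x"
  by (simp add: kernel_zero integral_return)

text \<open>Dominated convergence along the paths. Strong continuity of the semigroup would speak
  about \<open>C0\<close> only, to which the formulas need not belong.\<close>

lemma kernel_integral_continuous_time:
  fixes f :: "'e \<Rightarrow> real"
  assumes f: "continuous_on UNIV f" "\<And>x. 0 \<le> f x \<and> f x \<le> 1"
  shows "continuous_on {0..} (\<lambda>t. \<integral>y. f y \<partial>P t x)"
proof -
  interpret prob_space "\<P> x" by (rule path_prob_space)
  have fm: "f \<in> borel_measurable borel" by (rule borel_measurable_continuous_onI) fact
  have "continuous_on {0..} (\<lambda>t. \<integral>\<omega>. f (\<omega> t) \<partial>\<P> x)"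
    unfolding continuous_on_sequentially comp_def
  proof (intro allI ballI impI)
    fix s :: "nat \<Rightarrow> real" and t assume t: "t \<in> {0..}" and s: "(\<forall>n. s n \<in> {0..}) \<and> s \<longlonglongrightarrow> t"
    show "(\<lambda>n. \<integral>\<omega>. f (\<omega> (s n)) \<partial>\<P> x) \<longlonglongrightarrow> (\<integral>\<omega>. f (\<omega> t) \<partial>\<P> x)"
    proof (rule integral_dominated_convergence[where s="\<lambda>n \<omega>. f (\<omega> (s n))" and w="\<lambda>_. 1"])
      show "(\<lambda>\<omega>. f (\<omega> t)) \<in> borel_measurable (\<P> x)" "(\<lambda>\<omega>. f (\<omega> (s n))) \<in> borel_measurable (\<P> x)" for n
        using t s by (auto intro!: path_measurable measurable_compose[OF measurable_evaluation fm])
      show "AE \<omega> in \<P> x. (\<lambda>n. f (\<omega> (s n))) \<longlonglongrightarrow> f (\<omega> t)"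
      proof (rule AE_I2)
        fix \<omega> assume "\<omega> \<in> space (\<P> x)"
        then have "continuous_on {0..} \<omega>" by (simp add: trajectories_def)
        then have "continuous_on {0..} (\<lambda>t. f (\<omega> t))" by (intro continuous_on_compose2[OF f(1)]) auto
        then show "(\<lambda>n. f (\<omega> (s n))) \<longlonglongrightarrow> f (\<omega> t)"
          using t s unfolding continuous_on_sequentially comp_def by blast
      qed
    qed (use f(2) in auto)
  qed
  moreover have "(\<integral>\<omega>. f (\<omega> t) \<partial>\<P> x) = (\<integral>y. f y \<partial>P t x)" if "0 \<le> t" for t
    using integral_distr[OF path_measurable[OF measurable_evaluation[OF that]] fm, of x]
    by (simp add: kernel_eq_distr[OF that])
  ultimately show ?thesis by (auto intro: continuous_on_eq)
qed

section \<open>Rational parameters of the formulas\<close>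

lemma time_val_exists:
  assumes "t \<in> \<rat>" "0 \<le> t"
  obtains s where "time_val s = t"
proof -
  obtain r where r: "t = of_rat r" using assms(1) by (rule Rats_cases)
  then have "0 \<le> r" using assms(2) by simp
  then show thesis using r by (intro that[of "Abs_nonneg_rat r"]) (simp add: Abs_nonneg_rat_inverse)
qed

lemma unit_val_exists:
  assumes "q \<in> \<rat>" "0 \<le> q" "q \<le> 1"
  obtains r where "unit_val r = q"
proof -
  obtain r where r: "q = of_rat r" using assms(1) by (rule Rats_cases)
  then have "0 \<le> r" "r \<le> 1" using assms(2,3) by simp_all
  then show thesis using r by (intro that[of "Abs_unit_rat r"]) (simp add: Abs_unit_rat_inverse)
qed

lemma Rep_nonneg_rat_ge_0 [simp]: "0 \<le> Rep_nonneg_rat t"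
  using Rep_nonneg_rat[of t] by simp

lemma Rep_unit_rat_bounds [simp]: "0 \<le> Rep_unit_rat q" "Rep_unit_rat q \<le> 1"
  using Rep_unit_rat[of q] by simp_all

lemma time_val_nonneg: "0 \<le> time_val t"
  by simp

lemma unit_val_nonneg: "0 \<le> unit_val q"
  by simp

section \<open>Formulas and iterates; duality for the path functional\<close>

abbreviation "sig \<equiv> sigma_sem \<P> obs c"
abbreviation "tau \<equiv> tau_sem \<P> obs c"
abbreviation "lam \<equiv> lam_sem P obs c"
abbreviation "d \<equiv> d_seq \<P> obs c"
abbreviation "\<delta> \<equiv> delta_seq P obs c"

text \<open>If every nonexpansive trajectory formula fell short by \<open>e\<close>, strong duality
  with bound \<open>G_op \<P> c m x y - e\<close> would put the transport cost below itself.\<close>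

lemma G_op_approximation:
  assumes m: "continuous_pseudometric m" and att: "attained_by m (range sig)" and "0 < e"
  shows "\<exists>g. nonexpansive trajectory_space (U_op c m) (tau g) \<and>
    G_op \<P> c m x y - e < \<bar>sig (SInt g) x - sig (SInt g) y\<bar>"
proof -
  interpret discounted m c using m by (rule discountedI)
  interpret S: separable_cost trajectory_space "U_op c m" by (rule separable_cost_trajectories)
  define H where "H = {h \<in> range tau. nonexpansive trajectory_space (U_op c m) h}"
  \<comment> \<open>One half of \<open>e\<close> goes into a rational time that nearly attains the
    supremum in \<open>U_op c m\<close>, the other into a formula that nearly attains
    \<open>m\<close> at that time; its evaluation separates the two trajectories.\<close>
  have sep: "\<exists>h\<in>H. U_op c m \<omega> \<omega>' - e < h \<omega> - h \<omega>'"
    if \<omega>: "\<omega> \<in> trajectories" "\<omega>' \<in> trajectories" and e: "0 < e" for \<omega> \<omega>' e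
  proof -
    have "U_op c m \<omega> \<omega>' - e / 2 < (SUP t\<in>{0..} \<inter> \<rat>. c powr t * m (\<omega> t) (\<omega>' t))"
      using e by (simp add: U_rational[OF \<omega>])
    moreover have "(0::real) \<in> {0..} \<inter> \<rat>" by simp
    then have "{0..} \<inter> (\<rat>::real set) \<noteq> {}" by blast
    moreover have "bdd_above ((\<lambda>t. c powr t * m (\<omega> t) (\<omega>' t)) ` ({0..} \<inter> \<rat>))"
      by (intro bdd_aboveI2[where M=1]) (auto intro: order_trans[OF discounted_le le_1])
    ultimately obtain t where t: "t \<in> \<rat>" "0 \<le> t" "U_op c m \<omega> \<omega>' - e / 2 < c powr t * m (\<omega> t) (\<omega>' t)"
      by (auto simp: less_cSUP_iff)
    obtain s where s: "time_val s = t" using time_val_exists[OF t(1,2)] .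
    have "0 < e / 2" using e by simp
    then obtain f where f: "nonexpansive borel m (sig f)" "m (\<omega> t) (\<omega>' t) - e / 2 < sig f (\<omega> t) - sig f (\<omega>' t)"
      using attained_byD[OF att] by (metis rangeE)
    have "c powr t * (m (\<omega> t) (\<omega>' t) - (sig f (\<omega> t) - sig f (\<omega>' t))) \<le> 1 * (e / 2)"
      using f(2) e powr_le_1[OF t(2)] nonexpansive_def[of borel m "sig f"] f(1)
      by (intro mult_mono) (auto simp: abs_le_iff)
    then have "c powr t * m (\<omega> t) (\<omega>' t) - e / 2 \<le> tau (TEv f s) \<omega> - tau (TEv f s) \<omega>'"
      by (simp add: s algebra_simps)
    moreover have "nonexpansive trajectory_space (U_op c m) (tau (TEv f s))"
      using nonexpansive_evaluation[OF discounted_axioms f(1) t(2)] by (simp add: s[symmetric])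
    then have "tau (TEv f s) \<in> H" unfolding H_def by blast
    ultimately show ?thesis using t(3) by (intro bexI[of _ "tau (TEv f s)"]) linarith+
  qed
  have H_nonexp: "nonexpansive trajectory_space (U_op c m) h" if "h \<in> H" for h
    using that by (simp add: H_def)
  have H_minus: "(\<lambda>\<omega>. max 0 (h \<omega> - q)) \<in> H" and H_plus: "(\<lambda>\<omega>. min 1 (h \<omega> + q)) \<in> H"
    if h: "h \<in> H" and q: "q \<in> \<rat>" "0 \<le> q" "q \<le> 1" for h q
  proof -
    obtain g where g: "h = tau g" "nonexpansive trajectory_space (U_op c m) h" using h by (auto simp: H_def)
    obtain r where r: "unit_val r = q" using unit_val_exists[OF q] .
    have "(\<lambda>\<omega>. max 0 (h \<omega> - q)) = tau (TMinus g r)" "(\<lambda>\<omega>. min 1 (h \<omega> + q)) = tau (TPlus g r)"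
      by (simp_all add: g(1) r)
    then show "(\<lambda>\<omega>. max 0 (h \<omega> - q)) \<in> H" "(\<lambda>\<omega>. min 1 (h \<omega> + q)) \<in> H"
      using nonexpansive_minus[OF g(2) q(2)] nonexpansive_plus[OF g(2) q(2)]
      unfolding H_def by (metis (mono_tags) mem_Collect_eq rangeI)+
  qed
  have H_lattice: "(\<lambda>\<omega>. min (g \<omega>) (h \<omega>)) \<in> H" "(\<lambda>\<omega>. max (g \<omega>) (h \<omega>)) \<in> H" if gh: "g \<in> H" "h \<in> H" for g h
  proof -
    obtain g' h' where e: "g = tau g'" "h = tau h'" using gh by (auto simp: H_def)
    have "(\<lambda>\<omega>. min (g \<omega>) (h \<omega>)) = tau (TMin g' h')" "(\<lambda>\<omega>. max (g \<omega>) (h \<omega>)) = tau (TMax g' h')"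
      by (simp_all add: e)
    then show "(\<lambda>\<omega>. min (g \<omega>) (h \<omega>)) \<in> H" "(\<lambda>\<omega>. max (g \<omega>) (h \<omega>)) \<in> H"
      using nonexpansive_min[of _ _ g h] nonexpansive_max[of _ _ g h] gh
      unfolding H_def by (metis (mono_tags, lifting) mem_Collect_eq rangeI)+
  qed
  have "\<exists>h\<in>H. G_op \<P> c m x y - e < \<bar>(\<integral>\<omega>. h \<omega> \<partial>\<P> x) - (\<integral>\<omega>. h \<omega> \<partial>\<P> y)\<bar>"
  proof (rule ccontr)
    assume no: "\<not> ?thesis"
    have "transport_cost (U_op c m) (\<P> x) (\<P> y) \<le> G_op \<P> c m x y - e"
    proof (rule S.transport_strong_duality[where H=H])
      show "\<exists>h\<in>H. \<bar>h \<omega> - \<alpha>\<bar> < \<epsilon> \<and> \<bar>h \<omega>' - \<beta>\<bar> < \<epsilon>"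
        if *: "\<omega> \<in> space trajectory_space" "\<omega>' \<in> space trajectory_space" "0 \<le> \<alpha>" "\<alpha> \<le> 1" "0 \<le> \<beta>" "\<beta> \<le> 1"
          "\<bar>\<alpha> - \<beta>\<bar> \<le> U_op c m \<omega> \<omega>'" "0 < \<epsilon>" for \<omega> \<omega>' \<alpha> \<beta> \<epsilon>
      proof (rule two_point_approximation[OF H_minus H_plus])
        show "0 \<le> h \<omega> \<and> h \<omega> \<le> 1 \<and> 0 \<le> h \<omega>' \<and> h \<omega>' \<le> 1" if "h \<in> H" for h
          using that *(1,2) by (auto simp: H_def nonexpansive_def)
        show "\<exists>h\<in>H. U_op c m \<omega> \<omega>' - e < h \<omega> - h \<omega>'" "\<exists>h\<in>H. U_op c m \<omega> \<omega>' - e < h \<omega>' - h \<omega>" if "0 < e" for e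
          using sep[of \<omega> \<omega>' e] sep[of \<omega>' \<omega> e] *(1,2) that S.U_sym[of \<omega> \<omega>'] by auto
      qed (use * in auto)
    qed (use no in \<open>auto simp: H_lattice path_prob_space path_sets H_nonexp not_less\<close>)
    then show False using \<open>0 < e\<close> by (simp add: G_op_def)
  qed
  then show ?thesis by (auto simp: H_def)
qed

text \<open>Attainment is shown before continuity, as it yields the pseudometric axioms. Near the
  diagonal, the formula that nearly attains \<open>G_op \<P> c m x y\<close> varies with
  \<open>y\<close>, so its integrals must be close uniformly over all nonexpansive
  functions.\<close>

lemma G_op_attained:
  assumes m: "continuous_pseudometric m" and att: "attained_by m (range sig)"
  shows "continuous_pseudometric (G_op \<P> c m)" "attained_by (G_op \<P> c m) (range sig)"
    "\<And>g. nonexpansive trajectory_space (U_op c m) (tau g) \<Longrightarrow> nonexpansive borel (G_op \<P> c m) (sig (SInt g))"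
proof -
  interpret discounted m c using m by (rule discountedI)
  interpret S: separable_cost trajectory_space "U_op c m" by (rule separable_cost_trajectories)
  show ne: "nonexpansive borel (G_op \<P> c m) (sig (SInt g))"
    if g: "nonexpansive trajectory_space (U_op c m) (tau g)" for g
    unfolding nonexpansive_def
  proof (intro conjI ballI)
    show "sig (SInt g) \<in> borel_measurable borel"
      using nonexpansive_path_integral_continuous[OF discounted_axioms g]
      by (intro borel_measurable_continuous_onI) simp
    show "0 \<le> sig (SInt g) x" "sig (SInt g) x \<le> 1" for x
      using nonexpansive_integral(1)[OF g path_prob_space path_sets] by simp_all
    show "\<bar>sig (SInt g) x - sig (SInt g) y\<bar> \<le> G_op \<P> c m x y" for x y
      using transport_weak_duality_nonexpansive[OF path_prob_space path_prob_space path_sets path_sets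
          S.separable_cost_axioms g] by (simp add: G_op_def)
  qed
  show att': "attained_by (G_op \<P> c m) (range sig)"
  proof (rule attained_byI)
    show "\<exists>f\<in>range sig. nonexpansive borel (G_op \<P> c m) f \<and> G_op \<P> c m x y - e < \<bar>f x - f y\<bar>"
      if e: "0 < e" for x y e
      using G_op_approximation[OF m att e, of x y] ne by blast
    show "(\<lambda>x. 1 - f x) \<in> range sig" if f: "f \<in> range sig" for f
    proof -
      obtain f' where "f = sig f'" using f by blast
      then have "(\<lambda>x. 1 - f x) = sig (SCompl f')" by simp
      then show ?thesis by blast
    qed
  qed
  show "continuous_pseudometric (G_op \<P> c m)"
  proof (rule continuous_pseudometric_if_attained[OF att'])
    fix x :: 'e and e :: real assume e: "0 < e"
    then have e2: "0 < e / 2" by simp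
    have "((\<lambda>y. \<integral>\<omega>. h \<omega> \<partial>\<P> y) \<longlongrightarrow> (\<integral>\<omega>. h \<omega> \<partial>\<P> x)) (nhds x)"
      if "nonexpansive trajectory_space (U_op c m) h" for h
    proof -
      have "isCont (\<lambda>y. \<integral>\<omega>. h \<omega> \<partial>\<P> y) x"
        using nonexpansive_path_integral_continuous[OF discounted_axioms that]
        by (simp add: continuous_on_eq_continuous_at)
      then show ?thesis
        unfolding isCont_def by (rule iffD1[OF tendsto_at_iff_tendsto_nhds])
    qed
    then have "\<forall>\<^sub>F y in nhds x. \<forall>h. nonexpansive trajectory_space (U_op c m) h \<longrightarrow>
        \<bar>(\<integral>\<omega>. h \<omega> \<partial>\<P> x) - (\<integral>\<omega>. h \<omega> \<partial>\<P> y)\<bar> \<le> e / 2"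
      by (intro S.eventually_integrals_close path_prob_space path_sets e2) auto
    then show "\<forall>\<^sub>F y in nhds x. G_op \<P> c m x y < e"
    proof eventually_elim
      case (elim y)
      obtain g where g: "nonexpansive trajectory_space (U_op c m) (tau g)"
          "G_op \<P> c m x y - e / 2 < \<bar>sig (SInt g) x - sig (SInt g) y\<bar>"
        using G_op_approximation[OF m att e2] by blast
      then show ?case using elim by fastforce
    qed
  qed
qed

section \<open>The kernel functional and its comparison with the path functional\<close>

lemma F_op_upper:
  assumes "continuous_pseudometric m" "0 \<le> t"
  shows "c powr t * transport_cost m (P t x) (P t y) \<le> F_op P c m x y"
proof -
  interpret discounted m c using assms(1) by (rule discountedI)
  have "c powr s * transport_cost m (P s x) (P s y) \<le> 1" if s: "0 \<le> s" for s
    using powr_le_1[OF s] transport_cost_bounds[OF prob_space_kernel[OF s] prob_space_kernel[OF s]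
        sets_kernel[OF s] sets_kernel[OF s]] by (intro mult_le_one) auto
  then show ?thesis
    unfolding F_op_def using assms(2) by (intro cSUP_upper bdd_aboveI2[where M=1]) auto
qed

text \<open>Duality is applied at a single time that nearly attains the supremum. That time may be
  irrational, so it is afterwards moved to one that the modality can name.\<close>

lemma F_op_approximation:
  assumes m: "continuous_pseudometric m" and att: "attained_by m (range lam)" and "0 < e"
  shows "\<exists>f t. nonexpansive borel m (lam f) \<and>
    F_op P c m x y - e < \<bar>lam (LDiamond t f) x - lam (LDiamond t f) y\<bar>"
proof -
  interpret discounted m c using m by (rule discountedI)
  define H where "H = {h \<in> range lam. nonexpansive borel m h}"
  have H_nonexp: "nonexpansive borel m h" if "h \<in> H" for h using that by (simp add: H_def)
  have sep: "\<exists>h\<in>H. m x y - e < h x - h y" if "0 < e" for x y e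
    using att that unfolding attained_by_def H_def by fastforce
  have H_compl: "(\<lambda>x. 1 - h x) \<in> H" if h: "h \<in> H" for h
  proof -
    obtain f where "h = lam f" using h by (auto simp: H_def)
    then have "(\<lambda>x. 1 - h x) = lam (LCompl f)" by simp
    then have "(\<lambda>x. 1 - h x) \<in> range lam" by blast
    then show ?thesis using nonexpansive_compl[OF H_nonexp[OF h]] by (simp add: H_def)
  qed
  have H_minus: "(\<lambda>x. max 0 (h x - q)) \<in> H" if h: "h \<in> H" and q: "q \<in> \<rat>" "0 \<le> q" "q \<le> 1" for h q
  proof -
    obtain f where f: "h = lam f" using h by (auto simp: H_def)
    obtain r where "unit_val r = q" using unit_val_exists[OF q] .
    then have "(\<lambda>x. max 0 (h x - q)) = lam (LMinus f r)" by (simp add: f)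
    then have "(\<lambda>x. max 0 (h x - q)) \<in> range lam" by blast
    then show ?thesis using nonexpansive_minus[OF H_nonexp[OF h] q(2)] by (simp add: H_def)
  qed
  \<comment> \<open>Truncated addition and maximum are absent from the syntax; both arise by
    complementation from truncated subtraction and minimum.\<close>
  have H_plus: "(\<lambda>x. min 1 (h x + q)) \<in> H" if h: "h \<in> H" and q: "q \<in> \<rat>" "0 \<le> q" "q \<le> 1" for h q
  proof -
    have "(\<lambda>x. min 1 (h x + q)) = (\<lambda>x. 1 - max 0 ((1 - h x) - q))" by (auto simp: min_def max_def)
    then show ?thesis using H_compl[OF H_minus[OF H_compl[OF h] q]] by simp
  qed
  have H_min: "(\<lambda>x. min (g x) (h x)) \<in> H" if gh: "g \<in> H" "h \<in> H" for g h
  proof -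
    obtain g' h' where "g = lam g'" "h = lam h'" using gh by (auto simp: H_def)
    then have "(\<lambda>x. min (g x) (h x)) = lam (LMin g' h')" by simp
    then have "(\<lambda>x. min (g x) (h x)) \<in> range lam" by blast
    then show ?thesis using nonexpansive_min[OF gh[THEN H_nonexp]] by (simp add: H_def)
  qed
  have H_max: "(\<lambda>x. max (g x) (h x)) \<in> H" if gh: "g \<in> H" "h \<in> H" for g h
  proof -
    have "(\<lambda>x. max (g x) (h x)) = (\<lambda>x. 1 - min (1 - g x) (1 - h x))" by (auto simp: min_def max_def)
    then show ?thesis using H_compl[OF H_min[OF gh[THEN H_compl]]] by simp
  qed
  have ne: "{0::real..} \<noteq> {}" by simp
  have bdd: "bdd_above ((\<lambda>t. c powr t * transport_cost m (P t x) (P t y)) ` {0..})"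
    using F_op_upper[OF m] by (intro bdd_aboveI2[where M="F_op P c m x y"]) simp
  \<comment> \<open>One third of \<open>e\<close> each for the choice of \<open>t\<close>, for
    duality at \<open>t\<close> and for the passage to a rational time.\<close>
  have "F_op P c m x y - e / 3 < F_op P c m x y" using \<open>0 < e\<close> by simp
  then obtain t where t: "0 \<le> t" "F_op P c m x y - e / 3 < c powr t * transport_cost m (P t x) (P t y)"
    using less_cSUP_iff[OF ne bdd] unfolding F_op_def by auto
  note ps = prob_space_kernel[OF t(1)] and sets = sets_kernel[OF t(1)]
  have "\<exists>h\<in>H. transport_cost m (P t x) (P t y) - e / 3 < \<bar>(\<integral>z. h z \<partial>P t x) - (\<integral>z. h z \<partial>P t y)\<bar>"
  proof (rule ccontr)
    assume no: "\<not> ?thesis"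
    have "transport_cost m (P t x) (P t y) \<le> transport_cost m (P t x) (P t y) - e / 3"
    proof (rule transport_strong_duality[where H=H])
      show "\<exists>h\<in>H. \<bar>h z - \<alpha>\<bar> < \<epsilon> \<and> \<bar>h z' - \<beta>\<bar> < \<epsilon>"
        if *: "0 \<le> \<alpha>" "\<alpha> \<le> 1" "0 \<le> \<beta>" "\<beta> \<le> 1" "\<bar>\<alpha> - \<beta>\<bar> \<le> m z z'" "0 < \<epsilon>" for z z' \<alpha> \<beta> \<epsilon>
      proof (rule two_point_approximation[OF H_minus H_plus])
        show "0 \<le> h z \<and> h z \<le> 1 \<and> 0 \<le> h z' \<and> h z' \<le> 1" if "h \<in> H" for h
          using H_nonexp[OF that] by (auto simp: nonexpansive_def)
        show "\<exists>h\<in>H. m z z' - e < h z - h z'" "\<exists>h\<in>H. m z z' - e < h z' - h z" if "0 < e" for e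
          using sep[OF that, of z z'] sep[OF that, of z' z] sym[of z z'] by auto
      qed (use * in auto)
    qed (use no in \<open>auto simp: H_min H_max H_nonexp ps sets not_less\<close>)
    then show False using \<open>0 < e\<close> by simp
  qed
  then obtain f where f: "nonexpansive borel m (lam f)"
      "transport_cost m (P t x) (P t y) - e / 3 < \<bar>(\<integral>z. lam f z \<partial>P t x) - (\<integral>z. lam f z \<partial>P t y)\<bar>"
    by (auto simp: H_def)
  define D where "D s = c powr s * ((\<integral>z. lam f z \<partial>P s x) - (\<integral>z. lam f z \<partial>P s y))" for s
  have range: "0 \<le> lam f z \<and> lam f z \<le> 1" for z using f(1) by (simp add: nonexpansive_def)
  \<comment> \<open>Inherited from \<open>m\<close>, for which the formula is nonexpansive. Composed
    with continuous paths it makes \<open>D\<close> continuous in time.\<close>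
  have "continuous_on UNIV (lam f)"
  proof (rule continuous_at_imp_continuous_on, rule ballI)
    fix z
    have "(lam f \<longlongrightarrow> lam f z) (nhds z)"
    proof (rule tendstoI)
      fix e :: real assume "0 < e"
      from small[OF this, of z] show "\<forall>\<^sub>F z' in nhds z. dist (lam f z') (lam f z) < e"
      proof eventually_elim
        case (elim z')
        have "\<bar>lam f z - lam f z'\<bar> \<le> m z z'" using f(1) by (simp add: nonexpansive_def)
        then show ?case using elim by (simp add: dist_real_def)
      qed
    qed
    then show "isCont (lam f) z"
      unfolding isCont_def by (rule iffD2[OF tendsto_at_iff_tendsto_nhds])
  qed
  then have "continuous_on {0..} D"
    unfolding D_def using range c by (intro continuous_intros kernel_integral_continuous_time) auto
  moreover have "0 < e / 3" using \<open>0 < e\<close> by simp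
  ultimately obtain s where s: "s \<in> \<rat>" "0 \<le> s" "\<bar>D s - D t\<bar> < e / 3"
    using rational_approximation[OF _ t(1)] by blast
  obtain s' where s': "time_val s' = s" using time_val_exists[OF s(1,2)] .
  have "c powr t * (transport_cost m (P t x) (P t y) - \<bar>(\<integral>z. lam f z \<partial>P t x) - (\<integral>z. lam f z \<partial>P t y)\<bar>) \<le> 1 * (e / 3)"
  proof (rule mult_mono)
    show "0 \<le> transport_cost m (P t x) (P t y) - \<bar>(\<integral>z. lam f z \<partial>P t x) - (\<integral>z. lam f z \<partial>P t y)\<bar>"
      using transport_weak_duality_nonexpansive[OF ps ps sets sets separable_cost_axioms f(1)] by simp
  qed (use f(2) powr_le_1[OF t(1)] in auto)
  moreover have "c powr t * \<bar>(\<integral>z. lam f z \<partial>P t x) - (\<integral>z. lam f z \<partial>P t y)\<bar> = \<bar>D t\<bar>"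
    by (simp add: D_def abs_mult)
  ultimately have "c powr t * transport_cost m (P t x) (P t y) - e / 3 \<le> \<bar>D t\<bar>"
    by (simp only: right_diff_distrib mult_1)
  then have "F_op P c m x y - e < \<bar>D s\<bar>" using t(2) s(3) by linarith
  moreover have "D s = lam (LDiamond s' f) x - lam (LDiamond s' f) y"
    by (simp add: D_def s' algebra_simps)
  ultimately show ?thesis using f(1) by metis
qed

text \<open>Unlike for \<open>G_op\<close>, no continuity of the functional is claimed: it will come
  from domination by a continuous pseudometric. Measurability of the modal formula is read off from
  its form as a path integral.\<close>

lemma F_op_attained:
  assumes m: "continuous_pseudometric m" and att: "attained_by m (range lam)"
  shows "attained_by (F_op P c m) (range lam)"
    and "\<And>f t. nonexpansive borel m (lam f) \<Longrightarrow> nonexpansive borel (F_op P c m) (lam (LDiamond t f))"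
proof -
  interpret discounted m c using m by (rule discountedI)
  show ne: "nonexpansive borel (F_op P c m) (lam (LDiamond t f))" if f: "nonexpansive borel m (lam f)" for f t
  proof -
    let ?t = "time_val t"
    have t: "0 \<le> ?t" by (rule time_val_nonneg)
    have fm: "lam f \<in> borel_measurable borel" using f by (simp add: nonexpansive_def)
    have "lam (LDiamond t f) = (\<lambda>x. \<integral>\<omega>. c powr ?t * lam f (\<omega> ?t) \<partial>\<P> x)"
      unfolding integral_evaluation[OF fm t] lam_sem.simps ..
    then have "lam (LDiamond t f) \<in> borel_measurable borel"
      using nonexpansive_path_integral_continuous[OF discounted_axioms
          nonexpansive_evaluation[OF discounted_axioms f t]]
      by (simp only: borel_measurable_continuous_onI)
    moreover have "0 \<le> lam (LDiamond t f) x \<and> lam (LDiamond t f) x \<le> 1" for x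
      using nonexpansive_integral(1)[OF f prob_space_kernel[OF t] sets_kernel[OF t], of x] powr_le_1[OF t]
      unfolding lam_sem.simps by (intro conjI mult_nonneg_nonneg mult_le_one) auto
    moreover have "\<bar>lam (LDiamond t f) x - lam (LDiamond t f) y\<bar> \<le> F_op P c m x y" for x y
    proof -
      have "\<bar>lam (LDiamond t f) x - lam (LDiamond t f) y\<bar> =
          c powr ?t * \<bar>(\<integral>z. lam f z \<partial>P ?t x) - (\<integral>z. lam f z \<partial>P ?t y)\<bar>"
        unfolding lam_sem.simps right_diff_distrib[symmetric] abs_mult by simp
      also have "\<dots> \<le> c powr ?t * transport_cost m (P ?t x) (P ?t y)"
        using transport_weak_duality_nonexpansive[OF prob_space_kernel[OF t] prob_space_kernel[OF t]
            sets_kernel[OF t] sets_kernel[OF t] separable_cost_axioms f] by (intro mult_left_mono) auto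
      also have "\<dots> \<le> F_op P c m x y" by (rule F_op_upper[OF m t])
      finally show ?thesis .
    qed
    ultimately show ?thesis unfolding nonexpansive_def by blast
  qed
  show "attained_by (F_op P c m) (range lam)"
  proof (rule attained_byI)
    show "\<exists>f\<in>range lam. nonexpansive borel (F_op P c m) f \<and> F_op P c m x y - e < \<bar>f x - f y\<bar>"
      if e: "0 < e" for x y e
      using F_op_approximation[OF m att e, of x y] ne by blast
    show "(\<lambda>x. 1 - f x) \<in> range lam" if f: "f \<in> range lam" for f
    proof -
      obtain f' where "f = lam f'" using f by blast
      then have "(\<lambda>x. 1 - f x) = lam (LCompl f')" by simp
      then show ?thesis by blast
    qed
  qed
qed

text \<open>Uses formulas where one could push couplings of paths forward along evaluations: the
  discounted evaluation of a nearly optimal formula is a test function for \<open>U_op c m'\<close>,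
  and weak duality bounds its integrals.\<close>

lemma F_op_le_G_op:
  assumes m: "continuous_pseudometric m" "attained_by m (range lam)"
    and m': "continuous_pseudometric m'" and le: "\<And>x y. m x y \<le> m' x y"
  shows "F_op P c m x y \<le> G_op \<P> c m' x y"
proof (rule field_le_epsilon)
  fix e :: real assume "0 < e"
  interpret discounted m' c using m' by (rule discountedI)
  obtain f t where f: "nonexpansive borel m (lam f)"
      "F_op P c m x y - e < \<bar>lam (LDiamond t f) x - lam (LDiamond t f) y\<bar>"
    using F_op_approximation[OF m \<open>0 < e\<close>] by blast
  let ?t = "time_val t"
  have t: "0 \<le> ?t" by (rule time_val_nonneg)
  have fm: "lam f \<in> borel_measurable borel" using f by (simp add: nonexpansive_def)
  have "\<bar>(\<integral>\<omega>. c powr ?t * lam f (\<omega> ?t) \<partial>\<P> x) - (\<integral>\<omega>. c powr ?t * lam f (\<omega> ?t) \<partial>\<P> y)\<bar> \<le>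
      transport_cost (U_op c m') (\<P> x) (\<P> y)"
    by (rule transport_weak_duality_nonexpansive[OF path_prob_space path_prob_space path_sets path_sets
          separable_cost_trajectories
          nonexpansive_evaluation[OF discounted_axioms nonexpansive_mono[OF f(1) le] t]])
  then show "F_op P c m x y \<le> G_op \<P> c m' x y + e"
    using f(2) unfolding integral_evaluation[OF fm t] by (simp add: G_op_def)
qed

section \<open>Iteration of the functionals\<close>

lemma nonexpansive_obs: "nonexpansive borel (\<lambda>x y. \<bar>obs x - obs y\<bar>) obs"
  using obs_range borel_measurable_continuous_onI[OF obs_continuous] by (simp add: nonexpansive_def)

lemma obs_attained:
  assumes "obs \<in> S" "\<And>f. f \<in> S \<Longrightarrow> (\<lambda>x. 1 - f x) \<in> S"
  shows "attained_by (\<lambda>x y. \<bar>obs x - obs y\<bar>) S"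
  using assms nonexpansive_obs by (intro attained_byI bexI[of _ obs]) auto

lemma d_seq_attained: "continuous_pseudometric (d n) \<and> attained_by (d n) (range sig)"
proof (induction n)
  case 0
  have "sig SObs = obs" by simp
  then have "obs \<in> range sig" by (metis rangeI)
  moreover have "(\<lambda>x. 1 - f x) \<in> range sig" if f: "f \<in> range sig" for f
  proof -
    obtain f' where "f = sig f'" using f by blast
    then have "(\<lambda>x. 1 - f x) = sig (SCompl f')" by simp
    then show ?thesis by blast
  qed
  ultimately have att: "attained_by (d 0) (range sig)" using obs_attained by simp
  moreover have "continuous_pseudometric (d 0)"
  proof (rule continuous_pseudometric_if_attained[OF att])
    fix x :: 'e and e :: real assume "0 < e"
    moreover have "(obs \<longlongrightarrow> obs x) (nhds x)"
      using obs_continuous by (simp add: continuous_on_eq_continuous_at isCont_def tendsto_at_iff_tendsto_nhds)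
    ultimately show "\<forall>\<^sub>F y in nhds x. d 0 x y < e"
      by (auto dest: tendstoD simp: dist_real_def abs_minus_commute)
  qed
  ultimately show ?case by blast
next
  case (Suc n)
  then show ?case using G_op_attained(1,2)[of "d n"] by simp
qed

text \<open>The claims need a joint induction: domination at a stage uses attainment and continuity
  at the previous one, and continuity at a stage uses domination at that same stage.\<close>

lemma delta_seq_attained:
  "continuous_pseudometric (\<delta> n) \<and> attained_by (\<delta> n) (range lam) \<and> (\<forall>x y. \<delta> n x y \<le> d n x y)"
proof (induction n)
  case 0
  have "lam LObs = obs" by simp
  then have "obs \<in> range lam" by (metis rangeI)
  moreover have "(\<lambda>x. 1 - f x) \<in> range lam" if f: "f \<in> range lam" for f
  proof -
    obtain f' where "f = lam f'" using f by blast
    then have "(\<lambda>x. 1 - f x) = lam (LCompl f')" by simp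
    then show ?thesis by blast
  qed
  ultimately have "attained_by (\<delta> 0) (range lam)" using obs_attained by simp
  moreover have "\<delta> 0 = d 0" by simp
  ultimately show ?case using d_seq_attained[of 0] by simp
next
  case (Suc n)
  have att: "attained_by (\<delta> (Suc n)) (range lam)" using F_op_attained(1)[of "\<delta> n"] Suc.IH by simp
  have le: "\<delta> (Suc n) x y \<le> d (Suc n) x y" for x y
    using F_op_le_G_op[of "\<delta> n" "d n" x y] Suc.IH d_seq_attained[of n] by simp
  have "continuous_pseudometric (\<delta> (Suc n))"
  proof (rule continuous_pseudometric_if_attained[OF att])
    fix x :: 'e and e :: real assume "0 < e"
    then have "\<forall>\<^sub>F y in nhds x. d (Suc n) x y < e"
      using d_seq_attained[of "Suc n"] continuous_pseudometric.small by blast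
    then show "\<forall>\<^sub>F y in nhds x. \<delta> (Suc n) x y < e"
      by eventually_elim (use le le_less_trans in blast)
  qed
  with att le show ?case by blast
qed

text \<open>Paths start at \<open>x\<close> and time 0 is undiscounted, so evaluation at time 0 is a
  test function for the next stage that reproduces \<open>f\<close> exactly.\<close>

lemma d_seq_mono: "n \<le> k \<Longrightarrow> d n x y \<le> d k x y"
proof (induction k rule: dec_induct)
  case (step k)
  interpret discounted "d k" c using d_seq_attained by (intro discountedI) blast
  have "d k x y \<le> d (Suc k) x y"
  proof (rule field_le_epsilon)
    fix e :: real assume "0 < e"
    then obtain f where f: "nonexpansive borel (d k) f" "d k x y - e < f x - f y"
      using d_seq_attained[of k] attained_byD by blast
    then have fm: "f \<in> borel_measurable borel" by (simp add: nonexpansive_def)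
    have ev: "(\<integral>\<omega>. c powr 0 * f (\<omega> 0) \<partial>\<P> z) = f z" for z
      using integral_evaluation[OF fm order_refl, of z] integral_kernel_zero[OF fm, of z] c by simp
    have "\<bar>(\<integral>\<omega>. c powr 0 * f (\<omega> 0) \<partial>\<P> x) - (\<integral>\<omega>. c powr 0 * f (\<omega> 0) \<partial>\<P> y)\<bar> \<le> d (Suc k) x y"
      using transport_weak_duality_nonexpansive[OF path_prob_space path_prob_space path_sets path_sets
          separable_cost_trajectories nonexpansive_evaluation[OF discounted_axioms f(1) order_refl]]
      by (simp add: G_op_def)
    then show "d k x y \<le> d (Suc k) x y + e" using f(2) unfolding ev by linarith
  qed
  with step.IH show ?case by simp
qed simp

lemma delta_seq_mono: "n \<le> k \<Longrightarrow> \<delta> n x y \<le> \<delta> k x y"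
proof (induction k rule: dec_induct)
  case (step k)
  have k: "continuous_pseudometric (\<delta> k)" using delta_seq_attained by blast
  then interpret discounted "\<delta> k" c by (rule discountedI)
  have "\<delta> k x y \<le> \<delta> (Suc k) x y"
  proof (rule field_le_epsilon)
    fix e :: real assume "0 < e"
    then obtain f where f: "nonexpansive borel (\<delta> k) f" "\<delta> k x y - e < f x - f y"
      using delta_seq_attained[of k] attained_byD by blast
    then have fm: "f \<in> borel_measurable borel" by (simp add: nonexpansive_def)
    have "f x - f y \<le> transport_cost (\<delta> k) (P 0 x) (P 0 y)"
      using transport_weak_duality_nonexpansive[OF _ _ _ _ separable_cost_axioms f(1), of "P 0 x" "P 0 y"]
      by (simp add: prob_space_kernel sets_kernel integral_kernel_zero[OF fm])
    also have "\<dots> \<le> \<delta> (Suc k) x y" using F_op_upper[OF k order_refl, of x y] c by simp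
    finally show "\<delta> k x y \<le> \<delta> (Suc k) x y + e" using f(2) by linarith
  qed
  with step.IH show ?case by simp
qed simp

lemma U_op_mono:
  assumes "n \<le> k"
  shows "U_op c (d n) \<omega> \<omega>' \<le> U_op c (d k) \<omega> \<omega>'"
proof -
  interpret n: discounted "d n" c using d_seq_attained by (intro discountedI) blast
  interpret k: discounted "d k" c using d_seq_attained by (intro discountedI) blast
  show ?thesis
  proof (rule n.U_least)
    fix t :: real assume "0 \<le> t"
    have "c powr t * d n (\<omega> t) (\<omega>' t) \<le> c powr t * d k (\<omega> t) (\<omega>' t)"
      by (intro mult_left_mono d_seq_mono assms) simp
    also have "\<dots> \<le> U_op c (d k) \<omega> \<omega>'" using \<open>0 \<le> t\<close> by (rule k.U_upper)
    finally show "c powr t * d n (\<omega> t) (\<omega>' t) \<le> U_op c (d k) \<omega> \<omega>'" .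
  qed
qed

text \<open>The stage can be taken as the nesting depth of modalities: monotonicity lets binary
  connectives work at the larger of two stages, and each modality adds one.\<close>

lemma lam_nonexpansive: "\<exists>n. nonexpansive borel (\<delta> n) (lam f)"
proof (induction f)
  case (LConst q)
  show ?case by (intro exI[of _ 0]) (simp add: nonexpansive_def)
next
  case LObs
  show ?case by (intro exI[of _ 0]) (simp add: nonexpansive_obs)
next
  case (LMin f g)
  then obtain n k where "nonexpansive borel (\<delta> n) (lam f)" "nonexpansive borel (\<delta> k) (lam g)" by blast
  then have "nonexpansive borel (\<delta> (max n k)) (lam f)" "nonexpansive borel (\<delta> (max n k)) (lam g)"
    by (auto elim!: nonexpansive_mono intro: delta_seq_mono)
  from nonexpansive_min[OF this] show ?case by auto
next
  case (LCompl f)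
  then show ?case using nonexpansive_compl by fastforce
next
  case (LMinus f q)
  then show ?case using nonexpansive_minus[OF _ unit_val_nonneg[of q]] by fastforce
next
  case (LDiamond t f)
  then obtain n where "nonexpansive borel (\<delta> n) (lam f)" by blast
  then have "nonexpansive borel (\<delta> (Suc n)) (lam (LDiamond t f))"
    using F_op_attained(2)[of "\<delta> n" f t] delta_seq_attained[of n] by simp
  then show ?case by blast
qed

text \<open>Evaluation passes from states to trajectories within one stage, by the very form of
  \<open>U_op\<close>; the integral leads back to states and raises the stage by one.\<close>

lemma sigma_tau_nonexpansive:
  shows "\<exists>n. nonexpansive borel (d n) (sig f)"
    and "\<exists>n. nonexpansive trajectory_space (U_op c (d n)) (tau g)"
proof (induction f and g)
  case (SConst q)
  show ?case by (intro exI[of _ 0]) (simp add: nonexpansive_def)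
next
  case SObs
  show ?case by (intro exI[of _ 0]) (simp add: nonexpansive_obs)
next
  case (SCompl f)
  then show ?case using nonexpansive_compl by fastforce
next
  case (SInt g)
  then obtain n where n: "nonexpansive trajectory_space (U_op c (d n)) (tau g)" by blast
  have "nonexpansive borel (d (Suc n)) (sig (SInt g))"
    using G_op_attained(3)[OF _ _ n] d_seq_attained[of n] by simp
  then show ?case by blast
next
  case (TEv f t)
  then obtain n where n: "nonexpansive borel (d n) (sig f)" by blast
  have "discounted (d n) c" using d_seq_attained by (intro discountedI) blast
  from nonexpansive_evaluation[OF this n time_val_nonneg[of t]] show ?case by auto
next
  case (TMin g h)
  then obtain n k where "nonexpansive trajectory_space (U_op c (d n)) (tau g)"
      "nonexpansive trajectory_space (U_op c (d k)) (tau h)" by blast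
  then have "nonexpansive trajectory_space (U_op c (d (max n k))) (tau g)"
      "nonexpansive trajectory_space (U_op c (d (max n k))) (tau h)"
    by (auto elim!: nonexpansive_mono intro: U_op_mono)
  from nonexpansive_min[OF this] show ?case by auto
next
  case (TMax g h)
  then obtain n k where "nonexpansive trajectory_space (U_op c (d n)) (tau g)"
      "nonexpansive trajectory_space (U_op c (d k)) (tau h)" by blast
  then have "nonexpansive trajectory_space (U_op c (d (max n k))) (tau g)"
      "nonexpansive trajectory_space (U_op c (d (max n k))) (tau h)"
    by (auto elim!: nonexpansive_mono intro: U_op_mono)
  from nonexpansive_max[OF this] show ?case by auto
next
  case (TMinus g q)
  then show ?case using nonexpansive_minus[OF _ unit_val_nonneg[of q]] by fastforce
next
  case (TPlus g q)
  then show ?case using nonexpansive_plus[OF _ unit_val_nonneg[of q]] by fastforce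
qed

text \<open>The common core of both equalities: each formula is bounded by some iterate, and each
  iterate is approached by formulas. The bounds by 1 make the real suprema meaningful.\<close>

lemma SUP_seq_eq_SUP_logic:
  fixes m :: "nat \<Rightarrow> 'e \<Rightarrow> 'e \<Rightarrow> real" and sem :: "'f \<Rightarrow> 'e \<Rightarrow> real"
  assumes m: "\<And>n. continuous_pseudometric (m n)" "\<And>n. attained_by (m n) (range sem)"
    and sem: "\<And>f. \<exists>n. nonexpansive borel (m n) (sem f)"
  shows "(SUP f. \<bar>sem f x - sem f y\<bar>) = (SUP n. m n x y)"
proof (rule antisym)
  have bdd: "bdd_above (range (\<lambda>n. m n x y))"
    by (intro bdd_aboveI2[where M=1] continuous_pseudometric.le_1 m)
  have bdd': "bdd_above (range (\<lambda>f. \<bar>sem f x - sem f y\<bar>))"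
  proof (rule bdd_aboveI2[where M=1])
    fix f
    obtain n where "nonexpansive borel (m n) (sem f)" using sem by blast
    then show "\<bar>sem f x - sem f y\<bar> \<le> 1" unfolding nonexpansive_def by (auto simp: abs_le_iff; smt (verit))
  qed
  show "(SUP f. \<bar>sem f x - sem f y\<bar>) \<le> (SUP n. m n x y)"
  proof (rule cSUP_least)
    fix f
    obtain n where "nonexpansive borel (m n) (sem f)" using sem by blast
    then have "\<bar>sem f x - sem f y\<bar> \<le> m n x y" by (simp add: nonexpansive_def)
    also have "\<dots> \<le> (SUP n. m n x y)" by (intro cSUP_upper bdd) simp
    finally show "\<bar>sem f x - sem f y\<bar> \<le> (SUP n. m n x y)" .
  qed simp
  show "(SUP n. m n x y) \<le> (SUP f. \<bar>sem f x - sem f y\<bar>)"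
  proof (rule cSUP_least, simp, rule field_le_epsilon)
    fix n and e :: real assume e: "0 < e"
    obtain f where "m n x y - e < sem f x - sem f y" using attained_byD[OF m(2) e] by (metis rangeE)
    moreover have "\<bar>sem f x - sem f y\<bar> \<le> (SUP f. \<bar>sem f x - sem f y\<bar>)" by (intro cSUP_upper bdd') simp
    ultimately show "m n x y \<le> (SUP f. \<bar>sem f x - sem f y\<bar>) + e" by linarith
  qed
qed

lemma lam_metric_eq: "lam_metric P obs c x y = delta_bar P obs c x y"
  unfolding lam_metric_def delta_bar_def
  using delta_seq_attained lam_nonexpansive by (intro SUP_seq_eq_SUP_logic) blast+

lemma ell_metric_eq: "ell_metric \<P> obs c x y = d_bar \<P> obs c x y"
  unfolding ell_metric_def d_bar_def
  using d_seq_attained sigma_tau_nonexpansive(1) by (intro SUP_seq_eq_SUP_logic) blast+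

lemma delta_bar_le_d_bar: "delta_bar P obs c x y \<le> d_bar \<P> obs c x y"
  unfolding delta_bar_def d_bar_def
proof (rule cSUP_mono)
  show "bdd_above (range (\<lambda>n. d n x y))"
    using d_seq_attained by (intro bdd_aboveI2[where M=1] continuous_pseudometric.le_1) blast
  show "\<exists>k\<in>UNIV. \<delta> n x y \<le> d k x y" for n using delta_seq_attained by blast
qed simp

end

theorem theorem6p1:
  fixes T :: "real \<Rightarrow> ('e::{second_countable_topology, t2_space} \<Rightarrow> real) \<Rightarrow> 'e \<Rightarrow> real"
    and P :: "real \<Rightarrow> 'e \<Rightarrow> 'e measure"
    and \<Delta> :: "'e \<Rightarrow> 'e \<Rightarrow> real"
    and \<P> :: "'e \<Rightarrow> (real \<Rightarrow> 'e) measure"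
    and obs :: "'e \<Rightarrow> real"
    and c :: real
  assumes "diffusion T P \<Delta> \<P>"
    and "continuous_on UNIV obs"
    and "\<And>x. 0 \<le> obs x \<and> obs x \<le> 1"
    and "0 < c" and "c < 1"
  shows "\<forall>x y. lam_metric P obs c x y = delta_bar P obs c x y \<and>
               delta_bar P obs c x y \<le> d_bar \<P> obs c x y \<and>
               d_bar \<P> obs c x y = ell_metric \<P> obs c x y"
proof -
  interpret diffusion_observable T P \<Delta> \<P> obs c
    using assms by (intro diffusion_observable.intro diffusion_observable_axioms.intro)
  show ?thesis by (simp add: lam_metric_eq ell_metric_eq delta_bar_le_d_bar)
qed

end
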